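(* (Liftings of type $A_\theta$.) Let $\mu=(\mu_{ij})_{1\le i<j\le\theta+1}$ be a family of root vector parameters, and let $u(\mathcal D,\mu):=\mathcal O_q(B^+)/(\iota(\mathrm{Ker}\,\iota_\mu^* ))$ be the lifting attached to the group monomorphism $\iota_\mu:\widehat T\hookrightarrow B^+$, $\iota_\mu(\gamma)=Q_r^{-1}P_\gamma Q_r$, where $Q_r$ is the upper unitriangular matrix with entries $r_{ij}=(-1)^{i-j-1}(1-q^{-2})^N\mu_{ij}$ for $i<j$. Then the power root vector relations of $u(\mathcal D,\mu)$ are given, for all $1\le i<j\le\theta+1$, by $$x_{(ij)}^N=\mu_{ij}\big(1-g_{(ij)}^N\big)+\sum_{k=i+1}^{j-1}(1-q^{-2})^N\mu_{ik}\,x_{(kj)}^N.$$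
   Context: Everything is over $\mathbb C$. $\theta\ge1$, $I=\{1,\dots,\theta\}$; $q$ is a primitive root of unity of odd order $N>7$ with $\gcd(3,N)=1$. Type $A_\theta$: simple roots $\alpha_1,\dots,\alpha_\theta$, fundamental weights $\omega_i$, weight lattice $P=\bigoplus\mathbb Z\omega_i$, Cartan matrix $(a_{ij})$, $\alpha_i=\sum_ja_{ji}\omega_j$; positive roots $\alpha_{ij}=\alpha_i+\cdots+\alpha_{j-1}$, $1\le i<j\le\theta+1$, and $\mu_{ij}:=\mu_{\alpha_{ij}}$. $\Gamma=\prod_{i\in I}\mathbb Z/n_i\mathbb Z$ with $N\mid n_i$ for all $i$, with canonical generators $g_{\omega_1},\dots,g_{\omega_\theta}$; $g:P\to\Gamma$ is the homomorphism $\omega_i\mapsto g_{\omega_i}$, written $m\mapsto g_m$. $T\subseteq\Gamma$ is the subgroup generated by the $g_{\omega_i}^N$ and $\widehat T$ its character group. Root vector parameters: scalars $\mu_{ij}\in\mathbb C$ with $\mu_{ij}=0$ if $g_{\alpha_{ij}}^N=1$. $\mathcal O_q(B^+)$ ($B^+\subset\mathrm{SL}_{\theta+1}(\mathbb C)$ the upper triangular matrices) is the Hopf algebra generated by $z_{ij}$, $1\le i\le j\le\theta+1$ (with $z_{ij}=0$ for $i>j$), with relations: $z_{is}z_{js}=qz_{js}z_{is}$ and $z_{si}z_{sj}=qz_{sj}z_{si}$ for $i<j$; $z_{it}z_{js}=z_{js}z_{it}$ and $z_{is}z_{jt}-z_{jt}z_{is}=(q-q^{-1})z_{it}z_{js}$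 for $i<j$, $s<t$; $z_{11}\cdots z_{\theta+1,\theta+1}=1$; $\Delta(z_{ij})=\sum_kz_{ik}\otimes z_{kj}$. With $X_{ij}$ the coordinate functions on $B^+$, $\iota:\mathcal O(B^+)\hookrightarrow\mathcal O_q(B^+)$, $X_{ij}\mapsto z_{ij}^N$, is a Hopf algebra embedding with central image. $U_q^P(\mathfrak b^+)$ is the Hopf algebra generated by $K_m$ $(m\in P)$, $E_i$ $(i\in I)$ with $K_mK_{m'}=K_{m+m'}$, $K_0=1$, $K_{\omega_i}E_jK_{\omega_i}^{-1}=q^{\delta_{ij}}E_j$ and the quantum Serre relations; $K_m$ group-like, $\Delta(E_i)=E_i\otimes1+K_{\alpha_i}\otimes E_i$. There is a Hopf isomorphism $\psi:U_q^P(\mathfrak b^+)\to\mathcal O_q(B^+)$, $K_{\omega_i}\mapsto z_{11}\cdots z_{ii}$, $E_j\mapsto-(q-q^{-1})^{-1}z_{j,j+1}z_{j+1,j+1}^{-1}$. Root vectors: $E_{i,i+1}=E_i$ and $E_{i,j}=E_{i,j-1}E_{j-1}-q^{-1}E_{j-1}E_{i,j-1}$ for $j-i\ge2$. Embedding of the torus part: for $\gamma\in\widehat T$, $P_\gamma=\mathrm{diag}(t_1,\dots,t_{\theta+1})\in B^+$ is the diagonal matrix of determinant $1$ with $t_1\cdots t_i=\gamma(g_{\omega_i}^N)$ for $i\in I$ (so $t_it_{i+1}^{-1}=\gamma(g_{\alpha_i}^N)$). $\iota_\mu^*:\mathcal O(B^+)\to\mathbb C^{\widehat T}$ is the comorphism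 of $\iota_\mu$, and $(J)$ denotes the two-sided ideal generated by $J$. Let $p_\mu:\mathcal O_q(B^+)\to u(\mathcal D,\mu)$ be the projection. Put $x_{(ij)}:=p_\mu(\psi(E_{i,j}))$, $g_i:=p_\mu(\psi(K_{\alpha_i}))$ (identified with $g_{\alpha_i}\in\Gamma$), $g_{(ij)}:=g_ig_{i+1}\cdots g_{j-1}$. *)

theory Defs
  imports
    "HOL-Algebra.Algebra"
    "HOL-Library.Poly_Mapping"
    "Jordan_Normal_Form.Determinant"
begin

section \<open>Presented complex algebras\<close>

text \<open>
  A complex algebra is represented by a record of type \<^typ>\<open>(complex, 'a) module\<close>, that is, a ring
  in the sense of HOL-Algebra (not necessarily commutative) together with a scalar multiplication.
  Comultiplications are not formalized: the quotients and relations below involve only the algebra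
  structures.
\<close>

text \<open>The free monoid on \<^typ>\<open>'g\<close>, written additively as required by \<^type>\<open>poly_mapping\<close>, whose
  convolution product is then the product of the free algebra.\<close>

datatype 'g fword = Word (letters: "'g list")

instantiation fword :: (type) monoid_add
begin

definition zero_fword :: "'a fword" where "0 = Word []"

definition plus_fword :: "'a fword \<Rightarrow> 'a fword \<Rightarrow> 'a fword"
  where "u + v = Word (letters u @ letters v)"

instance by standard (auto simp: zero_fword_def plus_fword_def)

end

type_synonym 'g free_alg = "'g fword \<Rightarrow>\<^sub>0 complex"

definition gen :: "'g \<Rightarrow> 'g free_alg"
  where "gen x = Poly_Mapping.single (Word [x]) 1"

definition scal :: "complex \<Rightarrow> 'g free_alg"
  where "scal c = Poly_Mapping.single 0 c"

definition free_algebra :: "'g set \<Rightarrow> (complex, 'g free_alg) module"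
  where "free_algebra G =
    \<lparr>carrier = {f. \<forall>w \<in> Poly_Mapping.keys f. set (letters w) \<subseteq> G},
     monoid.mult = (*), one = 1, ring.zero = 0, ring.add = (+), module.smult = (\<lambda>c f. scal c * f)\<rparr>"

definition quot_algebra ::
    "(complex, 'a, 'm) module_scheme \<Rightarrow> 'a set \<Rightarrow> (complex, 'a set) module"
  where "quot_algebra A J =
    \<lparr>carrier = carrier (A Quot J), monoid.mult = monoid.mult (A Quot J), one = one (A Quot J),
     ring.zero = ring.zero (A Quot J), ring.add = ring.add (A Quot J),
     module.smult = (\<lambda>c S. \<Union>x\<in>S. J +>\<^bsub>A\<^esub> (c \<odot>\<^bsub>A\<^esub> x))\<rparr>"

text \<open>Note that \<^const>\<open>genideal\<close> is the generated two-sided ideal.\<close>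

definition presented_algebra ::
    "'g set \<Rightarrow> 'g free_alg set \<Rightarrow> (complex, 'g free_alg set) module"
  where "presented_algebra G R = quot_algebra (free_algebra G) (Idl\<^bsub>free_algebra G\<^esub> R)"

definition presented_class :: "'g set \<Rightarrow> 'g free_alg set \<Rightarrow> 'g free_alg \<Rightarrow> 'g free_alg set"
  where "presented_class G R f = (Idl\<^bsub>free_algebra G\<^esub> R) +>\<^bsub>free_algebra G\<^esub> f"

definition list_mult :: "('a, 'm) monoid_scheme \<Rightarrow> 'a list \<Rightarrow> 'a"
  where "list_mult A xs = foldr (monoid.mult A) xs \<one>\<^bsub>A\<^esub>"

text \<open>The algebra homomorphism from a free algebra to \<open>A\<close> that extends \<open>h\<close>.\<close>

definition free_lift :: "(complex, 'a, 'm) module_scheme \<Rightarrow> ('g \<Rightarrow> 'a) \<Rightarrow> 'g free_alg \<Rightarrow> 'a"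
  where "free_lift A h f =
    (\<Oplus>\<^bsub>A\<^esub>w\<in>Poly_Mapping.keys f.
        Poly_Mapping.lookup f w \<odot>\<^bsub>A\<^esub> list_mult A (map h (letters w)))"

text \<open>The algebra of all complex functions on a set, and the comorphism of a map of sets.\<close>

definition fun_algebra :: "'p set \<Rightarrow> (complex, 'p \<Rightarrow> complex) module"
  where "fun_algebra S =
    \<lparr>carrier = S \<rightarrow>\<^sub>E UNIV, monoid.mult = (\<lambda>f g. \<lambda>p\<in>S. f p * g p), one = (\<lambda>p\<in>S. 1),
     ring.zero = (\<lambda>p\<in>S. 0), ring.add = (\<lambda>f g. \<lambda>p\<in>S. f p + g p), module.smult = (\<lambda>c f. \<lambda>p\<in>S. c * f p)\<rparr>"

definition comorphism :: "'s set \<Rightarrow> ('s \<Rightarrow> 'p) \<Rightarrow> ('p \<Rightarrow> complex) \<Rightarrow> 's \<Rightarrow> complex"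
  where "comorphism S \<phi> f = (\<lambda>s\<in>S. f (\<phi> s))"

section \<open>Type A weights and the finite torus\<close>

text \<open>The weight lattice is the free abelian group on \<open>{1..\<theta>}\<close>; the fundamental weight \<open>\<omega>\<^sub>i\<close> is
  \<^term>\<open>frag_of i\<close>.\<close>

definition weight_lattice :: "nat \<Rightarrow> (nat \<Rightarrow>\<^sub>0 int) set"
  where "weight_lattice \<theta> = carrier (free_Abelian_group {1..\<theta>})"

definition cartan :: "nat \<Rightarrow> nat \<Rightarrow> int"
  where "cartan i j = (if i = j then 2 else if i = Suc j \<or> j = Suc i then - 1 else 0)"

definition simple_root :: "nat \<Rightarrow> nat \<Rightarrow> (nat \<Rightarrow>\<^sub>0 int)"
  where "simple_root \<theta> i = (\<Sum>j = 1..\<theta>. frag_cmul (cartan j i) (frag_of j))"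

definition pos_root :: "nat \<Rightarrow> nat \<Rightarrow> nat \<Rightarrow> (nat \<Rightarrow>\<^sub>0 int)"
  where "pos_root \<theta> i j = (\<Sum>k = i..<j. simple_root \<theta> k)"

definition Gam :: "nat \<Rightarrow> (nat \<Rightarrow> nat) \<Rightarrow> (nat \<Rightarrow> int) monoid"
  where "Gam \<theta> n = product_group {1..\<theta>} (\<lambda>i. integer_mod_group (n i))"

definition g_omega :: "nat \<Rightarrow> nat \<Rightarrow> (nat \<Rightarrow> int)"
  where "g_omega \<theta> i = (\<lambda>k\<in>{1..\<theta>}. if k = i then 1 else 0)"

definition g_of :: "nat \<Rightarrow> (nat \<Rightarrow> nat) \<Rightarrow> (nat \<Rightarrow>\<^sub>0 int) \<Rightarrow> (nat \<Rightarrow> int)"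
  where "g_of \<theta> n m =
    (\<Otimes>\<^bsub>Gam \<theta> n\<^esub>i\<in>{1..\<theta>}. g_omega \<theta> i [^]\<^bsub>Gam \<theta> n\<^esub> Poly_Mapping.lookup m i)"

definition T_group :: "nat \<Rightarrow> nat \<Rightarrow> (nat \<Rightarrow> nat) \<Rightarrow> (nat \<Rightarrow> int) monoid"
  where "T_group \<theta> N n =
    subgroup_generated (Gam \<theta> n) ((\<lambda>i. g_omega \<theta> i [^]\<^bsub>Gam \<theta> n\<^esub> N) ` {1..\<theta>})"

definition complex_units :: "complex monoid"
  where "complex_units = \<lparr>carrier = UNIV - {0}, monoid.mult = (*), one = 1\<rparr>"

definition char_group :: "('a, 'b) monoid_scheme \<Rightarrow> ('a \<Rightarrow> complex) monoid"
  where "char_group G =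
    \<lparr>carrier = hom G complex_units \<inter> extensional (carrier G),
     monoid.mult = (\<lambda>\<gamma> \<delta>. \<lambda>t\<in>carrier G. \<gamma> t * \<delta> t), one = (\<lambda>t\<in>carrier G. 1)\<rparr>"

text \<open>Only the values at \<open>1 \<le> i < j \<le> \<theta> + 1\<close> of a family \<open>\<mu>\<close> matter.\<close>

definition root_vector_parameters ::
    "nat \<Rightarrow> nat \<Rightarrow> (nat \<Rightarrow> nat) \<Rightarrow> (nat \<Rightarrow> nat \<Rightarrow> complex) \<Rightarrow> bool"
  where "root_vector_parameters \<theta> N n \<mu> \<longleftrightarrow>
    (\<forall>i j. 1 \<le> i \<and> i < j \<and> j \<le> \<theta> + 1 \<longrightarrow>
      g_of \<theta> n (pos_root \<theta> i j) [^]\<^bsub>Gam \<theta> n\<^esub> N = \<one>\<^bsub>Gam \<theta> n\<^esub> \<longrightarrow> \<mu> i j = 0)"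

section \<open>The Borel subgroup and its coordinate algebra\<close>

text \<open>Matrix indices of \<^type>\<open>mat\<close> start at 0, so the entry \<open>(i, j)\<close> of a matrix \<open>A\<close> is
  \<open>A $$ (i - 1, j - 1)\<close>.\<close>

definition Borel :: "nat \<Rightarrow> complex mat monoid"
  where "Borel \<theta> =
    \<lparr>carrier = {A \<in> carrier_mat (\<theta> + 1) (\<theta> + 1). upper_triangular A \<and> det A = 1},
     monoid.mult = (*), one = 1\<^sub>m (\<theta> + 1)\<rparr>"

definition upper_indices :: "nat \<Rightarrow> (nat \<times> nat) set"
  where "upper_indices \<theta> = {(i, j). 1 \<le> i \<and> i \<le> j \<and> j \<le> \<theta> + 1}"

definition coord_fun :: "nat \<Rightarrow> nat \<times> nat \<Rightarrow> complex mat \<Rightarrow> complex"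
  where "coord_fun \<theta> = (\<lambda>(i, j). \<lambda>A\<in>carrier (Borel \<theta>). A $$ (i - 1, j - 1))"

text \<open>The algebra of regular functions: the polynomial expressions in the coordinate functions.\<close>

definition O_Borel :: "nat \<Rightarrow> (complex, complex mat \<Rightarrow> complex) module"
  where "O_Borel \<theta> = (fun_algebra (carrier (Borel \<theta>)))
    \<lparr>carrier := free_lift (fun_algebra (carrier (Borel \<theta>))) (coord_fun \<theta>) `
        carrier (free_algebra (upper_indices \<theta>))\<rparr>"

section \<open>The quantized coordinate algebra\<close>

definition Z :: "nat \<Rightarrow> nat \<Rightarrow> nat \<Rightarrow> (nat \<times> nat) free_alg"
  where "Z \<theta> i j = (if (i, j) \<in> upper_indices \<theta> then gen (i, j) else 0)"

definition Oq_relators :: "nat \<Rightarrow> complex \<Rightarrow> (nat \<times> nat) free_alg set"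
  where "Oq_relators \<theta> q =
    (let I = {1..\<theta> + 1}; z = Z \<theta> in
      {z i s * z j s - scal q * z j s * z i s | i j s. i \<in> I \<and> j \<in> I \<and> s \<in> I \<and> i < j}
    \<union> {z s i * z s j - scal q * z s j * z s i | i j s. i \<in> I \<and> j \<in> I \<and> s \<in> I \<and> i < j}
    \<union> {z i t * z j s - z j s * z i t | i j s t.
        i \<in> I \<and> j \<in> I \<and> s \<in> I \<and> t \<in> I \<and> i < j \<and> s < t}
    \<union> {z i s * z j t - z j t * z i s - scal (q - inverse q) * z i t * z j s | i j s t.
        i \<in> I \<and> j \<in> I \<and> s \<in> I \<and> t \<in> I \<and> i < j \<and> s < t}
    \<union> {prod_list (map (\<lambda>i. z i i) [1..<\<theta> + 2]) - 1})"

definition Oq :: "nat \<Rightarrow> complex \<Rightarrow> (complex, (nat \<times> nat) free_alg set) module"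
  where "Oq \<theta> q = presented_algebra (upper_indices \<theta>) (Oq_relators \<theta> q)"

definition zq :: "nat \<Rightarrow> complex \<Rightarrow> nat \<Rightarrow> nat \<Rightarrow> (nat \<times> nat) free_alg set"
  where "zq \<theta> q i j = presented_class (upper_indices \<theta>) (Oq_relators \<theta> q) (Z \<theta> i j)"

text \<open>The homomorphism \<open>\<iota>\<close> determined by \<open>X\<^sub>i\<^sub>j \<mapsto> z\<^sub>i\<^sub>j\<^sup>N\<close>: its value at \<open>f\<close> is the common value of
  \<open>w(z\<^sub>i\<^sub>j\<^sup>N)\<close> over all polynomial expressions \<open>w\<close> with \<open>w(X\<^sub>i\<^sub>j) = f\<close>.\<close>

definition iota :: "nat \<Rightarrow> complex \<Rightarrow> nat \<Rightarrow> (complex mat \<Rightarrow> complex) \<Rightarrow> (nat \<times> nat) free_alg set"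
  where "iota \<theta> q N f = the_elem
    (free_lift (Oq \<theta> q) (\<lambda>(i, j). zq \<theta> q i j [^]\<^bsub>Oq \<theta> q\<^esub> N) `
      {w \<in> carrier (free_algebra (upper_indices \<theta>)).
        free_lift (fun_algebra (carrier (Borel \<theta>))) (coord_fun \<theta>) w = f})"

section \<open>The quantized Borel algebra\<close>

datatype uq_gen = Kgen "nat \<Rightarrow>\<^sub>0 int" | Egen nat

definition uq_gens :: "nat \<Rightarrow> uq_gen set"
  where "uq_gens \<theta> = Kgen ` weight_lattice \<theta> \<union> Egen ` {1..\<theta>}"

definition Uq_relators :: "nat \<Rightarrow> complex \<Rightarrow> uq_gen free_alg set"
  where "Uq_relators \<theta> q =
    (let I = {1..\<theta>}; P = weight_lattice \<theta>; K = (\<lambda>m. gen (Kgen m)); E = (\<lambda>i. gen (Egen i)) in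
      {K m * K m' - K (m + m') | m m'. m \<in> P \<and> m' \<in> P}
    \<union> {K 0 - 1}
    \<union> {K (frag_of i) * E j * K (- frag_of i) - scal (if i = j then q else 1) * E j | i j.
        i \<in> I \<and> j \<in> I}
    \<union> {E i * E j - E j * E i | i j. i \<in> I \<and> j \<in> I \<and> cartan i j = 0}
    \<union> {E i * E i * E j - scal (q + inverse q) * E i * E j * E i + E j * E i * E i | i j.
        i \<in> I \<and> j \<in> I \<and> cartan i j = - 1})"

definition Uq :: "nat \<Rightarrow> complex \<Rightarrow> (complex, uq_gen free_alg set) module"
  where "Uq \<theta> q = presented_algebra (uq_gens \<theta>) (Uq_relators \<theta> q)"

definition Kq :: "nat \<Rightarrow> complex \<Rightarrow> (nat \<Rightarrow>\<^sub>0 int) \<Rightarrow> uq_gen free_alg set"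
  where "Kq \<theta> q m = presented_class (uq_gens \<theta>) (Uq_relators \<theta> q) (gen (Kgen m))"

definition Eq :: "nat \<Rightarrow> complex \<Rightarrow> nat \<Rightarrow> uq_gen free_alg set"
  where "Eq \<theta> q i = presented_class (uq_gens \<theta>) (Uq_relators \<theta> q) (gen (Egen i))"

text \<open>The root vectors \<open>E\<^sub>i\<^sub>,\<^sub>j\<close>, meaningful for \<open>1 \<le> i < j \<le> \<theta> + 1\<close>.\<close>

fun root_vector :: "nat \<Rightarrow> complex \<Rightarrow> nat \<Rightarrow> nat \<Rightarrow> uq_gen free_alg set"
  where
    "root_vector \<theta> q i 0 = \<zero>\<^bsub>Uq \<theta> q\<^esub>"
  | "root_vector \<theta> q i (Suc j) =
      (if i < j then
         root_vector \<theta> q i j \<otimes>\<^bsub>Uq \<theta> q\<^esub> Eq \<theta> q j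
         \<ominus>\<^bsub>Uq \<theta> q\<^esub> inverse q \<odot>\<^bsub>Uq \<theta> q\<^esub> (Eq \<theta> q j \<otimes>\<^bsub>Uq \<theta> q\<^esub> root_vector \<theta> q i j)
       else if i = j then Eq \<theta> q i else \<zero>\<^bsub>Uq \<theta> q\<^esub>)"

text \<open>The isomorphism \<open>\<psi>\<close>, induced on cosets by its values on generators; on \<open>K\<^sub>m\<close> these are
  forced by those on the \<open>K\<close> of the fundamental weights.\<close>

fun psi_gen :: "nat \<Rightarrow> complex \<Rightarrow> uq_gen \<Rightarrow> (nat \<times> nat) free_alg set"
  where
    "psi_gen \<theta> q (Kgen m) = list_mult (Oq \<theta> q)
      (map (\<lambda>i. list_mult (Oq \<theta> q) (map (\<lambda>k. zq \<theta> q k k) [1..<i + 1])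
              [^]\<^bsub>Oq \<theta> q\<^esub> Poly_Mapping.lookup m i) [1..<\<theta> + 1])"
  | "psi_gen \<theta> q (Egen j) =
      (- inverse (q - inverse q)) \<odot>\<^bsub>Oq \<theta> q\<^esub>
        (zq \<theta> q j (j + 1) \<otimes>\<^bsub>Oq \<theta> q\<^esub> inv\<^bsub>Oq \<theta> q\<^esub> zq \<theta> q (j + 1) (j + 1))"

definition psi :: "nat \<Rightarrow> complex \<Rightarrow> uq_gen free_alg set \<Rightarrow> (nat \<times> nat) free_alg set"
  where "psi \<theta> q C = the_elem (free_lift (Oq \<theta> q) (psi_gen \<theta> q) ` C)"

section \<open>The lifting attached to root vector parameters\<close>

text \<open>The diagonal entries are \<open>t\<^sub>i = \<gamma>(g\<^sub>i\<^sup>N) / \<gamma>(g\<^sub>i\<^sub>-\<^sub>1\<^sup>N)\<close>, where \<open>g\<^sub>i\<close> is the generator belonging to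
  \<open>\<omega>\<^sub>i\<close> and the factors with index \<open>0\<close> and \<open>\<theta> + 1\<close> are read as 1; this is the diagonal matrix of
  determinant 1 with \<open>t\<^sub>1 \<cdots> t\<^sub>i = \<gamma>(g\<^sub>i\<^sup>N)\<close>, see \<open>torus_mat_Borel\<close> below.\<close>

definition torus_mat ::
    "nat \<Rightarrow> nat \<Rightarrow> (nat \<Rightarrow> nat) \<Rightarrow> ((nat \<Rightarrow> int) \<Rightarrow> complex) \<Rightarrow> complex mat"
  where "torus_mat \<theta> N n \<gamma> =
    (let c = (\<lambda>i. if i \<in> {1..\<theta>} then \<gamma> (g_omega \<theta> i [^]\<^bsub>Gam \<theta> n\<^esub> N) else 1)
     in mat (\<theta> + 1) (\<theta> + 1) (\<lambda>(a, b). if a = b then c (a + 1) / c a else 0))"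

definition Q_mat :: "nat \<Rightarrow> complex \<Rightarrow> nat \<Rightarrow> (nat \<Rightarrow> nat \<Rightarrow> complex) \<Rightarrow> complex mat"
  where "Q_mat \<theta> q N \<mu> =
    (let r = (\<lambda>i j. (- 1) powi (int i - int j - 1) * (1 - q powi (- 2)) ^ N * \<mu> i j)
     in mat (\<theta> + 1) (\<theta> + 1)
       (\<lambda>(a, b). if a = b then 1 else if a < b then r (a + 1) (b + 1) else 0))"

definition iota_mu ::
    "nat \<Rightarrow> complex \<Rightarrow> nat \<Rightarrow> (nat \<Rightarrow> nat) \<Rightarrow> (nat \<Rightarrow> nat \<Rightarrow> complex) \<Rightarrow>
      ((nat \<Rightarrow> int) \<Rightarrow> complex) \<Rightarrow> complex mat"
  where "iota_mu \<theta> q N n \<mu> \<gamma> =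
    inv\<^bsub>Borel \<theta>\<^esub> Q_mat \<theta> q N \<mu> * torus_mat \<theta> N n \<gamma> * Q_mat \<theta> q N \<mu>"

definition lifting_ideal ::
    "nat \<Rightarrow> complex \<Rightarrow> nat \<Rightarrow> (nat \<Rightarrow> nat) \<Rightarrow> (nat \<Rightarrow> nat \<Rightarrow> complex) \<Rightarrow> (nat \<times> nat) free_alg set set"
  where "lifting_ideal \<theta> q N n \<mu> =
    (let That = carrier (char_group (T_group \<theta> N n))
     in Idl\<^bsub>Oq \<theta> q\<^esub> (iota \<theta> q N `
          a_kernel (O_Borel \<theta>) (fun_algebra That) (comorphism That (iota_mu \<theta> q N n \<mu>))))"

definition lifting ::
    "nat \<Rightarrow> complex \<Rightarrow> nat \<Rightarrow> (nat \<Rightarrow> nat) \<Rightarrow> (nat \<Rightarrow> nat \<Rightarrow> complex) \<Rightarrow>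
      (complex, (nat \<times> nat) free_alg set set) module"
  where "lifting \<theta> q N n \<mu> = quot_algebra (Oq \<theta> q) (lifting_ideal \<theta> q N n \<mu>)"

definition p_mu ::
    "nat \<Rightarrow> complex \<Rightarrow> nat \<Rightarrow> (nat \<Rightarrow> nat) \<Rightarrow> (nat \<Rightarrow> nat \<Rightarrow> complex) \<Rightarrow>
      (nat \<times> nat) free_alg set \<Rightarrow> (nat \<times> nat) free_alg set set"
  where "p_mu \<theta> q N n \<mu> y = lifting_ideal \<theta> q N n \<mu> +>\<^bsub>Oq \<theta> q\<^esub> y"

definition x_root ::
    "nat \<Rightarrow> complex \<Rightarrow> nat \<Rightarrow> (nat \<Rightarrow> nat) \<Rightarrow> (nat \<Rightarrow> nat \<Rightarrow> complex) \<Rightarrow> nat \<Rightarrow> nat \<Rightarrow>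
      (nat \<times> nat) free_alg set set"
  where "x_root \<theta> q N n \<mu> i j = p_mu \<theta> q N n \<mu> (psi \<theta> q (root_vector \<theta> q i j))"

definition g_simple ::
    "nat \<Rightarrow> complex \<Rightarrow> nat \<Rightarrow> (nat \<Rightarrow> nat) \<Rightarrow> (nat \<Rightarrow> nat \<Rightarrow> complex) \<Rightarrow> nat \<Rightarrow>
      (nat \<times> nat) free_alg set set"
  where "g_simple \<theta> q N n \<mu> i = p_mu \<theta> q N n \<mu> (psi \<theta> q (Kq \<theta> q (simple_root \<theta> i)))"

definition g_root ::
    "nat \<Rightarrow> complex \<Rightarrow> nat \<Rightarrow> (nat \<Rightarrow> nat) \<Rightarrow> (nat \<Rightarrow> nat \<Rightarrow> complex) \<Rightarrow> nat \<Rightarrow> nat \<Rightarrow>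
      (nat \<times> nat) free_alg set set"
  where "g_root \<theta> q N n \<mu> i j =
    list_mult (lifting \<theta> q N n \<mu>) (map (g_simple \<theta> q N n \<mu>) [i..<j])"

section \<open>Basic facts\<close>

lemma free_algebra_ring: "ring (free_algebra G)"
proof -
  define C where "C = {f :: 'a free_alg. \<forall>w \<in> Poly_Mapping.keys f. set (letters w) \<subseteq> G}"
  have mult: "f * g \<in> C" if "f \<in> C" "g \<in> C" for f g
    using that keys_mult[of f g] unfolding C_def by (fastforce simp: plus_fword_def)
  have add: "f + g \<in> C" if "f \<in> C" "g \<in> C" for f g
    using that Poly_Mapping.keys_add[of f g] unfolding C_def by blast
  have neg: "- f \<in> C" if "f \<in> C" for f
    using that by (simp add: C_def Poly_Mapping.keys_minus)
  have one: "1 \<in> C" by (simp add: C_def zero_fword_def flip: single_one)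
  have zero: "0 \<in> C" by (simp add: C_def)
  have eq: "free_algebra G =
      \<lparr>carrier = C, monoid.mult = (*), one = 1, ring.zero = 0, ring.add = (+),
       module.smult = (\<lambda>c f. scal c * f)\<rparr>"
    by (simp add: free_algebra_def C_def)
  have ex: "\<exists>y\<in>C. f + y = 0" if "f \<in> C" for f
    using neg[OF that] by (intro bexI[of _ "- f"]) simp_all
  show ?thesis unfolding eq
    by (intro ringI abelian_groupI monoidI)
       (simp_all add: mult add one zero ex mult.assoc add.assoc add.commute distrib_left distrib_right)
qed

lemma Z_mem: "Z \<theta> i j \<in> carrier (free_algebra (upper_indices \<theta>))"
  by (simp add: Z_def free_algebra_def gen_def)

lemma group_Borel: "group (Borel \<theta>)"
proof (intro groupI)
  fix A B assume "A \<in> carrier (Borel \<theta>)" "B \<in> carrier (Borel \<theta>)"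
  then have A: "A \<in> carrier_mat (\<theta> + 1) (\<theta> + 1)" "upper_triangular A" "det A = 1"
    and B: "B \<in> carrier_mat (\<theta> + 1) (\<theta> + 1)" "upper_triangular B" "det B = 1"
    by (auto simp: Borel_def)
  have "upper_triangular (A * B)"
  proof (rule upper_triangularI)
    fix i j assume ij: "j < i" "i < dim_row (A * B)"
    have z: "A $$ (i, k) * B $$ (k, j) = 0" if "k < \<theta> + 1" for k
      using that ij A B upper_triangularD[OF A(2), of k i] upper_triangularD[OF B(2), of j k]
      by (cases "k < i") auto
    then show "(A * B) $$ (i, j) = 0"
      using A B ij by (auto simp: scalar_prod_def simp del: sum.op_ivl_Suc mult_eq_0_iff intro!: sum.neutral z)
  qed
  then show "A \<otimes>\<^bsub>Borel \<theta>\<^esub> B \<in> carrier (Borel \<theta>)"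
    using A B by (auto simp: Borel_def det_mult)
next
  fix A assume "A \<in> carrier (Borel \<theta>)"
  then have A: "A \<in> carrier_mat (\<theta> + 1) (\<theta> + 1)" "upper_triangular A" "det A = 1"
    by (auto simp: Borel_def)
  define B where "B = adj_mat A"
  have B: "B \<in> carrier_mat (\<theta> + 1) (\<theta> + 1)" "A * B = 1\<^sub>m (\<theta> + 1)" "B * A = 1\<^sub>m (\<theta> + 1)"
    using adj_mat[OF A(1)] A(3) by (auto simp: B_def)
  have diag: "A $$ (i, i) \<noteq> 0" if "i < \<theta> + 1" for i
  proof
    assume "A $$ (i, i) = 0"
    have "det A = (\<Prod>i = 0..<\<theta> + 1. A $$ (i, i))"
      using det_upper_triangular[OF A(2,1)] A(1) by (simp add: prod_list_diag_prod)
    also have "\<dots> = 0"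
      using that \<open>A $$ (i, i) = 0\<close> by (intro prod_zero) auto
    finally show False using A(3) by simp
  qed
  have zero: "B $$ (i, j) = 0" if "j < i" "i < \<theta> + 1" for i j
    using that
  proof (induction "\<theta> - i" arbitrary: i rule: less_induct)
    case less
    have "0 = (A * B) $$ (i, j)" using less.prems B by simp
    also have "\<dots> = (\<Sum>k = 0..<\<theta> + 1. A $$ (i, k) * B $$ (k, j))"
      using less.prems A(1) B(1) by (auto simp: scalar_prod_def)
    also have "\<dots> = (\<Sum>k\<in>{i}. A $$ (i, k) * B $$ (k, j))"
    proof (rule sum.mono_neutral_right)
      show "\<forall>k\<in>{0..<\<theta> + 1} - {i}. A $$ (i, k) * B $$ (k, j) = 0"
      proof
        fix k assume k: "k \<in> {0..<\<theta> + 1} - {i}"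
        show "A $$ (i, k) * B $$ (k, j) = 0"
        proof (cases "k < i")
          case True then show ?thesis using A less.prems upper_triangularD[OF A(2), of k i] by auto
        next
          case False
          then have "\<theta> - k < \<theta> - i" using k by auto
          then show ?thesis using k False less.hyps[of k] less.prems by auto
        qed
      qed
    qed (use less.prems in auto)
    finally show ?case using diag[of i] less.prems by simp
  qed
  have "det B = 1" using det_mult[OF B(1) A(1)] A(3) B(3) by simp
  moreover have "upper_triangular B" using zero B(1) by (intro upper_triangularI) auto
  ultimately show "\<exists>B\<in>carrier (Borel \<theta>). B \<otimes>\<^bsub>Borel \<theta>\<^esub> A = \<one>\<^bsub>Borel \<theta>\<^esub>"
    using B by (intro bexI[of _ B]) (auto simp: Borel_def)
next
  fix A B C assume "A \<in> carrier (Borel \<theta>)" "B \<in> carrier (Borel \<theta>)" "C \<in> carrier (Borel \<theta>)"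
  then show "A \<otimes>\<^bsub>Borel \<theta>\<^esub> B \<otimes>\<^bsub>Borel \<theta>\<^esub> C = A \<otimes>\<^bsub>Borel \<theta>\<^esub> (B \<otimes>\<^bsub>Borel \<theta>\<^esub> C)"
    using assoc_mult_mat[of A "\<theta> + 1" "\<theta> + 1" B "\<theta> + 1" C "\<theta> + 1"] by (simp add: Borel_def)
qed (auto simp: Borel_def)

context
  fixes \<theta> N :: nat and n :: "nat \<Rightarrow> nat"
  assumes n: "\<And>i. i \<in> {1..\<theta>} \<Longrightarrow> 1 < n i"
begin

lemma Gam_group: "group (Gam \<theta> n)"
  by (simp add: Gam_def)

lemma g_omega_mem: "g_omega \<theta> i \<in> carrier (Gam \<theta> n)"
  using n by (fastforce simp: g_omega_def Gam_def carrier_integer_mod_group)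

lemma T_gen_mem:
  assumes "i \<in> {1..\<theta>}"
  shows "g_omega \<theta> i [^]\<^bsub>Gam \<theta> n\<^esub> N \<in> carrier (T_group \<theta> N n)"
proof -
  interpret group "Gam \<theta> n" by (rule Gam_group)
  show ?thesis using assms g_omega_mem
    by (auto simp: T_group_def carrier_subgroup_generated intro!: generate.incl)
qed

lemma T_group_group: "group (T_group \<theta> N n)"
  using group.group_subgroup_generated[OF Gam_group] by (simp add: T_group_def)

lemma torus_mat_Borel:
  assumes \<gamma>: "\<gamma> \<in> carrier (char_group (T_group \<theta> N n))"
  shows "torus_mat \<theta> N n \<gamma> \<in> carrier (Borel \<theta>)"
    and "diagonal_mat (torus_mat \<theta> N n \<gamma>)"
    and "i \<in> {1..\<theta>} \<Longrightarrow>
      (\<Prod>k = 1..i. torus_mat \<theta> N n \<gamma> $$ (k - 1, k - 1)) = \<gamma> (g_omega \<theta> i [^]\<^bsub>Gam \<theta> n\<^esub> N)"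
proof -
  define c where "c = (\<lambda>i. if i \<in> {1..\<theta>} then \<gamma> (g_omega \<theta> i [^]\<^bsub>Gam \<theta> n\<^esub> N) else 1)"
  have c: "c i \<noteq> 0" for i
    using \<gamma> T_gen_mem[of i] by (auto simp: c_def char_group_def hom_def complex_units_def)
  have eq: "torus_mat \<theta> N n \<gamma> =
      mat (\<theta> + 1) (\<theta> + 1) (\<lambda>(a, b). if a = b then c (a + 1) / c a else 0)"
    unfolding torus_mat_def c_def Let_def by (rule refl)
  have c0: "c 0 = 1" by (simp add: c_def)
  have tele: "(\<Prod>k<m. c (k + 1) / c k) = c m" for m
    using c by (induction m) (auto simp: c0)
  have ut: "upper_triangular (torus_mat \<theta> N n \<gamma>)"
    by (auto simp: eq upper_triangular_def)
  have "det (torus_mat \<theta> N n \<gamma>) = (\<Prod>k = 0..<\<theta> + 1. c (k + 1) / c k)"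
    using det_upper_triangular[OF ut, of "\<theta> + 1"]
    by (simp add: eq prod_list_diag_prod)
  also have "\<dots> = 1" using tele[of "\<theta> + 1"] by (simp add: atLeast0LessThan c_def)
  finally show "torus_mat \<theta> N n \<gamma> \<in> carrier (Borel \<theta>)"
    using ut by (simp add: Borel_def eq)
  show "diagonal_mat (torus_mat \<theta> N n \<gamma>)"
    by (simp add: diagonal_mat_def eq)
  show "(\<Prod>k = 1..i. torus_mat \<theta> N n \<gamma> $$ (k - 1, k - 1)) = \<gamma> (g_omega \<theta> i [^]\<^bsub>Gam \<theta> n\<^esub> N)"
    if i: "i \<in> {1..\<theta>}"
  proof -
    have "(\<Prod>k = 1..i. torus_mat \<theta> N n \<gamma> $$ (k - 1, k - 1)) = (\<Prod>k<i. torus_mat \<theta> N n \<gamma> $$ (k, k))"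
      by (simp add: prod.atLeast1_atMost_eq)
    also have "\<dots> = (\<Prod>k<i. c (k + 1) / c k)"
      using i by (intro prod.cong) (auto simp: eq)
    finally show ?thesis using tele[of i] i by (simp add: c_def)
  qed
qed

lemma Q_mat_Borel: "Q_mat \<theta> q N \<mu> \<in> carrier (Borel \<theta>)"
proof -
  have ut: "upper_triangular (Q_mat \<theta> q N \<mu>)"
    by (auto simp: Q_mat_def upper_triangular_def Let_def)
  have "det (Q_mat \<theta> q N \<mu>) = 1"
    using det_upper_triangular[OF ut, of "\<theta> + 1"]
    by (simp add: prod_list_diag_prod Q_mat_def Let_def)
  then show ?thesis using ut by (simp add: Borel_def Q_mat_def Let_def)
qed

lemma iota_mu_mon: "iota_mu \<theta> q N n \<mu> \<in> mon (char_group (T_group \<theta> N n)) (Borel \<theta>)"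
proof -
  let ?C = "char_group (T_group \<theta> N n)" and ?P = "torus_mat \<theta> N n" and ?Q = "Q_mat \<theta> q N \<mu>"
  interpret B: group "Borel \<theta>" by (rule group_Borel)
  interpret T: group "T_group \<theta> N n" by (rule T_group_group)
  have mult: "A * B = A \<otimes>\<^bsub>Borel \<theta>\<^esub> B" for A B by (simp add: Borel_def)
  have iota: "iota_mu \<theta> q N n \<mu> \<gamma> = inv\<^bsub>Borel \<theta>\<^esub> ?Q \<otimes>\<^bsub>Borel \<theta>\<^esub> ?P \<gamma> \<otimes>\<^bsub>Borel \<theta>\<^esub> ?Q" for \<gamma>
    by (simp add: iota_mu_def mult)
  note Q = Q_mat_Borel[of q \<mu>] and P = torus_mat_Borel(1)
  have hom: "?P (\<gamma> \<otimes>\<^bsub>?C\<^esub> \<delta>) = ?P \<gamma> \<otimes>\<^bsub>Borel \<theta>\<^esub> ?P \<delta>" for \<gamma> \<delta>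
  proof (rule eq_matI)
    fix a b assume "a < dim_row (?P \<gamma> \<otimes>\<^bsub>Borel \<theta>\<^esub> ?P \<delta>)" "b < dim_col (?P \<gamma> \<otimes>\<^bsub>Borel \<theta>\<^esub> ?P \<delta>)"
    then have ab: "a < \<theta> + 1" "b < \<theta> + 1"
      by (auto simp: Borel_def torus_mat_def Let_def)
    have "(?P \<gamma> \<otimes>\<^bsub>Borel \<theta>\<^esub> ?P \<delta>) $$ (a, b) = (\<Sum>k = 0..<\<theta> + 1. ?P \<gamma> $$ (a, k) * ?P \<delta> $$ (k, b))"
      using ab by (simp add: Borel_def scalar_prod_def torus_mat_def Let_def)
    also have "\<dots> = (\<Sum>k\<in>{a}. ?P \<gamma> $$ (a, k) * ?P \<delta> $$ (k, b))"
      using ab by (intro sum.mono_neutral_right) (auto simp: torus_mat_def Let_def)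
    also have "\<dots> = ?P (\<gamma> \<otimes>\<^bsub>?C\<^esub> \<delta>) $$ (a, b)"
      using ab T_gen_mem[of a] T_gen_mem[of "Suc a"]
      by (auto simp: torus_mat_def Let_def char_group_def)
    finally show "?P (\<gamma> \<otimes>\<^bsub>?C\<^esub> \<delta>) $$ (a, b) = (?P \<gamma> \<otimes>\<^bsub>Borel \<theta>\<^esub> ?P \<delta>) $$ (a, b)" by simp
  qed (auto simp: Borel_def torus_mat_def Let_def)
  have inj: "\<gamma> = \<delta>" if \<gamma>: "\<gamma> \<in> carrier ?C" and \<delta>: "\<delta> \<in> carrier ?C" and eq: "?P \<gamma> = ?P \<delta>" for \<gamma> \<delta>
  proof (rule extensionalityI)
    interpret G: group "Gam \<theta> n" by (rule Gam_group)
    let ?S = "(\<lambda>i. g_omega \<theta> i [^]\<^bsub>Gam \<theta> n\<^esub> N) ` {1..\<theta>}"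
    have homs: "\<gamma> \<in> hom (T_group \<theta> N n) complex_units" "\<delta> \<in> hom (T_group \<theta> N n) complex_units"
      using \<gamma> \<delta> by (auto simp: char_group_def)
    have units: "group complex_units"
    proof (rule groupI)
      show "\<exists>y\<in>carrier complex_units. y \<otimes>\<^bsub>complex_units\<^esub> x = \<one>\<^bsub>complex_units\<^esub>"
        if "x \<in> carrier complex_units" for x
        using that by (intro bexI[of _ "inverse x"]) (auto simp: complex_units_def)
    qed (auto simp: complex_units_def)
    interpret h: group_hom "T_group \<theta> N n" complex_units \<gamma>
      using homs(1) units by (intro group_hom.intro group_hom_axioms.intro T_group_group)
    interpret h': group_hom "T_group \<theta> N n" complex_units \<delta>
      using homs(2) units by (intro group_hom.intro group_hom_axioms.intro T_group_group)
    have gens: "\<gamma> s = \<delta> s" if "s \<in> ?S" for s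
      using that torus_mat_Borel(3)[OF \<gamma>] torus_mat_Borel(3)[OF \<delta>] eq by auto
    have sub: "generate (Gam \<theta> n) (carrier (Gam \<theta> n) \<inter> ?S) = carrier (T_group \<theta> N n)"
      by (simp add: T_group_def carrier_subgroup_generated)
    have invs: "inv\<^bsub>Gam \<theta> n\<^esub> s = inv\<^bsub>T_group \<theta> N n\<^esub> s" if "s \<in> carrier (T_group \<theta> N n)" for s
      using that by (simp add: T_group_def)
    fix t assume "t \<in> carrier (T_group \<theta> N n)"
    then have "t \<in> generate (Gam \<theta> n) (carrier (Gam \<theta> n) \<inter> ?S)" by (simp only: sub)
    then show "\<gamma> t = \<delta> t"
    proof induction
      case one
      then show ?case using h.hom_one h'.hom_one by (simp add: T_group_def)
    next
      case (incl s)
      then show ?case using gens by blast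
    next
      case (inv s)
      then have "s \<in> carrier (T_group \<theta> N n)" using T_gen_mem by blast
      then show ?case using inv gens h.hom_inv h'.hom_inv invs by auto
    next
      case (eng s t)
      then have "s \<in> carrier (T_group \<theta> N n)" "t \<in> carrier (T_group \<theta> N n)"
        by (simp_all only: sub)
      then show ?case using eng h.hom_mult h'.hom_mult by (simp add: T_group_def)
    qed
  qed (use \<gamma> \<delta> in \<open>auto simp: char_group_def\<close>)
  show ?thesis unfolding mon_def
  proof (intro CollectI conjI homI inj_onI)
    fix \<gamma> \<delta> assume C: "\<gamma> \<in> carrier ?C" "\<delta> \<in> carrier ?C"
    show "iota_mu \<theta> q N n \<mu> \<gamma> \<in> carrier (Borel \<theta>)"
      using P[OF C(1)] Q by (simp add: iota)
    show "iota_mu \<theta> q N n \<mu> (\<gamma> \<otimes>\<^bsub>?C\<^esub> \<delta>) =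
        iota_mu \<theta> q N n \<mu> \<gamma> \<otimes>\<^bsub>Borel \<theta>\<^esub> iota_mu \<theta> q N n \<mu> \<delta>"
    proof -
      have "?Q \<otimes>\<^bsub>Borel \<theta>\<^esub> (inv\<^bsub>Borel \<theta>\<^esub> ?Q \<otimes>\<^bsub>Borel \<theta>\<^esub> A) = A" if "A \<in> carrier (Borel \<theta>)" for A
        using that Q by (simp flip: B.m_assoc)
      then show ?thesis using P[OF C(1)] P[OF C(2)] Q by (simp add: iota hom B.m_assoc)
    qed
    show "\<gamma> = \<delta>" if "iota_mu \<theta> q N n \<mu> \<gamma> = iota_mu \<theta> q N n \<mu> \<delta>"
      using that P[OF C(1)] P[OF C(2)] Q inj[OF C] by (simp add: iota)
  qed
qed

end

lemma Oq_relators_mem: "Oq_relators \<theta> q \<subseteq> carrier (free_algebra (upper_indices \<theta>))"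
proof -
  interpret ring "free_algebra (upper_indices \<theta>)" by (rule free_algebra_ring)
  let ?C = "carrier (free_algebra (upper_indices \<theta>))"
  have m: "x * y \<in> ?C" if "x \<in> ?C" "y \<in> ?C" for x y
    using m_closed[OF that] by (simp add: free_algebra_def)
  have d: "x - y \<in> ?C" if "x \<in> ?C" "y \<in> ?C" for x y
    using that Poly_Mapping.keys_diff[of x y] by (auto simp: free_algebra_def)
  have s: "scal c \<in> ?C" for c by (auto simp: free_algebra_def scal_def zero_fword_def)
  have o: "1 \<in> ?C" using one_closed by (simp add: free_algebra_def)
  have p: "prod_list (map (\<lambda>i. Z \<theta> i i) xs) \<in> ?C" for xs
    by (induction xs) (auto intro: o m Z_mem)
  show ?thesis unfolding Oq_relators_def Let_def
    by (intro Un_least) (auto intro!: d m s o p Z_mem)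
qed

lemma Uq_relators_mem: "Uq_relators \<theta> q \<subseteq> carrier (free_algebra (uq_gens \<theta>))"
proof -
  interpret ring "free_algebra (uq_gens \<theta>)" by (rule free_algebra_ring)
  let ?C = "carrier (free_algebra (uq_gens \<theta>))"
  have m: "x * y \<in> ?C" if "x \<in> ?C" "y \<in> ?C" for x y
    using m_closed[OF that] by (simp add: free_algebra_def)
  have a: "x + y \<in> ?C" if "x \<in> ?C" "y \<in> ?C" for x y
    using a_closed[OF that] by (simp add: free_algebra_def)
  have d: "x - y \<in> ?C" if "x \<in> ?C" "y \<in> ?C" for x y
    using that Poly_Mapping.keys_diff[of x y] by (auto simp: free_algebra_def)
  have s: "scal c \<in> ?C" for c by (auto simp: free_algebra_def scal_def zero_fword_def)
  have o: "1 \<in> ?C" using one_closed by (simp add: free_algebra_def)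
  have E: "gen (Egen i) \<in> ?C" if "1 \<le> i" "i \<le> \<theta>" for i
    using that by (auto simp: free_algebra_def gen_def uq_gens_def)
  have K: "gen (Kgen m) \<in> ?C" if "m \<in> weight_lattice \<theta>" for m
    using that by (auto simp: free_algebra_def gen_def uq_gens_def)
  have w: "0 \<in> weight_lattice \<theta>"
    "\<And>m m'. m \<in> weight_lattice \<theta> \<Longrightarrow> m' \<in> weight_lattice \<theta> \<Longrightarrow> m + m' \<in> weight_lattice \<theta>"
    "\<And>m. m \<in> weight_lattice \<theta> \<Longrightarrow> - m \<in> weight_lattice \<theta>"
    "\<And>i. 1 \<le> i \<Longrightarrow> i \<le> \<theta> \<Longrightarrow> frag_of i \<in> weight_lattice \<theta>"
    using Poly_Mapping.keys_add[where 'a = nat and 'b = int]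
    by (force simp: weight_lattice_def free_Abelian_group_def keys_frag_of)+
  show ?thesis unfolding Uq_relators_def Let_def
    by (intro Un_least) (auto intro!: a d m s o E K w)
qed

end

theory Submission
  imports Defs
begin

text \<open>
  Put \<open>e\<^sub>i\<^sub>j = z\<^sub>i\<^sub>j z\<^sub>j\<^sub>j\<^sup>-\<^sup>1\<close>. The commutation relations give
  \<open>e\<^sub>i\<^sub>m e\<^sub>m\<^sub>j - q\<^sup>-\<^sup>1 e\<^sub>m\<^sub>j e\<^sub>i\<^sub>m = q\<^sup>-\<^sup>1 (q - q\<^sup>-\<^sup>1) e\<^sub>i\<^sub>j\<close>, so \<open>\<psi>\<close> maps the root vector \<open>E\<^sub>i\<^sub>,\<^sub>j\<close> to an explicit
  multiple of \<open>e\<^sub>i\<^sub>j\<close>, and since \<open>z\<^sub>i\<^sub>j\<close> and \<open>z\<^sub>j\<^sub>j\<close> commute up to the factor \<open>q\<close>, where \<open>q\<close> has odd order \<open>N\<close>,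
  its \<open>N\<close>-th power is \<open>(-1)\<^sup>j\<^sup>-\<^sup>i (1 - q\<^sup>-\<^sup>2)\<^sup>-\<^sup>N z\<^sub>i\<^sub>j\<^sup>N z\<^sub>j\<^sub>j\<^sup>-\<^sup>N\<close>. A point \<open>M = Q\<^sup>-\<^sup>1 P Q\<close> of the image of \<open>\<iota>\<^sub>\<mu>\<close>
  satisfies \<open>Q M = P Q\<close>; the entry \<open>(i, j)\<close> of this identity is a linear relation between the coordinates
  \<open>M\<^sub>k\<^sub>j\<close> and \<open>M\<^sub>i\<^sub>i\<close>, that is, an element of the kernel of the comorphism. Applying \<open>\<iota>\<close> to it, multiplying by
  \<open>z\<^sub>j\<^sub>j\<^sup>-\<^sup>N\<close> and rescaling yields the power root vector relation.

  That \<open>\<iota>\<close> is well defined is not part of its definition and has to be proved. The \<open>z\<^sub>i\<^sub>j\<^sup>N\<close> commute, so a monomial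
  in them depends only on its exponents modulo the product of the diagonal coordinates, which is exactly what
  the corresponding monomial function on the Borel subgroup determines; distinct monomial functions are
  linearly independent because they are characters of a monoid.
\<close>

section \<open>Complex algebras\<close>

text \<open>The ring may be noncommutative, so compatibility of scalars with products is required in
  both factors. Scalars range over a whole type and need no carrier.\<close>

locale complex_algebra = ring A for A :: "(complex, 'a, 'm) module_scheme" (structure) +
  assumes smult_closed [simp, intro]: "x \<in> carrier A \<Longrightarrow> c \<odot> x \<in> carrier A"
    and smult_add_right: "x \<in> carrier A \<Longrightarrow> y \<in> carrier A \<Longrightarrow> c \<odot> (x \<oplus> y) = c \<odot> x \<oplus> c \<odot> y"
    and smult_add_left: "x \<in> carrier A \<Longrightarrow> (c + d) \<odot> x = c \<odot> x \<oplus> d \<odot> x"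
    and smult_smult: "x \<in> carrier A \<Longrightarrow> c \<odot> (d \<odot> x) = (c * d) \<odot> x"
    and smult_one: "x \<in> carrier A \<Longrightarrow> 1 \<odot> x = x"
    and smult_mult_left: "x \<in> carrier A \<Longrightarrow> y \<in> carrier A \<Longrightarrow> (c \<odot> x) \<otimes> y = c \<odot> (x \<otimes> y)"
    and smult_mult_right: "x \<in> carrier A \<Longrightarrow> y \<in> carrier A \<Longrightarrow> x \<otimes> (c \<odot> y) = c \<odot> (x \<otimes> y)"
begin

lemma smult_zero_left: "x \<in> carrier A \<Longrightarrow> 0 \<odot> x = \<zero>"
  using smult_add_left[of x 0 0] by (simp add: add.r_cancel_one')

lemma smult_zero_right: "c \<odot> \<zero> = \<zero>"
  using smult_add_right[of \<zero> \<zero> c] by (simp add: add.r_cancel_one')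

lemma smult_neg: "x \<in> carrier A \<Longrightarrow> (- c) \<odot> x = \<ominus> (c \<odot> x)"
  using smult_add_left[of x "- c" c] by (simp add: smult_zero_left minus_equality)

lemma smult_neg_right: "x \<in> carrier A \<Longrightarrow> c \<odot> (\<ominus> x) = \<ominus> (c \<odot> x)"
  using smult_add_right[of "\<ominus> x" x c] by (simp add: smult_zero_right l_neg minus_equality)

lemma smult_minus_right:
  "x \<in> carrier A \<Longrightarrow> y \<in> carrier A \<Longrightarrow> c \<odot> (x \<ominus> y) = c \<odot> x \<ominus> c \<odot> y"
  by (simp add: minus_eq smult_add_right smult_neg_right)

lemma smult_finsum: "f \<in> S \<rightarrow> carrier A \<Longrightarrow> c \<odot> (\<Oplus>k\<in>S. f k) = (\<Oplus>k\<in>S. c \<odot> f k)"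
  by (induction S rule: infinite_finite_induct) (auto simp: Pi_def smult_zero_right smult_add_right)

lemma list_mult_closed [simp, intro]: "set xs \<subseteq> carrier A \<Longrightarrow> list_mult A xs \<in> carrier A"
  by (induction xs) (auto simp: list_mult_def)

lemma list_mult_Nil [simp]: "list_mult A [] = \<one>"
  by (simp add: list_mult_def)

lemma list_mult_Cons [simp]: "list_mult A (x # xs) = x \<otimes> list_mult A xs"
  by (simp add: list_mult_def)

lemma list_mult_append:
  "set xs \<subseteq> carrier A \<Longrightarrow> set ys \<subseteq> carrier A \<Longrightarrow>
    list_mult A (xs @ ys) = list_mult A xs \<otimes> list_mult A ys"
  by (induction xs) (auto simp: m_assoc)

end

locale algebra_hom = source: complex_algebra A + target: complex_algebra B + ring_hom_ring A B h
  for A :: "(complex, 'a, 'm) module_scheme" and B :: "(complex, 'b, 'n) module_scheme" and h +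
  assumes hom_smult: "x \<in> carrier A \<Longrightarrow> h (c \<odot>\<^bsub>A\<^esub> x) = c \<odot>\<^bsub>B\<^esub> h x"
begin

lemma hom_minus: "x \<in> carrier A \<Longrightarrow> y \<in> carrier A \<Longrightarrow> h (x \<ominus>\<^bsub>A\<^esub> y) = h x \<ominus>\<^bsub>B\<^esub> h y"
  by (simp add: a_minus_def)

lemma hom_nat_pow: "x \<in> carrier A \<Longrightarrow> h (x [^]\<^bsub>A\<^esub> (k :: nat)) = h x [^]\<^bsub>B\<^esub> k"
  by (induction k) auto

lemma hom_list_mult:
  "set xs \<subseteq> carrier A \<Longrightarrow> h (list_mult A xs) = list_mult B (map h xs)"
  by (induction xs) auto

text \<open>The kernel is a two-sided ideal that contains \<open>S\<close>, hence it contains the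
  ideal generated by \<open>S\<close>.\<close>

lemma genideal_in_kernel:
  assumes "S \<subseteq> carrier A" "\<And>x. x \<in> S \<Longrightarrow> h x = \<zero>\<^bsub>B\<^esub>" "y \<in> Idl\<^bsub>A\<^esub> S"
  shows "h y = \<zero>\<^bsub>B\<^esub>"
proof -
  have "Idl\<^bsub>A\<^esub> S \<subseteq> a_kernel A B h"
  proof (rule source.genideal_minimal)
    show "ideal (a_kernel A B h) A" by (rule kernel_is_ideal)
    show "S \<subseteq> a_kernel A B h" unfolding a_kernel_def' using assms(1,2) by blast
  qed
  then show ?thesis using assms(3) unfolding a_kernel_def' by blast
qed

end

section \<open>Quotients by two-sided ideals\<close>

context complex_algebra
begin

lemma carrier_quot_algebra: "carrier (quot_algebra A J) = (\<lambda>x. J +> x) ` carrier A"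
  by (auto simp: quot_algebra_def FactRing_simps)

lemma ring_quot_algebra:
  assumes "ideal J A"
  shows "ring (quot_algebra A J)"
proof -
  interpret Q: ring "A Quot J" by (rule ideal.quotient_is_ring[OF assms])
  have "\<exists>y\<in>carrier (A Quot J). y \<oplus>\<^bsub>A Quot J\<^esub> x = \<zero>\<^bsub>A Quot J\<^esub>" if "x \<in> carrier (A Quot J)" for x
    using that Q.l_neg Q.a_inv_closed by blast
  then show ?thesis
    by (intro ringI abelian_groupI monoidI)
      (simp_all add: quot_algebra_def Q.m_assoc Q.a_ac Q.l_distr Q.r_distr)
qed

text \<open>The scalar action on cosets is defined as a union over representatives. It does not
  depend on them because scaling by \<open>c\<close> is multiplication by
  \<open>c \<odot> \<one>\<close>, under which a ring ideal is closed.\<close>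

lemma smult_quot_algebra:
  assumes J: "ideal J A" and x: "x \<in> carrier A"
  shows "c \<odot>\<^bsub>quot_algebra A J\<^esub> (J +> x) = J +> (c \<odot> x)"
proof -
  have "J +> (c \<odot> y) = J +> (c \<odot> x)" if "y \<in> J +> x" for y
  proof -
    interpret J: ideal J A by (fact J)
    have y: "y \<in> carrier A" using that x J.a_subset a_r_coset_subset_G by blast
    have "y \<ominus> x \<in> J"
      using quotient_eq_iff_same_a_r_cos[OF J y x] J.a_repr_independence'[OF that x] by simp
    then have "(c \<odot> \<one>) \<otimes> (y \<ominus> x) \<in> J" by (intro J.I_l_closed) auto
    moreover have "(c \<odot> \<one>) \<otimes> (y \<ominus> x) = c \<odot> y \<ominus> c \<odot> x"
      using x y by (simp add: smult_mult_left smult_minus_right)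
    ultimately show ?thesis
      using quotient_eq_iff_same_a_r_cos[OF J smult_closed[OF y] smult_closed[OF x]] by simp
  qed
  moreover have "x \<in> J +> x"
    using x J by (intro abelian_subgroup.a_rcos_self) (simp_all add: abelian_subgroupI3 ideal_def is_abelian_group)
  ultimately have "(\<Union>y\<in>J +> x. J +> (c \<odot> y)) = J +> (c \<odot> x)" by blast
  then show ?thesis by (simp only: quot_algebra_def module.simps)
qed

lemma quot_algebra_hom:
  assumes "ideal J A"
  shows "algebra_hom A (quot_algebra A J) ((+>) J)"
proof -
  let ?Q = "quot_algebra A J"
  have hom: "(+>) J \<in> Ring.ring_hom A ?Q"
    using ideal.rcos_ring_hom[OF assms] by (simp add: quot_algebra_def Ring.ring_hom_def)
  have car: "carrier ?Q = (\<lambda>x. J +> x) ` carrier A" by (rule carrier_quot_algebra)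
  have m: "(J +> x) \<otimes>\<^bsub>?Q\<^esub> (J +> y) = J +> (x \<otimes> y)"
    and a: "(J +> x) \<oplus>\<^bsub>?Q\<^esub> (J +> y) = J +> (x \<oplus> y)"
    if "x \<in> carrier A" "y \<in> carrier A" for x y
    using hom that by (simp_all add: Ring.ring_hom_def)
  note ring = ring_quot_algebra[OF assms] and smult = smult_quot_algebra[OF assms]
  have "complex_algebra ?Q"
  proof (intro complex_algebra.intro ring complex_algebra_axioms.intro)
    fix c d :: complex and U V assume "U \<in> carrier ?Q" "V \<in> carrier ?Q"
    then obtain x y where x: "x \<in> carrier A" "U = J +> x" and y: "y \<in> carrier A" "V = J +> y"
      unfolding car by blast
    show "c \<odot>\<^bsub>?Q\<^esub> U \<in> carrier ?Q" unfolding car x using smult[OF x(1)] smult_closed[OF x(1)] by simp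
    show "c \<odot>\<^bsub>?Q\<^esub> (U \<oplus>\<^bsub>?Q\<^esub> V) = c \<odot>\<^bsub>?Q\<^esub> U \<oplus>\<^bsub>?Q\<^esub> c \<odot>\<^bsub>?Q\<^esub> V"
      using x(1) y(1) unfolding x(2) y(2) by (simp add: smult a smult_add_right)
    show "(c + d) \<odot>\<^bsub>?Q\<^esub> U = c \<odot>\<^bsub>?Q\<^esub> U \<oplus>\<^bsub>?Q\<^esub> d \<odot>\<^bsub>?Q\<^esub> U"
      using x(1) y(1) unfolding x(2) y(2) by (simp add: smult a smult_add_left)
    show "c \<odot>\<^bsub>?Q\<^esub> (d \<odot>\<^bsub>?Q\<^esub> U) = (c * d) \<odot>\<^bsub>?Q\<^esub> U"
      using x(1) y(1) unfolding x(2) y(2) by (simp add: smult smult_smult)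
    show "1 \<odot>\<^bsub>?Q\<^esub> U = U"
      using x(1) y(1) unfolding x(2) y(2) by (simp add: smult smult_one)
    show "(c \<odot>\<^bsub>?Q\<^esub> U) \<otimes>\<^bsub>?Q\<^esub> V = c \<odot>\<^bsub>?Q\<^esub> (U \<otimes>\<^bsub>?Q\<^esub> V)"
      using x(1) y(1) unfolding x(2) y(2) by (simp add: smult m smult_mult_left)
    show "U \<otimes>\<^bsub>?Q\<^esub> (c \<odot>\<^bsub>?Q\<^esub> V) = c \<odot>\<^bsub>?Q\<^esub> (U \<otimes>\<^bsub>?Q\<^esub> V)"
      using x(1) y(1) unfolding x(2) y(2) by (simp add: smult m smult_mult_right)
  qed
  then show ?thesis
    by (intro algebra_hom.intro algebra_hom_axioms.intro complex_algebra_axioms ring_hom_ring.intro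
        ring_hom_ring_axioms.intro hom ring ring_axioms) (simp_all add: smult)
qed

lemma zero_quot_algebra: "\<zero>\<^bsub>quot_algebra A J\<^esub> = J"
  by (simp add: quot_algebra_def FactRing_def)

end

lemma (in ideal) coset_of_mem: "x \<in> I \<Longrightarrow> I +> x = I"
  using a_coset_join2 a_subgroup a_Hcarr by auto

text \<open>Statements that are additive in \<open>f\<close> then have to be checked on single terms
  only.\<close>

lemma poly_mapping_single_add_induct [case_names zero single add]:
  assumes "P 0" "\<And>k c. P (Poly_Mapping.single k c)" "\<And>f g. P f \<Longrightarrow> P g \<Longrightarrow> P (f + g)"
  shows "P f"
proof (induction f rule: update_induct)
  case (update f a b)
  then have "Poly_Mapping.update a b f = Poly_Mapping.single a b + f"
    by (intro poly_mapping_eqI) (auto simp: lookup_update lookup_add lookup_single when_def in_keys_iff)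
  then show ?case using assms update by simp
qed (rule assms)

lemma free_algebra_complex_algebra: "complex_algebra (free_algebra G)"
proof -
  have scal: "Poly_Mapping.keys (scal c * f) \<subseteq> Poly_Mapping.keys f" for c and f :: "'a free_alg"
    using keys_mult[of "scal c" f] by (auto simp: scal_def split: if_splits)
  \<comment> \<open>Scalars are the constants of the free algebra; being central, they can be pulled
    out of right factors.\<close>
  have comm: "f * scal c = scal c * f" for c and f :: "'a free_alg"
    by (induction f rule: poly_mapping_single_add_induct)
      (simp_all add: distrib_left distrib_right scal_def mult_single mult.commute)
  have ops: "scal (c + d) = (scal c + scal d :: 'a free_alg)" "scal (c * d) = (scal c * scal d :: 'a free_alg)"
    "scal 1 = (1 :: 'a free_alg)" for c d
    by (simp_all add: scal_def single_add mult_single)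
  have right: "f * (scal c * g) = scal c * (f * g)" for c and f g :: "'a free_alg"
    using comm[of f c] by (simp flip: mult.assoc)
  have closed: "scal c * f \<in> carrier (free_algebra G)" if "f \<in> carrier (free_algebra G)" for c f
    using that scal[of c f] by (simp add: free_algebra_def) blast
  show ?thesis
  proof (intro complex_algebra.intro free_algebra_ring complex_algebra_axioms.intro)
    fix c and f :: "'a free_alg"
    assume "f \<in> carrier (free_algebra G)"
    then show "c \<odot>\<^bsub>free_algebra G\<^esub> f \<in> carrier (free_algebra G)"
      using closed[of f c] by (simp add: free_algebra_def)
    show "f \<otimes>\<^bsub>free_algebra G\<^esub> (c \<odot>\<^bsub>free_algebra G\<^esub> g) = c \<odot>\<^bsub>free_algebra G\<^esub> (f \<otimes>\<^bsub>free_algebra G\<^esub> g)" for f g c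
      by (simp only: free_algebra_def module.simps ring.simps monoid.simps right)
  qed (simp_all only: free_algebra_def module.simps ring.simps monoid.simps distrib_left distrib_right mult.assoc ops mult_1_left)
qed

section \<open>Homomorphisms out of free and presented algebras\<close>

context complex_algebra
begin

text \<open>The support may be enlarged to any finite set, so that the sums belonging to different
  elements can be compared term by term.\<close>

lemma free_lift_eq_sum:
  assumes h: "range h \<subseteq> carrier A" and S: "finite S" "Poly_Mapping.keys f \<subseteq> S"
  shows "free_lift A h f =
    (\<Oplus>w\<in>S. Poly_Mapping.lookup f w \<odot> list_mult A (map h (letters w)))"
proof -
  have m: "list_mult A (map h ws) \<in> carrier A" for ws using h by (intro list_mult_closed) auto
  show ?thesis unfolding free_lift_def
    by (rule add.finprod_mono_neutral_cong_left[OF S])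
      (use m in \<open>auto simp: in_keys_iff smult_zero_left\<close>)
qed

lemma free_lift_single:
  assumes "range h \<subseteq> carrier A"
  shows "free_lift A h (Poly_Mapping.single w c) = c \<odot> list_mult A (map h (letters w))"
proof -
  have "list_mult A (map h (letters w)) \<in> carrier A" using assms by (intro list_mult_closed) auto
  then show ?thesis using free_lift_eq_sum[OF assms, of "{w}" "Poly_Mapping.single w c"] by simp
qed

lemma free_lift_add:
  assumes h: "range h \<subseteq> carrier A"
  shows "free_lift A h (f + g) = free_lift A h f \<oplus> free_lift A h g"
proof -
  let ?S = "Poly_Mapping.keys f \<union> Poly_Mapping.keys g"
  have m: "list_mult A (map h ws) \<in> carrier A" for ws using h by (intro list_mult_closed) auto
  have "free_lift A h (f + g) = (\<Oplus>w\<in>?S. Poly_Mapping.lookup (f + g) w \<odot> list_mult A (map h (letters w)))"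
    using Poly_Mapping.keys_add[of f g] by (intro free_lift_eq_sum h) auto
  also have "\<dots> = (\<Oplus>w\<in>?S. Poly_Mapping.lookup f w \<odot> list_mult A (map h (letters w)) \<oplus>
      Poly_Mapping.lookup g w \<odot> list_mult A (map h (letters w)))"
    by (simp add: lookup_add smult_add_left m)
  also have "\<dots> = free_lift A h f \<oplus> free_lift A h g"
    using m by (simp add: finsum_addf free_lift_eq_sum[OF h, of ?S])
  finally show ?thesis .
qed

lemma free_lift_closed:
  assumes "range h \<subseteq> carrier A"
  shows "free_lift A h f \<in> carrier A"
proof -
  have "list_mult A (map h ws) \<in> carrier A" for ws using assms by (intro list_mult_closed) auto
  then show ?thesis unfolding free_lift_def by (intro finsum_closed) auto
qed

lemma free_lift_zero: "free_lift A h 0 = \<zero>"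
  by (simp add: free_lift_def)

text \<open>Both sides are additive in each argument. This reduces the claim to two single words,
  for which concatenation becomes multiplication in \<open>A\<close>.\<close>

lemma free_lift_mult:
  assumes h: "range h \<subseteq> carrier A"
  shows "free_lift A h (f * g) = free_lift A h f \<otimes> free_lift A h g"
proof -
  have m: "list_mult A (map h ws) \<in> carrier A" for ws using h by (intro list_mult_closed) auto
  have single: "free_lift A h (Poly_Mapping.single v c * g) = free_lift A h (Poly_Mapping.single v c) \<otimes> free_lift A h g" for v c
  proof (induction g rule: poly_mapping_single_add_induct)
    case (single w d)
    have "list_mult A (map h (letters (v + w))) =
        list_mult A (map h (letters v)) \<otimes> list_mult A (map h (letters w))"
      using h by (auto simp: plus_fword_def image_subset_iff intro!: list_mult_append)
    then show ?case
      using m by (simp add: mult_single free_lift_single[OF h] smult_mult_left smult_mult_right smult_smult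
          mult.commute[of d c])
  qed (simp_all add: free_lift_zero free_lift_closed[OF h] free_lift_add[OF h] distrib_left r_distr)
  show ?thesis
    by (induction f rule: poly_mapping_single_add_induct)
      (simp_all add: single free_lift_zero free_lift_closed[OF h] free_lift_add[OF h] distrib_right l_distr)
qed

lemma free_lift_one: "range h \<subseteq> carrier A \<Longrightarrow> free_lift A h 1 = \<one>"
  using free_lift_single[of h 0 1] by (simp add: smult_one zero_fword_def flip: single_one)

lemma free_lift_scal_mult:
  assumes h: "range h \<subseteq> carrier A"
  shows "free_lift A h (scal c * f) = c \<odot> free_lift A h f"
  using free_lift_single[OF h, of 0 c] free_lift_closed[OF h, of f]
  by (simp add: free_lift_mult[OF h] scal_def zero_fword_def smult_mult_left)

lemma free_lift_gen: "range h \<subseteq> carrier A \<Longrightarrow> free_lift A h (gen x) = h x"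
  by (simp add: gen_def free_lift_single smult_one image_subset_iff)

lemma free_lift_uminus:
  assumes h: "range h \<subseteq> carrier A"
  shows "free_lift A h (- f) = \<ominus> free_lift A h f"
  using free_lift_add[OF h, of "- f" f] free_lift_closed[OF h]
  by (simp add: free_lift_zero minus_equality)

lemma free_lift_minus:
  assumes h: "range h \<subseteq> carrier A"
  shows "free_lift A h (f - g) = free_lift A h f \<ominus> free_lift A h g"
  using free_lift_add[OF h, of f "- g"] free_lift_uminus[OF h, of g] by (simp add: minus_eq)

lemma free_lift_sum:
  assumes h: "range h \<subseteq> carrier A"
  shows "free_lift A h (\<Sum>k\<in>S. f k) = (\<Oplus>k\<in>S. free_lift A h (f k))"
  by (induction S rule: infinite_finite_induct)
    (simp_all add: free_lift_zero free_lift_add[OF h] free_lift_closed[OF h])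

lemma free_lift_cong:
  assumes h: "range h \<subseteq> carrier A" and f: "f \<in> carrier (free_algebra G)"
    and eq: "\<And>x. x \<in> G \<Longrightarrow> h' x = h x"
  shows "free_lift A h' f = free_lift A h f"
proof -
  have m: "list_mult A (map h ws) \<in> carrier A" for ws using h by (intro list_mult_closed) auto
  have "map h' (letters w) = map h (letters w)" if "w \<in> Poly_Mapping.keys f" for w
    using f eq that by (auto simp: free_algebra_def)
  then show ?thesis unfolding free_lift_def
    using m by (intro finsum_cong') (auto simp del: map_eq_conv)
qed

lemma free_lift_hom:
  assumes h: "range h \<subseteq> carrier A"
  shows "algebra_hom (free_algebra G) A (free_lift A h)"
proof -
  interpret F: complex_algebra "free_algebra G" by (rule free_algebra_complex_algebra)
  have "free_lift A h \<in> Ring.ring_hom (free_algebra G) A"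
    by (rule ring_hom_memI)
      (simp_all add: free_algebra_def free_lift_closed[OF h] free_lift_mult[OF h] free_lift_add[OF h] free_lift_one[OF h])
  then show ?thesis
    by (intro algebra_hom.intro algebra_hom_axioms.intro complex_algebra_axioms F.complex_algebra_axioms
        ring_hom_ring.intro ring_hom_ring_axioms.intro ring_axioms F.ring_axioms)
      (simp_all add: free_algebra_def free_lift_scal_mult[OF h])
qed

end

section \<open>Presented algebras as quotients of free algebras\<close>

context
  fixes G :: "'g set" and R :: "'g free_alg set"
  assumes R: "R \<subseteq> carrier (free_algebra G)"
begin

lemma presented_ideal: "ideal (Idl\<^bsub>free_algebra G\<^esub> R) (free_algebra G)"
  by (rule ring.genideal_ideal[OF free_algebra_ring R])

lemma presented_class_hom:
  "algebra_hom (free_algebra G) (presented_algebra G R) (presented_class G R)"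
  using complex_algebra.quot_algebra_hom[OF free_algebra_complex_algebra presented_ideal]
  unfolding presented_algebra_def presented_class_def[abs_def] .

lemma carrier_presented_algebra:
  "carrier (presented_algebra G R) = presented_class G R ` carrier (free_algebra G)"
  unfolding presented_algebra_def presented_class_def[abs_def]
  by (rule complex_algebra.carrier_quot_algebra[OF free_algebra_complex_algebra])

lemma presented_class_relator:
  assumes "r \<in> R"
  shows "presented_class G R r = \<zero>\<^bsub>presented_algebra G R\<^esub>"
  unfolding presented_algebra_def presented_class_def
    complex_algebra.zero_quot_algebra[OF free_algebra_complex_algebra]
  using ring.genideal_self[OF free_algebra_ring R] assms
  by (intro ideal.coset_of_mem presented_ideal) blast

text \<open>Elements of the ideal are sent to zero, so the lift is constant on the coset. This is
  what makes \<open>the_elem\<close> of the image meaningful.\<close>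

lemma free_lift_presented_class:
  assumes A: "complex_algebra A" and h: "range h \<subseteq> carrier A"
    and kill: "\<And>r. r \<in> R \<Longrightarrow> free_lift A h r = \<zero>\<^bsub>A\<^esub>"
    and f: "f \<in> carrier (free_algebra G)"
  shows "the_elem (free_lift A h ` presented_class G R f) = free_lift A h f"
proof -
  interpret h: algebra_hom "free_algebra G" A "free_lift A h"
    by (rule complex_algebra.free_lift_hom[OF A h])
  interpret J: ideal "Idl\<^bsub>free_algebra G\<^esub> R" "free_algebra G" by (rule presented_ideal)
  have "free_lift A h y = free_lift A h f" if y: "y \<in> presented_class G R f" for y
  proof -
    from y obtain i where i: "i \<in> Idl\<^bsub>free_algebra G\<^esub> R" "y = i \<oplus>\<^bsub>free_algebra G\<^esub> f"
      unfolding presented_class_def a_r_coset_def r_coset_def by auto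
    have "free_lift A h i = \<zero>\<^bsub>A\<^esub>" by (rule h.genideal_in_kernel[OF R kill i(1)])
    then show ?thesis using i f by simp
  qed
  moreover have "f \<in> presented_class G R f"
    unfolding presented_class_def by (rule J.a_rcos_self[OF f])
  ultimately have "free_lift A h ` presented_class G R f = {free_lift A h f}" by blast
  then show ?thesis by simp
qed

end

section \<open>Elements that commute up to a scalar\<close>

context complex_algebra
begin

text \<open>The case \<open>c = 1\<close> is ordinary commutation, so one calculus of scalars covers
  both kinds of relations.\<close>

definition qcomm :: "complex \<Rightarrow> 'a \<Rightarrow> 'a \<Rightarrow> bool"
  where "qcomm c x y \<longleftrightarrow> x \<otimes> y = c \<odot> (y \<otimes> x)"

lemma qcomm_one_iff: "x \<in> carrier A \<Longrightarrow> y \<in> carrier A \<Longrightarrow> qcomm 1 x y \<longleftrightarrow> x \<otimes> y = y \<otimes> x"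
  by (simp add: qcomm_def smult_one)

lemma qcomm_refl: "x \<in> carrier A \<Longrightarrow> qcomm 1 x x"
  by (simp add: qcomm_one_iff)

lemma qcomm_unit_right: "x \<in> carrier A \<Longrightarrow> qcomm 1 x \<one>"
  by (simp add: qcomm_one_iff)

lemma qcomm_sym:
  assumes "x \<in> carrier A" "y \<in> carrier A" "c \<noteq> 0" "qcomm c x y"
  shows "qcomm (inverse c) y x"
  using assms by (simp add: qcomm_def smult_smult smult_one)

lemma qcomm_mult_right:
  assumes x: "x \<in> carrier A" and y: "y \<in> carrier A" and z: "z \<in> carrier A"
    and "qcomm c x y" "qcomm d x z"
  shows "qcomm (c * d) x (y \<otimes> z)"
proof -
  have "x \<otimes> (y \<otimes> z) = (c \<odot> (y \<otimes> x)) \<otimes> z" using assms by (simp add: qcomm_def flip: m_assoc)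
  also have "\<dots> = c \<odot> (y \<otimes> (x \<otimes> z))" using x y z by (simp add: smult_mult_left m_assoc)
  also have "\<dots> = (c * d) \<odot> (y \<otimes> z \<otimes> x)"
    using assms by (simp add: qcomm_def smult_mult_right smult_smult m_assoc)
  finally show ?thesis by (simp add: qcomm_def)
qed

lemma qcomm_mult_left:
  assumes x: "x \<in> carrier A" and y: "y \<in> carrier A" and z: "z \<in> carrier A"
    and "qcomm c x z" "qcomm d y z"
  shows "qcomm (c * d) (x \<otimes> y) z"
proof -
  have "x \<otimes> y \<otimes> z = x \<otimes> (d \<odot> (z \<otimes> y))" using assms by (simp add: qcomm_def m_assoc)
  also have "\<dots> = d \<odot> (x \<otimes> z \<otimes> y)" using x y z by (simp add: smult_mult_right m_assoc)
  also have "\<dots> = (c * d) \<odot> (z \<otimes> (x \<otimes> y))"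
    using assms by (simp add: qcomm_def smult_mult_left smult_smult m_assoc mult.commute[of c d])
  finally show ?thesis by (simp add: qcomm_def)
qed

lemma qcomm_smult:
  assumes "x \<in> carrier A" "y \<in> carrier A" "qcomm c x y"
  shows "qcomm c (d \<odot> x) (e \<odot> y)"
  using assms by (simp add: qcomm_def smult_mult_left smult_mult_right smult_smult mult_ac)

lemma qcomm_inv_right:
  assumes x: "x \<in> carrier A" and y: "y \<in> Units A" and "c \<noteq> 0" and xy: "qcomm c x y"
  shows "qcomm (inverse c) x (inv y)"
proof -
  have y': "y \<in> carrier A" "inv y \<in> carrier A" using y by auto
  have "inv y \<otimes> (x \<otimes> y) \<otimes> inv y = inv y \<otimes> (c \<odot> (y \<otimes> x)) \<otimes> inv y"
    using xy by (simp add: qcomm_def)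
  also have "\<dots> = c \<odot> (inv y \<otimes> y \<otimes> (x \<otimes> inv y))"
    using x y' by (simp add: smult_mult_left smult_mult_right m_assoc)
  also have "\<dots> = c \<odot> (x \<otimes> inv y)" using x y y' by simp
  also have "inv y \<otimes> (x \<otimes> y) \<otimes> inv y = inv y \<otimes> x" using x y y' by (simp add: m_assoc)
  finally show ?thesis using \<open>c \<noteq> 0\<close> x y' by (simp add: qcomm_def smult_smult smult_one)
qed

lemma qcomm_inv_left:
  assumes x: "x \<in> Units A" and y: "y \<in> carrier A" and "c \<noteq> 0" and xy: "qcomm c x y"
  shows "qcomm (inverse c) (inv x) y"
proof -
  have "qcomm c y (inv x)"
    using qcomm_inv_right[OF y x, of "inverse c"] qcomm_sym[OF _ y _ xy] assms by auto
  then show ?thesis using qcomm_sym[of y "inv x" c] assms by auto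
qed

lemma qcomm_pow_left:
  assumes "x \<in> carrier A" "y \<in> carrier A" "qcomm c x y"
  shows "qcomm (c ^ k) (x [^] (k :: nat)) y"
proof (induction k)
  case 0
  then show ?case using assms by (simp add: qcomm_one_iff)
next
  case (Suc k)
  then show ?case using qcomm_mult_left[of "x [^] k" x y "c ^ k" c] assms by (simp add: mult.commute)
qed

lemma qcomm_pow_right:
  assumes "x \<in> carrier A" "y \<in> carrier A" "qcomm c x y"
  shows "qcomm (c ^ k) x (y [^] (k :: nat))"
proof (induction k)
  case 0
  then show ?case using assms by (simp add: qcomm_one_iff)
next
  case (Suc k)
  then show ?case using qcomm_mult_right[of x "y [^] k" y "c ^ k" c] assms by (simp add: mult.commute)
qed

text \<open>Sorting the power moves each \<open>y\<close> past every later \<open>x\<close>; there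
  are \<open>k choose 2\<close> such pairs, and each costs one factor \<open>c\<close>.\<close>

lemma qcomm_mult_pow:
  assumes x: "x \<in> carrier A" and y: "y \<in> carrier A" and yx: "qcomm c y x"
  shows "(x \<otimes> y) [^] (k :: nat) = c ^ (k choose 2) \<odot> (x [^] k \<otimes> y [^] k)"
proof (induction k)
  case 0
  then show ?case by (simp add: smult_one numeral_2_eq_2)
next
  case (Suc k)
  have "(x \<otimes> y) [^] Suc k = c ^ (k choose 2) \<odot> (x [^] k \<otimes> (y [^] k \<otimes> x) \<otimes> y)"
    using x y Suc.IH by (simp add: smult_mult_left m_assoc)
  also have "y [^] k \<otimes> x = c ^ k \<odot> (x \<otimes> y [^] k)"
    using qcomm_pow_left[OF y x yx] by (simp add: qcomm_def)
  also have "c ^ (k choose 2) \<odot> (x [^] k \<otimes> (c ^ k \<odot> (x \<otimes> y [^] k)) \<otimes> y) =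
      c ^ (Suc k choose 2) \<odot> (x [^] Suc k \<otimes> y [^] Suc k)"
    using x y by (simp add: smult_mult_left smult_mult_right smult_smult m_assoc
        numeral_2_eq_2 power_add mult.commute)
  finally show ?case .
qed

lemma smult_pow: "x \<in> carrier A \<Longrightarrow> (c \<odot> x) [^] (k :: nat) = c ^ k \<odot> (x [^] k)"
  by (induction k) (simp_all add: smult_one smult_mult_left smult_mult_right smult_smult mult.commute)

text \<open>Each copy of \<open>a\<close> that passes \<open>d\<close> leaves a copy of
  \<open>w\<close> behind. Carrying the copies of \<open>a\<close> to the left of this
  \<open>w\<close> across it costs a power of \<open>c\<close>, and these powers add up to a
  geometric sum.\<close>

lemma pow_commutator:
  assumes a: "a \<in> carrier A" and d: "d \<in> carrier A" and w: "w \<in> carrier A"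
    and ad: "a \<otimes> d = d \<otimes> a \<oplus> k \<odot> w" and aw: "qcomm c a w"
  shows "a [^] Suc m \<otimes> d = d \<otimes> a [^] Suc m \<oplus> (k * (\<Sum>i\<le>m. c ^ i)) \<odot> (w \<otimes> a [^] m)"
proof (induction m)
  case 0
  then show ?case using a d w ad by simp
next
  case (Suc m)
  have aw': "a \<otimes> w = c \<odot> (w \<otimes> a)" using aw by (simp add: qcomm_def)
  let ?s = "k * (\<Sum>i\<le>m. c ^ i)"
  have pow: "a \<otimes> a [^] j = a [^] Suc j" for j :: nat
    using a nat_pow_Suc2 by simp
  have "a [^] Suc (Suc m) \<otimes> d = a \<otimes> (a [^] Suc m \<otimes> d)"
    using a d pow[of "Suc m"] m_assoc[of a "a [^] Suc m" d] by simp
  also have "\<dots> = a \<otimes> (d \<otimes> a [^] Suc m) \<oplus> a \<otimes> (?s \<odot> (w \<otimes> a [^] m))"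
    using a d w Suc.IH by (simp only: r_distr m_closed nat_pow_closed smult_closed)
  also have "a \<otimes> (d \<otimes> a [^] Suc m) = (d \<otimes> a \<oplus> k \<odot> w) \<otimes> a [^] Suc m"
    using a d ad m_assoc[of a d "a [^] Suc m"] by simp
  also have "\<dots> = d \<otimes> a [^] Suc (Suc m) \<oplus> k \<odot> (w \<otimes> a [^] Suc m)"
    using a d w pow[of "Suc m"] m_assoc[of d a "a [^] Suc m"]
    by (simp only: l_distr m_closed nat_pow_closed smult_closed smult_mult_left)
  also have "a \<otimes> (?s \<odot> (w \<otimes> a [^] m)) = ?s \<odot> ((a \<otimes> w) \<otimes> a [^] m)"
    using a w by (simp add: smult_mult_right m_assoc)
  also have "\<dots> = (?s * c) \<odot> (w \<otimes> a [^] Suc m)"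
    using a w pow[of m] by (simp only: aw' smult_mult_left smult_smult m_assoc m_closed nat_pow_closed)
  also have "d \<otimes> a [^] Suc (Suc m) \<oplus> k \<odot> (w \<otimes> a [^] Suc m) \<oplus> (?s * c) \<odot> (w \<otimes> a [^] Suc m) =
      d \<otimes> a [^] Suc (Suc m) \<oplus> (k + ?s * c) \<odot> (w \<otimes> a [^] Suc m)"
    using a d w by (simp add: smult_add_left a_assoc del: nat_pow_Suc)
  \<comment> \<open>Horner form of the geometric sum.\<close>
  also have "k + ?s * c = k * (\<Sum>i\<le>Suc m. c ^ i)"
    by (simp add: sum.atMost_Suc_shift sum_distrib_right sum_distrib_left distrib_left mult_ac del: sum.atMost_Suc)
  finally show ?case .
qed

text \<open>The error term of \<open>pow_commutator\<close> carries the full geometric sum of a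
  nontrivial root of unity, which vanishes.\<close>

lemma pow_commute_root_of_unity:
  assumes "a \<in> carrier A" "d \<in> carrier A" "w \<in> carrier A"
    and "a \<otimes> d = d \<otimes> a \<oplus> k \<odot> w" "qcomm c a w"
    and c: "c ^ m = 1" "c \<noteq> 1"
  shows "qcomm 1 (a [^] m) d"
proof (cases m)
  case 0
  then show ?thesis using assms(2) by (simp add: qcomm_one_iff)
next
  case (Suc l)
  have "(\<Sum>i\<le>l. c ^ i) = 0"
    using geometric_sum[OF c(2), of m] c(1) Suc by (simp add: lessThan_Suc_atMost)
  then show ?thesis using pow_commutator[OF assms(1-5), of l] assms(1-3) Suc
    by (simp add: qcomm_one_iff smult_zero_left)
qed

section \<open>Products of lists of commuting elements\<close>

lemma qcomm_list_mult_right: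
  assumes "x \<in> carrier A" "set xs \<subseteq> carrier A" "\<And>y. y \<in> set xs \<Longrightarrow> qcomm 1 x y"
  shows "qcomm 1 x (list_mult A xs)"
  using assms(2,3)
proof (induction xs)
  case Nil
  then show ?case using assms(1) by (simp add: qcomm_unit_right)
next
  case (Cons y ys)
  then show ?case using qcomm_mult_right[of x y "list_mult A ys" 1 1] assms(1) by simp
qed

lemma list_mult_map_mult:
  assumes "f ` set xs \<subseteq> carrier A" "g ` set xs \<subseteq> carrier A"
    and "\<And>i j. i \<in> set xs \<Longrightarrow> j \<in> set xs \<Longrightarrow> qcomm 1 (g i) (f j)"
  shows "list_mult A (map (\<lambda>i. f i \<otimes> g i) xs) = list_mult A (map f xs) \<otimes> list_mult A (map g xs)"
  using assms
proof (induction xs)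
  case (Cons x xs)
  let ?F = "list_mult A (map f xs)" and ?G = "list_mult A (map g xs)"
  have car: "f x \<in> carrier A" "g x \<in> carrier A" "?F \<in> carrier A" "?G \<in> carrier A"
    using Cons.prems by (auto intro!: list_mult_closed)
  have "qcomm 1 (g x) ?F" using Cons.prems by (intro qcomm_list_mult_right) auto
  then have "g x \<otimes> ?F = ?F \<otimes> g x" using car by (simp add: qcomm_one_iff)
  then have "g x \<otimes> (?F \<otimes> ?G) = ?F \<otimes> (g x \<otimes> ?G)" using car by (simp flip: m_assoc)
  then show ?case using Cons car by (simp add: m_assoc)
qed simp

lemma list_mult_map_pow:
  assumes "f ` set xs \<subseteq> carrier A"
    and "\<And>i j. i \<in> set xs \<Longrightarrow> j \<in> set xs \<Longrightarrow> qcomm 1 (f i) (f j)"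
  shows "list_mult A (map (\<lambda>i. f i [^] (k :: nat)) xs) = list_mult A (map f xs) [^] k"
proof (induction k)
  case 0
  then show ?case by (induction xs) auto
next
  case (Suc k)
  have "qcomm 1 (f i) (f j [^] k)" if "i \<in> set xs" "j \<in> set xs" for i j
    using qcomm_pow_right[of "f i" "f j" 1 k] that assms by auto
  then have "list_mult A (map (\<lambda>i. f i [^] k \<otimes> f i) xs) = list_mult A (map (\<lambda>i. f i [^] k) xs) \<otimes> list_mult A (map f xs)"
    using assms by (intro list_mult_map_mult) auto
  then show ?case using Suc by simp
qed

lemma list_mult_remove1:
  assumes "set xs \<subseteq> carrier A" "x \<in> set xs" "\<And>y. y \<in> set xs \<Longrightarrow> qcomm 1 x y"
  shows "list_mult A xs = x \<otimes> list_mult A (remove1 x xs)"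
  using assms
proof (induction xs)
  case (Cons y ys)
  show ?case
  proof (cases "x = y")
    case False
    have car: "x \<in> carrier A" "y \<in> carrier A" "list_mult A (remove1 x ys) \<in> carrier A"
      using Cons.prems set_remove1_subset[of x ys] by (auto intro!: list_mult_closed)
    have "qcomm 1 x y" using Cons.prems by simp
    then have "x \<otimes> y = y \<otimes> x" using car by (simp add: qcomm_one_iff)
    then have "y \<otimes> (x \<otimes> list_mult A (remove1 x ys)) = x \<otimes> (y \<otimes> list_mult A (remove1 x ys))"
      using car by (simp flip: m_assoc)
    then show ?thesis using False Cons by auto
  qed simp
qed simp

lemma list_mult_mset_eq:
  assumes "set xs \<subseteq> carrier A" "mset xs = mset ys"
    and "\<And>x y. x \<in> set xs \<Longrightarrow> y \<in> set xs \<Longrightarrow> qcomm 1 x y"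
  shows "list_mult A xs = list_mult A ys"
  using assms
proof (induction xs arbitrary: ys)
  case (Cons x xs)
  have set: "set ys = set (x # xs)" using Cons.prems(2) by (metis set_mset_mset)
  have "list_mult A ys = x \<otimes> list_mult A (remove1 x ys)"
    using Cons.prems set by (intro list_mult_remove1) auto
  moreover have "mset xs = mset (remove1 x ys)" using Cons.prems(2) by (metis add_mset_remove_trivial mset.simps(2) mset_remove1)
  then have "list_mult A xs = list_mult A (remove1 x ys)" using Cons.prems by (intro Cons.IH) auto
  ultimately show ?case by simp
qed simp

text \<open>With \<open>x\<close> moved to the front, the remaining product times the inverse of the
  whole is a right inverse of \<open>x\<close>. The same two factors in the other order give a left
  inverse, and the two inverses agree.\<close>

lemma Units_of_list_mult_Units:
  assumes "set xs \<subseteq> carrier A" "list_mult A xs \<in> Units A" "x \<in> set xs"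
    and "\<And>x y. x \<in> set xs \<Longrightarrow> y \<in> set xs \<Longrightarrow> qcomm 1 x y"
  shows "x \<in> Units A"
proof -
  let ?y = "list_mult A (remove1 x xs)" and ?u = "list_mult A xs"
  have car: "x \<in> carrier A" "?y \<in> carrier A" "inv ?u \<in> carrier A"
    using assms set_remove1_subset[of x xs] by (auto intro!: list_mult_closed)
  have u: "?u = x \<otimes> ?y" using assms by (intro list_mult_remove1) auto
  have "qcomm 1 x ?y"
    using assms set_remove1_subset[of x xs] by (intro qcomm_list_mult_right) auto
  then have yx: "?u = ?y \<otimes> x" using u car by (simp add: qcomm_one_iff)
  have r: "x \<otimes> (?y \<otimes> inv ?u) = \<one>" using assms(2) car u by (simp flip: m_assoc)
  have l: "(inv ?u \<otimes> ?y) \<otimes> x = \<one>" using assms(2) car yx by (simp add: m_assoc)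
  have "inv ?u \<otimes> ?y = ?y \<otimes> inv ?u" using inv_unique[OF l r] car by simp
  then have "(?y \<otimes> inv ?u) \<otimes> x = \<one>" using l by simp
  moreover have "?y \<otimes> inv ?u \<in> carrier A" using car by simp
  ultimately have "\<exists>z\<in>carrier A. z \<otimes> x = \<one> \<and> x \<otimes> z = \<one>" using r by (intro bexI conjI)
  then show ?thesis using car(1) unfolding Units_def by (intro CollectI conjI)
qed

section \<open>Integer powers of units\<close>

lemma inv_pow_Units:
  assumes "x \<in> Units A"
  shows "inv x [^] (k :: nat) = inv (x [^] k)"
  using group.nat_pow_inv[OF units_group, of x k] assms
  unfolding units_of_carrier units_of_inv[OF assms] units_of_pow[OF Units_inv_Units[OF assms]]
    units_of_pow[OF assms] units_of_inv[OF Units_pow_closed[OF assms]] by simp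

text \<open>Integer powers are moved to the group of units, where the exponent laws of groups
  apply.\<close>

lemma Units_int_pow:
  assumes "x \<in> Units A"
  shows "x [^]\<^bsub>units_of A\<^esub> (k :: int) = x [^] k"
  unfolding int_pow_def2 units_of_pow[OF assms] units_of_inv[OF Units_pow_closed[OF assms]] ..

lemma int_pow_Units:
  assumes "x \<in> Units A"
  shows "x [^] (k :: int) \<in> Units A"
  using group.int_pow_closed[OF units_group, of x k] assms by (simp add: units_of_carrier Units_int_pow)

lemma int_pow_add_Units:
  assumes "x \<in> Units A"
  shows "x [^] (k + l :: int) = x [^] k \<otimes> x [^] l"
  using group.int_pow_mult[OF units_group, of x k l] assms
  by (simp add: units_of_carrier Units_int_pow units_of_mult)

lemma qcomm_int_pow_right:
  assumes "x \<in> carrier A" "y \<in> Units A" "qcomm 1 x y"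
  shows "qcomm 1 x (y [^] (k :: int))"
proof -
  have pow: "qcomm 1 x (y [^] (l :: nat))" for l
    using qcomm_pow_right[OF assms(1) Units_closed[OF assms(2)] assms(3), of l] by simp
  have "qcomm 1 x (inv (y [^] (l :: nat)))" for l
    using qcomm_inv_right[OF assms(1) Units_pow_closed[OF assms(2)] _ pow, of l] by simp
  then show ?thesis using pow by (simp only: int_pow_def2 split: if_split) blast
qed

lemma Units_list_mult: "set xs \<subseteq> Units A \<Longrightarrow> list_mult A xs \<in> Units A"
  by (induction xs) auto

end

section \<open>Commutation relations in the quantized coordinate algebra\<close>

text \<open>Four exchanges of factors take place: \<open>x\<close> with \<open>y\<close> costs
  \<open>a\<close>, the two exchanges that involve one inverted factor cost the inverses of
  \<open>b\<close> and \<open>c\<close>, and the inverted factors commute with each other.\<close>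

lemma (in complex_algebra) qcomm_frac:
  assumes car: "x \<in> carrier A" "y \<in> carrier A" "u \<in> Units A" "v \<in> Units A"
    and nz: "b \<noteq> 0" "c \<noteq> 0"
    and q: "qcomm a x y" "qcomm b x v" "qcomm c u y" "qcomm 1 u v"
  shows "qcomm (a * inverse b * inverse c) (x \<otimes> inv u) (y \<otimes> inv v)"
proof -
  have car': "inv u \<in> carrier A" "inv v \<in> carrier A" "u \<in> carrier A" "v \<in> carrier A" using car by auto
  have "qcomm 1 (inv u) v" using qcomm_inv_left[of u v 1] car q(4) by auto
  then have "qcomm 1 (inv u) (inv v)" using qcomm_inv_right[of "inv u" v 1] car by auto
  then have "qcomm (inverse c * 1) (inv u) (y \<otimes> inv v)"
    using qcomm_inv_left[OF car(3,2) nz(2) q(3)] car car' by (intro qcomm_mult_right) auto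
  moreover have "qcomm (a * inverse b) x (y \<otimes> inv v)"
    using qcomm_inv_right[OF car(1,4) nz(1) q(2)] q(1) car car' by (intro qcomm_mult_right) auto
  ultimately have "qcomm (a * inverse b * (inverse c * 1)) (x \<otimes> inv u) (y \<otimes> inv v)"
    using car car' by (intro qcomm_mult_left) auto
  then show ?thesis by (simp add: mult.assoc)
qed

text \<open>The relations of the quantized coordinate algebra for an abstract family of generators,
  so that the computations do not involve cosets of a free algebra.\<close>

locale quantum_borel = complex_algebra A for A :: "(complex, 'a, 'm) module_scheme" (structure) +
  fixes \<theta> :: nat and q :: complex and z :: "nat \<Rightarrow> nat \<Rightarrow> 'a"
  assumes q_nonzero: "q \<noteq> 0"
    and z_closed [simp, intro]: "z i j \<in> carrier A"
    and z_lower: "j < i \<Longrightarrow> z i j = \<zero>"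
    and z_column: "{i, j, s} \<subseteq> {1..\<theta> + 1} \<Longrightarrow> i < j \<Longrightarrow> qcomm q (z i s) (z j s)"
    and z_row: "{i, j, s} \<subseteq> {1..\<theta> + 1} \<Longrightarrow> i < j \<Longrightarrow> qcomm q (z s i) (z s j)"
    and z_antidiagonal: "{i, j, s, t} \<subseteq> {1..\<theta> + 1} \<Longrightarrow> i < j \<Longrightarrow> s < t \<Longrightarrow> qcomm 1 (z i t) (z j s)"
    and z_diagonal: "{i, j, s, t} \<subseteq> {1..\<theta> + 1} \<Longrightarrow> i < j \<Longrightarrow> s < t \<Longrightarrow>
      z i s \<otimes> z j t = z j t \<otimes> z i s \<oplus> (q - inverse q) \<odot> (z i t \<otimes> z j s)"
    and z_det: "list_mult A (map (\<lambda>i. z i i) [1..<\<theta> + 2]) = \<one>"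
begin

text \<open>The correction term of the diagonal relation contains \<open>z j s\<close>, which lies
  below the diagonal and is zero.\<close>

lemma z_diagonal_commute:
  assumes "{i, j, s, t} \<subseteq> {1..\<theta> + 1}" "i < j" "s < t" "s < j"
  shows "qcomm 1 (z i s) (z j t)"
  using z_diagonal[OF assms(1-3)] z_lower[OF assms(4)] by (simp add: qcomm_one_iff smult_zero_right)

lemma z_diag_diag:
  assumes "i \<in> {1..\<theta> + 1}" "j \<in> {1..\<theta> + 1}"
  shows "qcomm 1 (z i i) (z j j)"
proof (cases i j rule: linorder_cases)
  case less
  then show ?thesis using z_diagonal_commute[of i j i j] assms by simp
next
  case equal
  then show ?thesis by (simp add: qcomm_refl)
next
  case greater
  then show ?thesis using qcomm_sym[OF _ _ _ z_diagonal_commute[of j i j i]] assms by simp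
qed

text \<open>The diagonal generators commute with each other and their product is one.\<close>

lemma z_diag_Units:
  assumes "i \<in> {1..\<theta> + 1}"
  shows "z i i \<in> Units A"
proof (rule Units_of_list_mult_Units)
  show "list_mult A (map (\<lambda>i. z i i) [1..<\<theta> + 2]) \<in> Units A" using z_det by simp
  show "z i i \<in> set (map (\<lambda>i. z i i) [1..<\<theta> + 2])" using assms by (auto simp del: upt_Suc)
  show "qcomm 1 x y" if "x \<in> set (map (\<lambda>i. z i i) [1..<\<theta> + 2])" "y \<in> set (map (\<lambda>i. z i i) [1..<\<theta> + 2])" for x y
    using that z_diag_diag by (auto simp del: upt_Suc)
qed auto

text \<open>If \<open>k\<close> lies between \<open>i\<close> and \<open>s\<close>, the two
  generators are in antidiagonal position; otherwise they are in diagonal position with vanishing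
  correction term.\<close>

lemma z_diag_commute:
  assumes "{i, s, k} \<subseteq> {1..\<theta> + 1}" "i < s" "k \<noteq> i" "k \<noteq> s"
  shows "qcomm 1 (z k k) (z i s)"
proof -
  consider "k < i" | "i < k" "k < s" | "s < k" using assms by linarith
  then show ?thesis
  proof cases
    case 1
    then show ?thesis using z_diagonal_commute[of k i k s] assms by simp
  next
    case 2
    then show ?thesis using qcomm_sym[OF _ _ _ z_antidiagonal[of i k k s]] assms by simp
  next
    case 3
    then show ?thesis using qcomm_sym[OF _ _ _ z_diagonal_commute[of i k s k]] assms by simp
  qed
qed

lemma z_diag_commute':
  assumes "{i, s, k} \<subseteq> {1..\<theta> + 1}" "i < s" "k \<noteq> i" "k \<noteq> s"
  shows "qcomm 1 (z i s) (z k k)"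
  using qcomm_sym[OF _ _ _ z_diag_commute[OF assms]] by simp

text \<open>Up to a scalar, \<open>e i j\<close> is the image of the root vector \<open>E\<^sub>i\<^sub>,\<^sub>j\<close> under \<open>\<psi>\<close>.\<close>

definition e :: "nat \<Rightarrow> nat \<Rightarrow> 'a"
  where "e i j = z i j \<otimes> inv (z j j)"

lemma e_closed: "j \<in> {1..\<theta> + 1} \<Longrightarrow> e i j \<in> carrier A"
  using z_diag_Units by (simp add: e_def)

text \<open>With the inverted diagonal generators collected on the right, both products end in the
  same factor; the first acquires \<open>inverse q\<close> when the inverse of \<open>z m m\<close>
  crosses \<open>z m j\<close>. What remains is the diagonal relation for \<open>z i m\<close> and
  \<open>z m j\<close>, and the factor \<open>z m m\<close> of its correction term cancels against
  the inverse.\<close>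

lemma e_bracket:
  assumes "1 \<le> i" "i < m" "m < j" "j \<le> \<theta> + 1"
  shows "e i m \<otimes> e m j \<ominus> inverse q \<odot> (e m j \<otimes> e i m) =
    (inverse q * (q - inverse q)) \<odot> e i j"
proof -
  let ?u = "inv (z m m)" and ?v = "inv (z j j)"
  have U: "z m m \<in> Units A" "z j j \<in> Units A" using assms by (auto intro!: z_diag_Units)
  then have car: "?u \<in> carrier A" "?v \<in> carrier A" by auto
  have "qcomm (inverse q) ?u (z m j)"
    using assms U q_nonzero by (intro qcomm_inv_left z_row) auto
  then have 1: "?u \<otimes> z m j = inverse q \<odot> (z m j \<otimes> ?u)" by (simp add: qcomm_def)
  have "qcomm (inverse 1) ?v (z i m)"
    using assms U by (intro qcomm_inv_left z_diag_commute) auto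
  then have 2: "?v \<otimes> z i m = z i m \<otimes> ?v" using car by (simp add: qcomm_one_iff)
  have "qcomm (inverse 1) (inv (z m m)) (z j j)"
    using assms U by (intro qcomm_inv_left z_diag_diag) auto
  then have "qcomm (inverse 1) ?u ?v" using U car by (intro qcomm_inv_right) auto
  then have 3: "?u \<otimes> ?v = ?v \<otimes> ?u" using car by (simp add: qcomm_one_iff)
  have "e i m \<otimes> e m j = z i m \<otimes> (?u \<otimes> z m j) \<otimes> ?v" using car by (simp add: e_def m_assoc)
  also have "\<dots> = inverse q \<odot> (z i m \<otimes> z m j \<otimes> (?u \<otimes> ?v))"
    unfolding 1 using car by (simp add: smult_mult_left smult_mult_right m_assoc)
  finally have l: "e i m \<otimes> e m j = inverse q \<odot> (z i m \<otimes> z m j \<otimes> (?u \<otimes> ?v))" .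
  have "e m j \<otimes> e i m = z m j \<otimes> (?v \<otimes> z i m) \<otimes> ?u" using car by (simp add: e_def m_assoc)
  also have "\<dots> = z m j \<otimes> z i m \<otimes> (?u \<otimes> ?v)" unfolding 2 3 using car by (simp add: m_assoc)
  finally have r: "e m j \<otimes> e i m = z m j \<otimes> z i m \<otimes> (?u \<otimes> ?v)" .
  have d: "z i m \<otimes> z m j = z m j \<otimes> z i m \<oplus> (q - inverse q) \<odot> (z i j \<otimes> z m m)"
    using assms by (intro z_diagonal) auto
  let ?w = "z m j \<otimes> z i m \<otimes> (?u \<otimes> ?v)"
  have "z m m \<otimes> (?u \<otimes> ?v) = ?v" using U car by (simp flip: m_assoc)
  then have *: "z i m \<otimes> z m j \<otimes> (?u \<otimes> ?v) = ?w \<oplus> (q - inverse q) \<odot> e i j"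
    unfolding d e_def using car by (simp add: l_distr smult_mult_left m_assoc)
  have "e i j \<in> carrier A" using car by (simp add: e_def)
  moreover have "?w \<in> carrier A" using car by simp
  ultimately show ?thesis unfolding l r *
    by (simp add: smult_add_right smult_smult minus_eq a_assoc a_comm[of _ "\<ominus> _"] r_neg1 r_neg2)
qed

text \<open>By \<open>e_bracket\<close>, \<open>e i (i + 2)\<close> is up to a scalar the bracket of
  \<open>e i (i + 1)\<close> and \<open>e (i + 1) (i + 2)\<close>. Its commutation with each of the
  two, given here and in \<open>e_qcomm_column\<close>, is therefore a quantum Serre relation in
  another form.\<close>

lemma e_qcomm_row:
  assumes "1 \<le> i" "i + 2 \<le> \<theta> + 1"
  shows "qcomm q (e i (i + 1)) (e i (i + 2))"
proof -
  have "qcomm (q * inverse 1 * inverse 1) (e i (i + 1)) (e i (i + 2))"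
    unfolding e_def using assms
    by (intro qcomm_frac z_row z_diag_commute z_diag_commute' z_diag_diag z_diag_Units) auto
  then show ?thesis by simp
qed

lemma e_qcomm_column:
  assumes "1 \<le> i" "i + 2 \<le> \<theta> + 1"
  shows "qcomm q (e i (i + 2)) (e (i + 1) (i + 2))"
proof -
  have "qcomm (inverse q) (z (i + 2) (i + 2)) (z (i + 1) (i + 2))"
    using assms q_nonzero by (intro qcomm_sym z_column) auto
  \<comment> \<open>Both elements have the denominator \<open>z (i + 2) (i + 2)\<close>, which
    contributes one factor \<open>inverse q\<close> and one factor \<open>q\<close>.\<close>
  then have "qcomm (q * inverse q * inverse (inverse q)) (e i (i + 2)) (e (i + 1) (i + 2))"
    unfolding e_def using assms q_nonzero
    by (intro qcomm_frac z_column z_diag_diag z_diag_Units) auto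
  then show ?thesis using q_nonzero by simp
qed

lemma e_far_commute:
  assumes "1 \<le> i" "i + 2 \<le> j" "j \<le> \<theta>"
  shows "qcomm 1 (e i (i + 1)) (e j (j + 1))"
proof -
  have "qcomm (1 * inverse 1 * inverse 1) (e i (i + 1)) (e j (j + 1))"
    unfolding e_def using assms
    by (intro qcomm_frac z_diagonal_commute z_diag_commute z_diag_commute' z_diag_diag z_diag_Units) auto
  then show ?thesis by simp
qed

lemma e_pow:
  assumes N: "odd N" "q ^ N = 1" and ij: "1 \<le> i" "i < j" "j \<le> \<theta> + 1"
  shows "e i j [^] N = z i j [^] N \<otimes> inv (z j j [^] N)"
proof -
  have U: "z j j \<in> Units A" using ij by (auto intro!: z_diag_Units)
  have "qcomm q (z i j) (z j j)" using ij by (intro z_column) auto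
  then have "qcomm q (inv (z j j)) (z i j)"
    using U q_nonzero qcomm_inv_left[of "z j j" "z i j" "inverse q"] qcomm_sym[of "z i j" "z j j" q] by simp
  then have "e i j [^] N = q ^ (N choose 2) \<odot> (z i j [^] N \<otimes> inv (z j j) [^] N)"
    unfolding e_def using U by (intro qcomm_mult_pow) auto
  \<comment> \<open>For odd \<open>N\<close> this binomial coefficient is a multiple of
    \<open>N\<close>, so the scalar becomes one.\<close>
  also have "N choose 2 = N * ((N - 1) div 2)"
    using N(1) by (auto simp: choose_two elim!: oddE)
  also have "q ^ \<dots> = 1" using N(2) by (simp add: power_mult)
  also have "inv (z j j) [^] N = inv (z j j [^] N)"
    by (rule inv_pow_Units[OF U])
  finally show ?thesis using U by (simp add: smult_one Units_pow_closed)
qed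

text \<open>Unless the generators are in diagonal position, they commute up to 1, \<open>q\<close>
  or \<open>inverse q\<close>, whose \<open>N\<close>-th powers are one. In diagonal position the
  correction term commutes with \<open>z i j\<close> up to the square of \<open>q\<close> or of its
  inverse: one factor comes from the row and one from the column. The vanishing geometric sum then
  applies.\<close>

lemma z_pow_commute:
  assumes N: "q ^ N = 1" "q\<^sup>2 \<noteq> 1" and I: "{i, j, k, l} \<subseteq> {1..\<theta> + 1}"
  shows "qcomm 1 (z i j [^] N) (z k l)"
proof -
  have pow: "qcomm 1 (z i j [^] N) (z k l)" if "qcomm c (z i j) (z k l)" "c ^ N = 1" for c
    using qcomm_pow_left[of "z i j" "z k l" c N] that by simp
  have inv: "inverse q ^ N = 1" using N(1) by (simp add: power_inverse)
  note sym = qcomm_sym[OF z_closed z_closed]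
  show ?thesis
  proof (cases i k rule: linorder_cases)
    case less
    note ik = less
    show ?thesis
    proof (cases j l rule: linorder_cases)
      case less
      show ?thesis
      proof (rule pow_commute_root_of_unity)
        show "z i j \<otimes> z k l = z k l \<otimes> z i j \<oplus> (q - inverse q) \<odot> (z i l \<otimes> z k j)"
          using ik less I by (intro z_diagonal) auto
        show "qcomm (q * q) (z i j) (z i l \<otimes> z k j)"
          using ik less I by (intro qcomm_mult_right z_row z_column) auto
        show "(q * q) ^ N = 1" "q * q \<noteq> 1" using N by (simp_all add: power_mult_distrib power2_eq_square)
      qed auto
    next
      case equal
      then show ?thesis using ik I N by (intro pow[of q]) (auto intro: z_column)
    next
      case greater
      then show ?thesis using ik I by (intro pow[of 1]) (auto intro: z_antidiagonal)
    qed
  next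
    case equal
    note ik = equal
    show ?thesis
    proof (cases j l rule: linorder_cases)
      case less
      then show ?thesis using ik I N by (intro pow[of q]) (auto intro: z_row)
    next
      case equal
      then show ?thesis using ik by (intro pow[of 1]) (auto intro: qcomm_refl)
    next
      case greater
      then show ?thesis using ik I inv sym[OF q_nonzero z_row[of l j i]] by (intro pow[of "inverse q"]) auto
    qed
  next
    case greater
    note ik = greater
    show ?thesis
    proof (cases j l rule: linorder_cases)
      case less
      then show ?thesis using ik I sym[OF _ z_antidiagonal[of k i j l]] by (intro pow[of 1]) auto
    next
      case equal
      then show ?thesis using ik I inv sym[OF q_nonzero z_column[of k i j]] by (intro pow[of "inverse q"]) auto
    next
      case greater
      show ?thesis
      proof (rule pow_commute_root_of_unity)
        \<comment> \<open>The diagonal relation has the other generator first; solving it for the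
          wanted order negates the coefficient.\<close>
        have "z k l \<otimes> z i j = z i j \<otimes> z k l \<oplus> (q - inverse q) \<odot> (z k j \<otimes> z i l)"
          using ik greater I by (intro z_diagonal) auto
        then show "z i j \<otimes> z k l = z k l \<otimes> z i j \<oplus> (- (q - inverse q)) \<odot> (z k j \<otimes> z i l)"
          by (simp only: smult_neg m_closed z_closed a_assoc smult_closed r_neg r_zero a_inv_closed)
        have "qcomm (inverse q) (z i j) (z k j)" "qcomm (inverse q) (z i j) (z i l)"
          using sym[OF q_nonzero z_column[of k i j]] sym[OF q_nonzero z_row[of l j i]] ik greater I by auto
        then show "qcomm (inverse q * inverse q) (z i j) (z k j \<otimes> z i l)"
          by (intro qcomm_mult_right) auto
        show "(inverse q * inverse q) ^ N = 1" "inverse q * inverse q \<noteq> 1"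
          using N inv by (auto simp: power_mult_distrib power2_eq_square field_simps q_nonzero)
      qed auto
    qed
  qed
qed

lemma z_pow_pow_commute:
  assumes "q ^ N = 1" "q\<^sup>2 \<noteq> 1" "{i, j, k, l} \<subseteq> {1..\<theta> + 1}"
  shows "qcomm 1 (z i j [^] N) (z k l [^] N)"
  using qcomm_pow_right[OF _ _ z_pow_commute[OF assms], of N] by simp

lemma z_pow_det: "list_mult A (map (\<lambda>i. z i i [^] (N :: nat)) [1..<\<theta> + 2]) = \<one>"
proof -
  have "list_mult A (map (\<lambda>i. z i i [^] N) [1..<\<theta> + 2]) = list_mult A (map (\<lambda>i. z i i) [1..<\<theta> + 2]) [^] N"
    by (intro list_mult_map_pow z_diag_diag) auto
  then show ?thesis using z_det by simp
qed

end

section \<open>Relations of the quantized Borel algebra\<close>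

text \<open>With \<open>F = x y - r\<^sup>-\<^sup>1 y x\<close> the two quantum Serre relators are \<open>x F - r F x\<close> and \<open>F y - r y F\<close>.\<close>

lemma (in complex_algebra) serre_of_qcomm_left:
  assumes x: "x \<in> carrier A" and y: "y \<in> carrier A" and r: "r \<noteq> 0"
    and "qcomm r x (x \<otimes> y \<ominus> inverse r \<odot> (y \<otimes> x))"
  shows "x \<otimes> x \<otimes> y \<ominus> (r + inverse r) \<odot> x \<otimes> y \<otimes> x \<oplus> y \<otimes> x \<otimes> x = \<zero>"
proof -
  let ?a = "x \<otimes> x \<otimes> y" and ?b = "x \<otimes> y \<otimes> x" and ?c = "y \<otimes> x \<otimes> x"
  have car: "?a \<in> carrier A" "?b \<in> carrier A" "?c \<in> carrier A" using x y by auto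
  have "?a \<ominus> inverse r \<odot> ?b = r \<odot> ?b \<ominus> ?c"
    using assms by (simp add: qcomm_def minus_eq l_distr r_distr l_minus r_minus smult_mult_left
        smult_mult_right smult_add_right smult_neg_right smult_smult smult_one m_assoc)
  then have "?a \<ominus> inverse r \<odot> ?b \<oplus> inverse r \<odot> ?b = r \<odot> ?b \<ominus> ?c \<oplus> inverse r \<odot> ?b" by simp
  then have a: "?a = r \<odot> ?b \<ominus> ?c \<oplus> inverse r \<odot> ?b"
    using car by (simp add: minus_eq a_assoc l_neg)
  have s: "(r + inverse r) \<odot> x \<otimes> y \<otimes> x = r \<odot> ?b \<oplus> inverse r \<odot> ?b"
    using x y by (simp add: smult_add_left smult_mult_left l_distr)
  have "B \<ominus> c \<oplus> B' \<ominus> (B \<oplus> B') \<oplus> c = \<zero>" if "B \<in> carrier A" "B' \<in> carrier A" "c \<in> carrier A" for B B' c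
    using that by algebra
  then show ?thesis unfolding s using a car by (metis smult_closed)
qed

lemma (in complex_algebra) serre_of_qcomm_right:
  assumes x: "x \<in> carrier A" and y: "y \<in> carrier A" and r: "r \<noteq> 0"
    and "qcomm r (x \<otimes> y \<ominus> inverse r \<odot> (y \<otimes> x)) y"
  shows "y \<otimes> y \<otimes> x \<ominus> (r + inverse r) \<odot> y \<otimes> x \<otimes> y \<oplus> x \<otimes> y \<otimes> y = \<zero>"
proof -
  let ?a = "y \<otimes> y \<otimes> x" and ?b = "y \<otimes> x \<otimes> y" and ?c = "x \<otimes> y \<otimes> y"
  have car: "?a \<in> carrier A" "?b \<in> carrier A" "?c \<in> carrier A" using x y by auto
  have "?c \<ominus> inverse r \<odot> ?b = r \<odot> ?b \<ominus> ?a"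
    using assms by (simp add: qcomm_def minus_eq l_distr r_distr l_minus r_minus smult_mult_left
        smult_mult_right smult_add_right smult_neg_right smult_smult smult_one m_assoc)
  then have "?c \<ominus> inverse r \<odot> ?b \<oplus> inverse r \<odot> ?b = r \<odot> ?b \<ominus> ?a \<oplus> inverse r \<odot> ?b" by simp
  then have c: "?c = r \<odot> ?b \<ominus> ?a \<oplus> inverse r \<odot> ?b"
    using car by (simp add: minus_eq a_assoc l_neg)
  have s: "(r + inverse r) \<odot> y \<otimes> x \<otimes> y = r \<odot> ?b \<oplus> inverse r \<odot> ?b"
    using x y by (simp add: smult_add_left smult_mult_left l_distr)
  have "a \<ominus> (B \<oplus> B') \<oplus> (B \<ominus> a \<oplus> B') = \<zero>" if "B \<in> carrier A" "B' \<in> carrier A" "a \<in> carrier A" for B B' a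
    using that by algebra
  then show ?thesis unfolding s using c car by (metis smult_closed)
qed

lemma (in complex_algebra) list_mult_single:
  assumes "distinct xs" "i \<in> set xs" "f i \<in> carrier A" "\<And>j. j \<in> set xs \<Longrightarrow> j \<noteq> i \<Longrightarrow> f j = \<one>"
  shows "list_mult A (map f xs) = f i"
proof -
  have one: "list_mult A (map f ys) = \<one>" if "\<forall>j\<in>set ys. f j = \<one>" for ys
    using that by (induction ys) auto
  show ?thesis using assms
  proof (induction xs)
    case (Cons x xs)
    show ?case
    proof (cases "x = i")
      case True
      then have "\<forall>j\<in>set xs. f j = \<one>" using Cons.prems by auto
      then show ?thesis using Cons.prems True one by simp
    next
      case False
      then show ?thesis using Cons by auto
    qed
  qed simp
qed

section \<open>Images of the generators of the quantized Borel algebra and their relations\<close>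

context quantum_borel
begin

text \<open>\<open>fund\<close>, \<open>torus_elt\<close> and \<open>E\<close> are the values of
  \<psi> on the \<open>K\<close> of a fundamental weight, on the \<open>K\<close> of an arbitrary
  weight and on a simple root vector.\<close>

definition fund :: "nat \<Rightarrow> 'a"
  where "fund k = list_mult A (map (\<lambda>i. z i i) [1..<k + 1])"

definition torus_elt :: "(nat \<Rightarrow>\<^sub>0 int) \<Rightarrow> 'a"
  where "torus_elt m = list_mult A (map (\<lambda>i. fund i [^] Poly_Mapping.lookup m i) [1..<\<theta> + 1])"

definition E :: "nat \<Rightarrow> 'a"
  where "E j = (- inverse (q - inverse q)) \<odot> e j (j + 1)"

lemma fund_0: "fund 0 = \<one>"
  by (simp add: fund_def)

lemma fund_Suc: "fund (Suc k) = fund k \<otimes> z (Suc k) (Suc k)"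
proof -
  have "fund (Suc k) = list_mult A (map (\<lambda>i. z i i) [1..<k + 1] @ [z (Suc k) (Suc k)])"
    by (simp add: fund_def)
  then show ?thesis by (subst (asm) list_mult_append) (auto simp: fund_def)
qed

text \<open>This is the determinant relation. It lets the index \<open>Suc \<theta>\<close> be
  treated like the index 0 at the ends of the diagram.\<close>

lemma fund_top: "fund (Suc \<theta>) = \<one>"
  using z_det by (simp add: fund_def)

lemma fund_Units: "k \<le> \<theta> + 1 \<Longrightarrow> fund k \<in> Units A"
  unfolding fund_def by (intro Units_list_mult) (auto intro!: z_diag_Units)

lemma z_fund_commute:
  assumes "i \<in> {1..\<theta> + 1}" "k \<le> \<theta> + 1"
  shows "qcomm 1 (z i i) (fund k)"
  unfolding fund_def using assms by (intro qcomm_list_mult_right) (auto intro!: z_diag_diag simp del: upt_Suc)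

lemma fund_commute:
  assumes "i \<le> \<theta> + 1" "k \<le> \<theta> + 1"
  shows "qcomm 1 (fund i) (fund k)"
proof -
  have k: "fund k \<in> carrier A" using fund_Units[OF assms(2)] by auto
  have *: "qcomm 1 (fund k) (fund i)"
    unfolding fund_def[of i]
  proof (intro qcomm_list_mult_right k)
    show "qcomm 1 (fund k) x" if "x \<in> set (map (\<lambda>i. z i i) [1..<i + 1])" for x
      using that assms qcomm_sym[OF _ k _ z_fund_commute[OF _ assms(2)]] by (auto simp del: upt_Suc)
  qed auto
  show ?thesis using qcomm_sym[OF k _ _ *] fund_Units[OF assms(1)] by auto
qed

lemma torus_elt_Units: "torus_elt m \<in> Units A"
  unfolding torus_elt_def
  by (intro Units_list_mult) (auto intro!: int_pow_Units fund_Units simp del: upt_Suc)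

lemma torus_elt_add: "torus_elt (m + m') = torus_elt m \<otimes> torus_elt m'"
proof -
  have U: "fund i \<in> Units A" if "i \<in> set [1..<\<theta> + 1]" for i
    using that by (auto intro: fund_Units simp del: upt_Suc)
  have "torus_elt (m + m') = list_mult A (map (\<lambda>i. fund i [^] Poly_Mapping.lookup m i \<otimes>
      fund i [^] Poly_Mapping.lookup m' i) [1..<\<theta> + 1])"
    unfolding torus_elt_def
    by (intro arg_cong[where f = "list_mult A"] map_cong refl) (simp add: lookup_add int_pow_add_Units[OF U] del: upt_Suc)
  also have "\<dots> = torus_elt m \<otimes> torus_elt m'"
    unfolding torus_elt_def
  proof (rule list_mult_map_mult)
    fix i j assume i: "i \<in> set [1..<\<theta> + 1]" and j: "j \<in> set [1..<\<theta> + 1]"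
    have "qcomm 1 (fund j) (fund i [^] Poly_Mapping.lookup m' i)"
      using U[OF i] U[OF j] i j by (intro qcomm_int_pow_right fund_commute) (auto simp del: upt_Suc)
    then have "qcomm (inverse 1) (fund i [^] Poly_Mapping.lookup m' i) (fund j)"
      using U[OF i] U[OF j] int_pow_Units by (intro qcomm_sym) auto
    then show "qcomm 1 (fund i [^] Poly_Mapping.lookup m' i) (fund j [^] Poly_Mapping.lookup m j)"
      using U[OF i] U[OF j] int_pow_Units by (intro qcomm_int_pow_right) auto
  qed (use U int_pow_Units in \<open>blast+\<close>)
  finally show ?thesis .
qed

lemma torus_elt_0: "torus_elt 0 = \<one>"
proof -
  have "list_mult A (map (\<lambda>i. \<one>) xs) = \<one>" for xs :: "nat list" by (induction xs) auto
  then show ?thesis by (simp add: torus_elt_def del: upt_Suc)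
qed

lemma torus_elt_frag_of:
  assumes "i \<in> {1..\<theta>}"
  shows "torus_elt (frag_of i) = fund i"
proof -
  have U: "fund i \<in> Units A" using assms by (auto intro: fund_Units)
  have one: "fund i [^] (1 :: int) = fund i"
    using int_pow_int[of A "fund i" 1] U by (simp add: Units_closed)
  have "torus_elt (frag_of i) = fund i [^] Poly_Mapping.lookup (frag_of i) i"
    unfolding torus_elt_def
  proof (rule list_mult_single)
    show "fund i [^] Poly_Mapping.lookup (frag_of i) i \<in> carrier A"
      using int_pow_Units[OF U] by blast
  qed (use assms in \<open>auto simp: lookup_frag_of simp del: upt_Suc\<close>)
  then show ?thesis using one by (simp add: lookup_frag_of)
qed

lemma torus_elt_neg: "torus_elt (- m) = inv (torus_elt m)"
proof -
  have "torus_elt m \<otimes> torus_elt (- m) = \<one>" "torus_elt (- m) \<otimes> torus_elt m = \<one>"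
    by (simp_all flip: torus_elt_add add: torus_elt_0)
  then show ?thesis using inv_unique'[of "torus_elt m" "torus_elt (- m)"] torus_elt_Units by blast
qed

text \<open>The row relation applies at \<open>k = j\<close> and the column relation, read
  backwards, at \<open>k = j + 1\<close>. The denominator commutes with all diagonal
  generators.\<close>

lemma z_e_commute:
  assumes "k \<in> {1..\<theta> + 1}" "j \<in> {1..\<theta>}"
  shows "qcomm (if k = j then q else if k = j + 1 then inverse q else 1) (z k k) (e j (j + 1))"
proof -
  have U: "z (j + 1) (j + 1) \<in> Units A" using assms by (intro z_diag_Units) auto
  have "qcomm (inverse 1) (z k k) (inv (z (j + 1) (j + 1)))"
    using assms U by (intro qcomm_inv_right z_diag_diag) auto
  moreover have "qcomm (if k = j then q else if k = j + 1 then inverse q else 1) (z k k) (z j (j + 1))"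
    using z_row[of j "j + 1" j] qcomm_sym[OF _ _ q_nonzero z_column[of j "j + 1" "j + 1"]]
      z_diag_commute[of j "j + 1" k] assms by auto
  ultimately show ?thesis
    using qcomm_mult_right[of "z k k" "z j (j + 1)" "inv (z (j + 1) (j + 1))" _ 1] U
    by (auto simp: e_def)
qed

text \<open>The factors of \<open>fund k\<close> contribute \<open>q\<close> at the index
  \<open>j\<close> and \<open>inverse q\<close> at \<open>j + 1\<close>, so a scalar survives for
  \<open>k = j\<close> only.\<close>

lemma fund_e_commute:
  assumes j: "j \<in> {1..\<theta>}"
  shows "k \<le> \<theta> \<Longrightarrow> qcomm (if k = j then q else 1) (fund k) (e j (j + 1))"
proof (induction k)
  case 0
  have "e j (j + 1) \<in> carrier A" using j by (intro e_closed) auto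
  then show ?case using j by (simp add: fund_0 qcomm_one_iff)
next
  case (Suc k)
  have car: "e j (j + 1) \<in> carrier A" "fund k \<in> carrier A" using j Suc.prems fund_Units[of k] by (auto intro!: e_closed)
  have "qcomm ((if k = j then q else 1) * (if Suc k = j then q else if Suc k = j + 1 then inverse q else 1))
      (fund (Suc k)) (e j (j + 1))"
    unfolding fund_Suc using Suc j car by (intro qcomm_mult_left z_e_commute) auto
  then show ?case using q_nonzero by (auto split: if_splits)
qed

lemma E_closed: "j \<in> {1..\<theta>} \<Longrightarrow> E j \<in> carrier A"
  by (auto simp: E_def intro!: smult_closed e_closed)

lemma torus_E_conj:
  assumes "i \<in> {1..\<theta>}" "j \<in> {1..\<theta>}"
  shows "torus_elt (frag_of i) \<otimes> E j \<otimes> torus_elt (- frag_of i) = (if i = j then q else 1) \<odot> E j"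
proof -
  have U: "fund i \<in> Units A" using assms by (auto intro: fund_Units)
  have e: "e j (j + 1) \<in> carrier A" using assms by (intro e_closed) auto
  have "qcomm (if i = j then q else 1) (1 \<odot> fund i) (E j)"
    unfolding E_def using assms U e by (intro qcomm_smult fund_e_commute) auto
  then have "fund i \<otimes> E j = (if i = j then q else 1) \<odot> (E j \<otimes> fund i)"
    using U by (simp add: qcomm_def smult_one Units_closed)
  then show ?thesis
    using U E_closed[OF assms(2)] assms
    by (simp add: torus_elt_neg torus_elt_frag_of smult_mult_left m_assoc Units_closed)
qed

lemma E_far_commute:
  assumes "i \<in> {1..\<theta>}" "j \<in> {1..\<theta>}" "cartan i j = 0"
  shows "E i \<otimes> E j = E j \<otimes> E i"
proof -
  have far: "qcomm 1 (E i) (E j)" if "i \<in> {1..\<theta>}" "j \<in> {1..\<theta>}" "i + 2 \<le> j" for i j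
    unfolding E_def using that by (intro qcomm_smult e_far_commute e_closed) auto
  have "i + 2 \<le> j \<or> j + 2 \<le> i" using assms(3) by (auto simp: cartan_def split: if_splits)
  then show ?thesis using far[of i j] far[of j i] assms E_closed by (auto simp: qcomm_one_iff)
qed

lemma E_bracket:
  assumes "1 \<le> i" "i + 1 \<le> \<theta>"
  shows "E i \<otimes> E (i + 1) \<ominus> inverse q \<odot> (E (i + 1) \<otimes> E i) =
    ((inverse (q - inverse q))\<^sup>2 * (inverse q * (q - inverse q))) \<odot> e i (i + 2)"
proof -
  have car: "e i (i + 1) \<in> carrier A" "e (i + 1) (i + 2) \<in> carrier A" "e i (i + 2) \<in> carrier A"
    using assms by (auto intro!: e_closed)
  let ?c = "(inverse (q - inverse q))\<^sup>2"
  have "E i \<otimes> E (i + 1) \<ominus> inverse q \<odot> (E (i + 1) \<otimes> E i) =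
      ?c \<odot> (e i (i + 1) \<otimes> e (i + 1) (i + 2) \<ominus> inverse q \<odot> (e (i + 1) (i + 2) \<otimes> e i (i + 1)))"
    unfolding E_def using car
    by (simp add: smult_mult_left smult_mult_right smult_smult smult_minus_right power2_eq_square mult_ac)
  then show ?thesis using e_bracket[of i "i + 1" "i + 2"] assms car by (simp add: smult_smult)
qed

text \<open>The bracket of two neighbours is a multiple of an \<open>e\<close> with index gap two,
  which commutes up to \<open>q\<close> with either neighbour. Which of the two Serre forms results
  depends on whether the squared neighbour is the left or the right one.\<close>

lemma E_serre:
  assumes "i \<in> {1..\<theta>}" "j \<in> {1..\<theta>}" "cartan i j = - 1"
  shows "E i \<otimes> E i \<otimes> E j \<ominus> (q + inverse q) \<odot> E i \<otimes> E j \<otimes> E i \<oplus> E j \<otimes> E i \<otimes> E i = \<zero>"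
proof -
  consider "j = i + 1" | "i = j + 1" using assms(3) by (auto simp: cartan_def split: if_splits)
  then show ?thesis
  proof cases
    case 1
    have e: "e i (i + 1) \<in> carrier A" "e i (i + 2) \<in> carrier A"
      using assms 1 by (auto intro!: e_closed)
    have br: "E i \<otimes> E j \<ominus> inverse q \<odot> (E j \<otimes> E i) =
        ((inverse (q - inverse q))\<^sup>2 * (inverse q * (q - inverse q))) \<odot> e i (i + 2)"
      using E_bracket[of i] assms 1 by simp
    have "qcomm q (E i) (E i \<otimes> E j \<ominus> inverse q \<odot> (E j \<otimes> E i))"
      unfolding br unfolding E_def using assms 1 by (intro qcomm_smult e e_qcomm_row) auto
    then show ?thesis using assms E_closed q_nonzero by (intro serre_of_qcomm_left) auto
  next
    case 2
    have e: "e i (i + 1) \<in> carrier A" "e j (j + 2) \<in> carrier A"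
      using assms 2 by (auto intro!: e_closed)
    have br: "E j \<otimes> E i \<ominus> inverse q \<odot> (E i \<otimes> E j) =
        ((inverse (q - inverse q))\<^sup>2 * (inverse q * (q - inverse q))) \<odot> e j (j + 2)"
      using E_bracket[of j] assms 2 by simp
    have "qcomm q (e j (j + 2)) (e i (i + 1))" using e_qcomm_column[of j] assms 2 by simp
    then have "qcomm q (E j \<otimes> E i \<ominus> inverse q \<odot> (E i \<otimes> E j)) (E i)"
      unfolding br unfolding E_def by (intro qcomm_smult e)
    then show ?thesis using assms E_closed q_nonzero by (intro serre_of_qcomm_right) auto
  qed
qed

lemma torus_elt_simple_root:
  assumes i: "i \<in> {1..\<theta>}"
  shows "torus_elt (simple_root \<theta> i) = z i i \<otimes> inv (z (i + 1) (i + 1))"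
proof -
  \<comment> \<open>With \<open>\<omega>\<^sub>0 = \<omega>\<^sub>\<theta>\<^sub>+\<^sub>1 = 0\<close> the equation \<open>\<alpha>\<^sub>i = 2 \<omega>\<^sub>i - \<omega>\<^sub>i\<^sub>-\<^sub>1 - \<omega>\<^sub>i\<^sub>+\<^sub>1\<close> holds at the ends of the diagram, too.\<close>
  define W where "W = (\<lambda>k :: nat. if k \<in> {1..\<theta>} then frag_of k else 0)"
  have W: "torus_elt (W k) = fund k" if "k \<le> \<theta> + 1" for k
  proof (cases "k \<in> {1..\<theta>}")
    case False
    then have "k = 0 \<or> k = Suc \<theta>" using that by auto
    then show ?thesis using False by (auto simp: W_def torus_elt_0 fund_0 fund_top)
  qed (simp add: W_def torus_elt_frag_of)
  have lookup: "Poly_Mapping.lookup (simple_root \<theta> i) k = (if k \<in> {1..\<theta>} then cartan k i else 0)" for k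
    by (simp add: simple_root_def lookup_sum lookup_frag_of sum.delta if_distrib cong: if_cong)
  have "simple_root \<theta> i + W (i - 1) + W (i + 1) = W i + W i"
    using i by (intro poly_mapping_eqI, unfold lookup_add)
      (auto simp: lookup lookup_frag_of W_def cartan_def split: if_splits)
  then have "torus_elt (simple_root \<theta> i) \<otimes> torus_elt (W (i - 1)) \<otimes> torus_elt (W (i + 1)) =
      torus_elt (W i) \<otimes> torus_elt (W i)"
    by (simp flip: torus_elt_add)
  moreover have le: "i - 1 \<le> \<theta> + 1" "i \<le> \<theta> + 1" "i + 1 \<le> \<theta> + 1" using i by auto
  ultimately have eq: "torus_elt (simple_root \<theta> i) \<otimes> fund (i - 1) \<otimes> fund (i + 1) = fund i \<otimes> fund i"
    by (simp only: W)
  let ?k = "torus_elt (simple_root \<theta> i)" and ?f = "fund (i - 1)" and ?g = "fund i"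
    and ?z = "z i i" and ?w = "z (i + 1) (i + 1)"
  have U: "?f \<in> Units A" "?g \<in> Units A" "?w \<in> Units A" "?k \<in> Units A"
    using i by (auto intro!: fund_Units z_diag_Units torus_elt_Units)
  then have car: "?f \<in> carrier A" "?g \<in> carrier A" "?w \<in> carrier A" "?k \<in> carrier A" by auto
  have g: "?g = ?f \<otimes> ?z" using fund_Suc[of "i - 1"] i by simp
  have fz: "?z \<otimes> ?f = ?f \<otimes> ?z" "?w \<otimes> ?f = ?f \<otimes> ?w" "?w \<otimes> ?g = ?g \<otimes> ?w"
    using z_fund_commute[of i "i - 1"] z_fund_commute[of "i + 1" "i - 1"] z_fund_commute[of "i + 1" i] i car le
    by (simp_all add: qcomm_one_iff)
  \<comment> \<open>Multiplication by the unit \<open>?f \<otimes> ?g\<close> turns the left side of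
    the claim into the product known from \<open>eq\<close>, since \<open>?g \<otimes> ?w\<close> is
    \<open>fund (i + 1)\<close>.\<close>
  have "?k \<otimes> ?w \<otimes> (?f \<otimes> ?g) = ?k \<otimes> ?f \<otimes> (?g \<otimes> ?w)"
    using car fz by (metis m_assoc m_closed)
  also have "\<dots> = ?g \<otimes> ?g" using eq fund_Suc[of i] by simp
  also have "\<dots> = ?z \<otimes> (?f \<otimes> ?g)" using car fz(1) by (metis g m_assoc z_closed)
  finally have "?k \<otimes> ?w \<otimes> (?f \<otimes> ?g) \<otimes> inv (?f \<otimes> ?g) = ?z \<otimes> (?f \<otimes> ?g) \<otimes> inv (?f \<otimes> ?g)" by simp
  moreover have "x \<otimes> (?f \<otimes> ?g) \<otimes> inv (?f \<otimes> ?g) = x" if "x \<in> carrier A" for x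
    using that U Units_m_closed[OF U(1,2)] by (simp add: m_assoc[of x] Units_closed)
  ultimately have "?k \<otimes> ?w = ?z" using car by simp
  then have "?k \<otimes> ?w \<otimes> inv ?w = ?z \<otimes> inv ?w" by simp
  then show ?thesis using U car by (simp add: m_assoc)
qed

end

section \<open>Monomials as characters\<close>

text \<open>Artin's argument: the relation at \<open>m s t\<close> minus \<open>\<chi> x s\<close>
  times the relation at \<open>t\<close> no longer involves \<open>x\<close>, and for an
  \<open>s\<close> that separates \<open>v\<close> from \<open>x\<close> the coefficient of
  \<open>v\<close> is only multiplied by a nonzero number. As \<open>S\<close> carries just a
  product and no unit, each character is assumed to be nonzero somewhere.\<close>

lemma characters_independent:
  fixes \<chi> :: "'u \<Rightarrow> 's \<Rightarrow> 'k :: field"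
  assumes "finite U"
    and m: "\<And>s t. s \<in> S \<Longrightarrow> t \<in> S \<Longrightarrow> m s t \<in> S"
    and "\<And>u s t. u \<in> U \<Longrightarrow> s \<in> S \<Longrightarrow> t \<in> S \<Longrightarrow> \<chi> u (m s t) = \<chi> u s * \<chi> u t"
    and "\<And>u. u \<in> U \<Longrightarrow> \<exists>s\<in>S. \<chi> u s \<noteq> 0"
    and "\<And>u v. u \<in> U \<Longrightarrow> v \<in> U \<Longrightarrow> u \<noteq> v \<Longrightarrow> \<exists>s\<in>S. \<chi> u s \<noteq> \<chi> v s"
    and "\<And>s. s \<in> S \<Longrightarrow> (\<Sum>u\<in>U. w u * \<chi> u s) = 0"
    and "u \<in> U"
  shows "w u = 0"
  using assms(1,3-)
proof (induction U arbitrary: w u rule: finite_induct)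
  case (insert x F)
  have F: "w v = 0" if v: "v \<in> F" for v
  proof -
    have "v \<noteq> x" using v insert.hyps by auto
    then obtain s where s: "s \<in> S" "\<chi> v s \<noteq> \<chi> x s" using insert.prems(3)[of v x] v by auto
    have "w v * (\<chi> v s - \<chi> x s) = 0"
    proof (rule insert.IH[of "\<lambda>u. w u * (\<chi> u s - \<chi> x s)"])
      fix t assume t: "t \<in> S"
      have "0 = (\<Sum>u\<in>insert x F. w u * \<chi> u (m s t)) - \<chi> x s * (\<Sum>u\<in>insert x F. w u * \<chi> u t)"
        using insert.prems(4) m s t by simp
      also have "\<dots> = (\<Sum>u\<in>insert x F. w u * (\<chi> u s - \<chi> x s) * \<chi> u t)"
        using insert.prems(1) s t
        by (simp only: sum_distrib_left flip: sum_subtractf) (intro sum.cong, auto simp: algebra_simps)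
      also have "\<dots> = (\<Sum>u\<in>F. w u * (\<chi> u s - \<chi> x s) * \<chi> u t)"
        using insert.hyps by simp
      finally show "(\<Sum>u\<in>F. w u * (\<chi> u s - \<chi> x s) * \<chi> u t) = 0" by simp
    qed (use insert.prems v in auto)
    then show ?thesis using s by simp
  qed
  obtain s where s: "s \<in> S" "\<chi> x s \<noteq> 0" using insert.prems(2) by blast
  have "w x * \<chi> x s = 0" using insert.prems(4)[OF s(1)] insert.hyps F by simp
  then show ?case using s F insert.prems(5) by auto
qed simp

text \<open>Indices with equal characters have equal values of \<open>\<zeta>\<close> and can be
  merged by adding their coefficients, which shrinks \<open>U\<close>. Once all characters are
  distinct, their independence makes every coefficient zero.\<close>

lemma (in complex_algebra) character_relation_transfer:
  fixes \<chi> :: "'u \<Rightarrow> 's \<Rightarrow> complex" and w :: "'u \<Rightarrow> complex"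
  assumes "finite U"
    and m: "\<And>s t. s \<in> S \<Longrightarrow> t \<in> S \<Longrightarrow> m s t \<in> S"
    and "\<And>u s t. u \<in> U \<Longrightarrow> s \<in> S \<Longrightarrow> t \<in> S \<Longrightarrow> \<chi> u (m s t) = \<chi> u s * \<chi> u t"
    and "\<And>u. u \<in> U \<Longrightarrow> \<exists>s\<in>S. \<chi> u s \<noteq> 0"
    and "\<And>u. u \<in> U \<Longrightarrow> \<zeta> u \<in> carrier A"
    and "\<And>u v. u \<in> U \<Longrightarrow> v \<in> U \<Longrightarrow> (\<And>s. s \<in> S \<Longrightarrow> \<chi> u s = \<chi> v s) \<Longrightarrow> \<zeta> u = \<zeta> v"
    and "\<And>s. s \<in> S \<Longrightarrow> (\<Sum>u\<in>U. w u * \<chi> u s) = 0"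
  shows "(\<Oplus>u\<in>U. w u \<odot> \<zeta> u) = \<zero>"
  using assms(1,3-)
proof (induction "card U" arbitrary: U w rule: less_induct)
  case less
  note [simp] = less.prems(1)
  show ?case
  proof (cases "\<exists>u v. u \<in> U \<and> v \<in> U \<and> u \<noteq> v \<and> (\<forall>s\<in>S. \<chi> u s = \<chi> v s)")
    case True
    then obtain u v where uv: "u \<in> U" "v \<in> U" "u \<noteq> v" "\<And>s. s \<in> S \<Longrightarrow> \<chi> u s = \<chi> v s" by blast
    define V where "V = U - {u, v}"
    have U: "U = insert u (insert v V)" and V: "finite V" "u \<notin> V" "v \<notin> V" "U - {v} = insert u V"
      using uv by (auto simp: V_def)
    have "\<zeta> v = \<zeta> u" by (rule less.prems(5)[OF uv(2,1)]) (simp add: uv(4))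
    then have \<zeta>: "\<zeta> u \<in> carrier A" "\<zeta> v = \<zeta> u" "\<And>x. x \<in> V \<Longrightarrow> \<zeta> x \<in> carrier A"
      using less.prems(4) uv(1) by (simp_all add: V_def)
    let ?w = "w(u := w u + w v)"
    have "(\<Oplus>x\<in>U. w x \<odot> \<zeta> x) = w u \<odot> \<zeta> u \<oplus> (w v \<odot> \<zeta> u \<oplus> (\<Oplus>x\<in>V. w x \<odot> \<zeta> x))"
    proof -
      have c: "(\<lambda>x. w x \<odot> \<zeta> x) \<in> V \<rightarrow> carrier A" "(\<lambda>x. w x \<odot> \<zeta> x) \<in> insert v V \<rightarrow> carrier A"
        using \<zeta> by auto
      show ?thesis
        unfolding U using V(1-3) uv(3) \<zeta>(1,2) finsum_insert[OF V(1,3) c(1)] finsum_insert[of "insert v V" u, OF _ _ c(2)]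
        by simp
    qed
    also have "\<dots> = ?w u \<odot> \<zeta> u \<oplus> (\<Oplus>x\<in>V. w x \<odot> \<zeta> x)"
      using \<zeta> by (simp add: smult_add_left a_assoc Pi_def)
    also have "(\<Oplus>x\<in>V. w x \<odot> \<zeta> x) = (\<Oplus>x\<in>V. ?w x \<odot> \<zeta> x)"
      using V \<zeta> by (intro finsum_cong') auto
    also have "?w u \<odot> \<zeta> u \<oplus> \<dots> = (\<Oplus>x\<in>insert u V. ?w x \<odot> \<zeta> x)"
      using V \<zeta> by (subst finsum_insert) (auto simp: Pi_def)
    also have "\<dots> = \<zero>"
      unfolding V(4)[symmetric]
    proof (rule less.hyps)
      show "card (U - {v}) < card U" using uv by (intro psubset_card_mono) auto
      fix s assume s: "s \<in> S"
      have "(\<Sum>x\<in>U - {v}. ?w x * \<chi> x s) = (w u + w v) * \<chi> u s + (\<Sum>x\<in>V. ?w x * \<chi> x s)"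
        unfolding V(4) using V by simp
      also have "(\<Sum>x\<in>V. ?w x * \<chi> x s) = (\<Sum>x\<in>V. w x * \<chi> x s)"
        using V by (intro sum.cong) auto
      also have "(w u + w v) * \<chi> u s + \<dots> = (\<Sum>x\<in>U. w x * \<chi> x s)"
        unfolding U using V uv s by (simp add: algebra_simps)
      finally show "(\<Sum>x\<in>U - {v}. ?w x * \<chi> x s) = 0" using less.prems(6)[OF s] by simp
    next
      show "\<chi> x (m s t) = \<chi> x s * \<chi> x t" if "x \<in> U - {v}" "s \<in> S" "t \<in> S" for x s t
        using less.prems(2) that by blast
      show "\<exists>s\<in>S. \<chi> x s \<noteq> 0" if "x \<in> U - {v}" for x
        using less.prems(3) that by blast
      show "\<zeta> x \<in> carrier A" if "x \<in> U - {v}" for x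
        using less.prems(4) that by blast
      show "\<zeta> x = \<zeta> y" if "x \<in> U - {v}" "y \<in> U - {v}" "\<And>s. s \<in> S \<Longrightarrow> \<chi> x s = \<chi> y s" for x y
        using less.prems(5)[OF _ _ that(3)] that(1,2) by blast
    qed simp
    finally show ?thesis .
  next
    case False
    then have "w u = 0" if "u \<in> U" for u
      using characters_independent[where \<chi> = \<chi> and U = U and S = S and m = m and w = w and u = u]
        m less.prems that by blast
    then have "(\<Oplus>u\<in>U. w u \<odot> \<zeta> u) = (\<Oplus>u\<in>U. \<zero>)"
      using less.prems(4) by (intro finsum_cong') (auto simp: smult_zero_left)
    then show ?thesis by simp
  qed
qed

lemma prod_list_map_fun_upd_one:
  "prod_list (map ((\<lambda>_. 1)(p := c)) xs) = (c :: 'k :: comm_monoid_mult) ^ count_list xs p"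
  by (induction xs) auto

lemma prod_list_map_mult:
  "prod_list (map (\<lambda>x. f x * g x) xs) = prod_list (map f xs) * (prod_list (map g xs) :: 'k :: comm_monoid_mult)"
  by (induction xs) (auto simp: ac_simps)

lemma count_mset_concat_replicate: "count (mset (concat (replicate d xs))) p = d * count (mset xs) p"
  by (induction d) auto

text \<open>Unlike the Borel subgroup, this set of coordinate families is closed under the entrywise product, for
  which monomials are multiplicative.\<close>

definition torus_points :: "nat \<Rightarrow> (nat \<times> nat \<Rightarrow> complex) set"
  where "torus_points \<theta> = {P. (\<Prod>i = 1..\<theta> + 1. P (i, i)) = 1}"

text \<open>Evaluation at points with entries 1, 2 and 1/2 recovers the exponents up to a common shift on the
  diagonal.\<close>

lemma monomials_eq_on_torus_points:
  assumes u: "set u \<subseteq> upper_indices \<theta>" and v: "set v \<subseteq> upper_indices \<theta>"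
    and eq: "\<And>P. P \<in> torus_points \<theta> \<Longrightarrow> prod_list (map P u) = prod_list (map P v)"
    and le: "count_list v (1, 1) \<le> count_list u (1, 1)"
  shows "mset u = mset (v @ concat (replicate (count_list u (1, 1) - count_list v (1, 1))
    (map (\<lambda>i. (i, i)) [1..<\<theta> + 2])))"
proof (rule multiset_eqI)
  fix p
  let ?d = "count_list u (1, 1) - count_list v (1, 1)"
  let ?D = "map (\<lambda>i. (i, i)) [1..<\<theta> + 2]"
  have D: "count (mset ?D) p = (if p \<in> (\<lambda>i. (i, i)) ` {1..\<theta> + 1} then 1 else 0)"
    by (subst distinct_count_atmost_1[THEN iffD1])
      (auto simp: distinct_map inj_on_def simp del: upt_Suc)
  have two: "(2 :: complex) ^ a = 2 ^ b \<longleftrightarrow> a = b" for a b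
    using power_inject_exp[of "2 :: real" a b] by (metis norm_numeral norm_power one_less_numeral_iff semiring_norm(76))
  consider "p \<notin> upper_indices \<theta>" | i j where "p = (i, j)" "i < j" "p \<in> upper_indices \<theta>"
    | i where "p = (i, i)" "i \<in> {1..\<theta> + 1}"
    by (cases p) (force simp: upper_indices_def)
  then have "count_list u p = count_list v p + ?d * count (mset ?D) p"
  proof cases
    case 1
    then have "p \<notin> (\<lambda>i. (i, i)) ` {1..\<theta> + 1}" "p \<notin> set u" "p \<notin> set v"
      using u v by (auto simp: upper_indices_def)
    then show ?thesis using D by (simp add: count_list_0_iff)
  next
    case 2
    \<comment> \<open>The condition on torus points concerns the diagonal only, so an entry off the
      diagonal may be chosen freely.\<close>
    have "(\<lambda>_. 1)(p := 2) \<in> torus_points \<theta>"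
      using 2 by (auto simp: torus_points_def simp del: prod.cl_ivl_Suc intro!: prod.neutral)
    from eq[OF this] have "(2 :: complex) ^ count_list u p = 2 ^ count_list v p"
      by (simp only: prod_list_map_fun_upd_one)
    then have "count_list u p = count_list v p" by (simp only: two)
    moreover have "p \<notin> (\<lambda>i. (i, i)) ` {1..\<theta> + 1}" using 2 by auto
    ultimately show ?thesis using D by simp
  next
    case 3
    \<comment> \<open>Equality of differences in additive form, free of truncated subtraction. The
      entry \<open>(1, 1)\<close> is the reference, so the case \<open>i = 1\<close> is
      trivial.\<close>
    have "count_list u p + count_list v (1, 1) = count_list v p + count_list u (1, 1)"
    proof (cases "i = 1")
      case False
      let ?f = "(\<lambda>_. 1)(p := 2)" and ?g = "(\<lambda>_. 1)((1, 1) := 1 / 2)"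
      \<comment> \<open>The entry 1/2 at the reference position compensates the entry 2 at
        \<open>p\<close>, so the diagonal product stays one.\<close>
      let ?P = "\<lambda>x. ?f x * ?g x :: complex"
      have "(\<Prod>k = 1..\<theta> + 1. ?P (k, k)) = (\<Prod>k = 1..\<theta> + 1. if k = i then 2 else 1) * (\<Prod>k = 1..\<theta> + 1. if k = 1 then 1 / 2 else 1)"
        using 3 by (simp only: prod.distrib[symmetric]) (intro prod.cong, auto)
      also have "\<dots> = 1" using 3 by (simp add: prod.delta)
      finally have "?P \<in> torus_points \<theta>" by (simp add: torus_points_def)
      from eq[OF this] have "(2 :: complex) ^ count_list u p * (1 / 2) ^ count_list u (1, 1) =
          2 ^ count_list v p * (1 / 2) ^ count_list v (1, 1)"
        by (simp only: prod_list_map_mult prod_list_map_fun_upd_one)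
      then have "(2 :: complex) ^ (count_list u p + count_list v (1, 1)) = 2 ^ (count_list v p + count_list u (1, 1))"
        by (simp add: power_add power_divide field_simps)
      then show ?thesis by (simp only: two)
    qed (use 3 in simp)
    then show ?thesis using D 3 le by simp
  qed
  then show "count (mset u) p = count (mset (v @ concat (replicate ?d ?D))) p"
    by (simp only: mset_append plus_multiset.rep_eq count_mset_concat_replicate) (simp only: count_mset)
qed

section \<open>Relations between the \<open>N\<close>-th powers of the generators\<close>

context quantum_borel
begin

text \<open>The two words differ by a permutation and by copies of the diagonal word. A permutation
  does no harm because the \<open>N\<close>-th powers commute, and the diagonal word evaluates to
  one by \<open>z_pow_det\<close>.\<close>

lemma z_monomial_eq:
  assumes N: "q ^ N = 1" "q\<^sup>2 \<noteq> 1"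
    and uv: "set u \<subseteq> upper_indices \<theta>" "set v \<subseteq> upper_indices \<theta>"
    and eq: "\<And>P. P \<in> torus_points \<theta> \<Longrightarrow> prod_list (map P u) = prod_list (map P v)"
  shows "list_mult A (map (\<lambda>(i, j). z i j [^] N) u) = list_mult A (map (\<lambda>(i, j). z i j [^] N) v)"
proof -
  let ?h = "\<lambda>(i, j). z i j [^] N"
  let ?D = "map (\<lambda>i. (i, i)) [1..<\<theta> + 2]"
  have closed: "set (map ?h xs) \<subseteq> carrier A" for xs by auto
  \<comment> \<open>By symmetry the word with at least as many letters \<open>(1, 1)\<close> can be
    taken first.\<close>
  have *: "list_mult A (map ?h u) = list_mult A (map ?h v)"
    if u: "set u \<subseteq> upper_indices \<theta>" and v: "set v \<subseteq> upper_indices \<theta>"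
      and eq: "\<And>P. P \<in> torus_points \<theta> \<Longrightarrow> prod_list (map P u) = prod_list (map P v)"
      and le: "count_list v (1, 1) \<le> count_list u (1, 1)" for u v
  proof -
    let ?c = "concat (replicate (count_list u (1, 1) - count_list v (1, 1)) ?D)"
    have "mset (map ?h u) = mset (map ?h (v @ ?c))"
      using arg_cong[OF monomials_eq_on_torus_points[OF u v eq le], of "image_mset ?h"] by (simp del: upt_Suc)
    moreover have "qcomm 1 x y" if "x \<in> set (map ?h u)" "y \<in> set (map ?h u)" for x y
      using that u by (auto intro!: z_pow_pow_commute[OF N] simp: upper_indices_def)
    ultimately have "list_mult A (map ?h u) = list_mult A (map ?h (v @ ?c))"
      by (intro list_mult_mset_eq closed)
    also have "\<dots> = list_mult A (map ?h v) \<otimes> list_mult A (map ?h ?c)"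
      unfolding map_append by (intro list_mult_append closed)
    also have "list_mult A (map ?h (concat (replicate d ?D))) = \<one>" for d
    proof (induction d)
      case (Suc d)
      have "list_mult A (map ?h ?D) = \<one>" using z_pow_det[of N] by (simp add: comp_def del: upt_Suc)
      then show ?case using Suc list_mult_append[OF closed closed, of ?D "concat (replicate d ?D)"]
        by (simp del: upt_Suc)
    qed simp
    finally show ?thesis using list_mult_closed[OF closed, of v] by simp
  qed
  show ?thesis
  proof (cases "count_list v (1, 1) \<le> count_list u (1, 1)")
    case True
    then show ?thesis using * uv eq by blast
  next
    case False
    then show ?thesis using *[OF uv(2,1)] eq by fastforce
  qed
qed

text \<open>Words act as characters on the monoid of torus points, and words with equal characters
  have equal values in \<open>A\<close> by \<open>z_monomial_eq\<close>. A linear relation between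
  the characters therefore carries over to the values.\<close>

lemma z_pow_relation:
  assumes N: "q ^ N = 1" "q\<^sup>2 \<noteq> 1"
    and f: "f \<in> carrier (free_algebra (upper_indices \<theta>))"
    and zero: "\<And>P. P \<in> torus_points \<theta> \<Longrightarrow>
      (\<Sum>w\<in>Poly_Mapping.keys f. Poly_Mapping.lookup f w * prod_list (map P (letters w))) = 0"
  shows "free_lift A (\<lambda>(i, j). z i j [^] N) f = \<zero>"
  unfolding free_lift_def
proof (rule character_relation_transfer[where S = "torus_points \<theta>" and m = "\<lambda>P Q p. P p * Q p"
    and \<chi> = "\<lambda>w P. prod_list (map P (letters w))"])
  show "(\<lambda>p. P p * Q p) \<in> torus_points \<theta>" if "P \<in> torus_points \<theta>" "Q \<in> torus_points \<theta>" for P Q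
    using that by (simp only: torus_points_def mem_Collect_eq prod.distrib mult_1)
  show "\<exists>P\<in>torus_points \<theta>. prod_list (map P (letters w)) \<noteq> 0" for w :: "(nat \<times> nat) fword"
  proof (rule bexI[of _ "\<lambda>_. 1"])
    have "prod_list (map (\<lambda>_. 1 :: complex) xs) = 1" for xs :: "(nat \<times> nat) list" by (induction xs) auto
    then show "prod_list (map (\<lambda>_. 1 :: complex) (letters w)) \<noteq> 0" by simp
  qed (simp add: torus_points_def)
  show "list_mult A (map (\<lambda>(i, j). z i j [^] N) (letters u)) = list_mult A (map (\<lambda>(i, j). z i j [^] N) (letters v))"
    if "u \<in> Poly_Mapping.keys f" "v \<in> Poly_Mapping.keys f"
      "\<And>P. P \<in> torus_points \<theta> \<Longrightarrow> prod_list (map P (letters u)) = prod_list (map P (letters v))" for u v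
    using that f by (intro z_monomial_eq[OF N]) (auto simp: free_algebra_def)
qed (auto simp: prod_list_map_mult zero intro!: list_mult_closed)

end

section \<open>Pointwise evaluation in function algebras\<close>

lemma fun_algebra_complex_algebra: "complex_algebra (fun_algebra S)"
proof -
  have "\<exists>g\<in>S \<rightarrow>\<^sub>E UNIV. (\<lambda>p\<in>S. g p + f p) = (\<lambda>p\<in>S. 0 :: complex)" for f
    by (intro bexI[of _ "\<lambda>p\<in>S. - f p"]) (auto simp: restrict_def)
  then have "ring (fun_algebra S)"
    by (intro ringI abelian_groupI monoidI)
      (auto simp: fun_algebra_def algebra_simps PiE_def intro!: extensionalityI[of _ S])
  then show ?thesis
    by (intro complex_algebra.intro complex_algebra_axioms.intro)
      (auto simp: fun_algebra_def algebra_simps PiE_def intro!: extensionalityI[of _ S])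
qed

lemma list_mult_fun_algebra:
  "s \<in> S \<Longrightarrow> list_mult (fun_algebra S) fs s = prod_list (map (\<lambda>f. f s) fs)"
  by (induction fs) (auto simp: list_mult_def fun_algebra_def)

lemma finsum_fun_algebra:
  assumes "finite K" "\<And>k. k \<in> K \<Longrightarrow> F k \<in> carrier (fun_algebra S)" "s \<in> S"
  shows "(\<Oplus>\<^bsub>fun_algebra S\<^esub>k\<in>K. F k) s = (\<Sum>k\<in>K. F k s)"
proof -
  interpret complex_algebra "fun_algebra S" by (rule fun_algebra_complex_algebra)
  have add: "(f \<oplus>\<^bsub>fun_algebra S\<^esub> g) s = f s + g s" for f g using assms(3) by (simp add: fun_algebra_def)
  have zero: "\<zero>\<^bsub>fun_algebra S\<^esub> s = 0" using assms(3) by (simp add: fun_algebra_def)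
  show ?thesis using assms(1,2)
    by (induction K rule: finite_induct) (simp_all add: Pi_def add zero)
qed

lemma free_lift_fun_algebra:
  assumes h: "range h \<subseteq> carrier (fun_algebra S)" and s: "s \<in> S"
  shows "free_lift (fun_algebra S) h f s =
    (\<Sum>w\<in>Poly_Mapping.keys f. Poly_Mapping.lookup f w * prod_list (map (\<lambda>p. h p s) (letters w)))"
proof -
  interpret complex_algebra "fun_algebra S" by (rule fun_algebra_complex_algebra)
  have m: "list_mult (fun_algebra S) (map h ws) \<in> carrier (fun_algebra S)" for ws
    using h by (intro list_mult_closed) auto
  have smult: "(c \<odot>\<^bsub>fun_algebra S\<^esub> g) s = c * g s" for c g using s by (simp add: fun_algebra_def)
  show ?thesis unfolding free_lift_def using s m
    by (subst finsum_fun_algebra) (auto simp: smult list_mult_fun_algebra comp_def)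
qed

section \<open>The presented algebras\<close>

lemma free_algebra_simps:
  "x \<otimes>\<^bsub>free_algebra G\<^esub> y = x * y" "x \<oplus>\<^bsub>free_algebra G\<^esub> y = x + y"
  "\<one>\<^bsub>free_algebra G\<^esub> = 1" "\<zero>\<^bsub>free_algebra G\<^esub> = 0" "c \<odot>\<^bsub>free_algebra G\<^esub> x = scal c * x"
  by (simp_all add: free_algebra_def)

lemma free_algebra_mult_mem:
  "x \<in> carrier (free_algebra G) \<Longrightarrow> y \<in> carrier (free_algebra G) \<Longrightarrow> x * y \<in> carrier (free_algebra G)"
  using ring.ring_simprules(5)[OF free_algebra_ring, of x G y] by (simp add: free_algebra_simps)

lemma free_algebra_add_mem:
  "x \<in> carrier (free_algebra G) \<Longrightarrow> y \<in> carrier (free_algebra G) \<Longrightarrow> x + y \<in> carrier (free_algebra G)"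
  using ring.ring_simprules(1)[OF free_algebra_ring, of x G y] by (simp add: free_algebra_simps)

lemma free_algebra_scal_mult_mem:
  "x \<in> carrier (free_algebra G) \<Longrightarrow> scal c * x \<in> carrier (free_algebra G)"
  using complex_algebra.smult_closed[OF free_algebra_complex_algebra, of x G c] by (simp add: free_algebra_simps)

lemma free_algebra_minus_mem:
  "x \<in> carrier (free_algebra G) \<Longrightarrow> y \<in> carrier (free_algebra G) \<Longrightarrow> x - y \<in> carrier (free_algebra G)"
  using Poly_Mapping.keys_diff[of x y] by (auto simp: free_algebra_def)

lemma free_algebra_sum_mem:
  "(\<And>k. k \<in> K \<Longrightarrow> f k \<in> carrier (free_algebra G)) \<Longrightarrow> (\<Sum>k\<in>K. f k) \<in> carrier (free_algebra G)"
proof (induction K rule: infinite_finite_induct)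
  case (insert k K)
  then show ?case by (simp add: free_algebra_add_mem)
qed (simp_all add: free_algebra_def)

lemma free_algebra_gen_mem: "x \<in> G \<Longrightarrow> gen x \<in> carrier (free_algebra G)"
  by (simp add: free_algebra_def gen_def)

lemma free_algebra_minus:
  assumes "x \<in> carrier (free_algebra G)" "y \<in> carrier (free_algebra G)"
  shows "x \<ominus>\<^bsub>free_algebra G\<^esub> y = x - y"
proof -
  interpret ring "free_algebra G" by (rule free_algebra_ring)
  have "0 - y \<in> carrier (free_algebra G)"
    using assms zero_closed by (intro free_algebra_minus_mem) (simp_all add: free_algebra_simps)
  then have "\<ominus>\<^bsub>free_algebra G\<^esub> y = - y"
    using minus_equality[of "- y" y] assms by (simp add: free_algebra_simps)
  then show ?thesis by (simp add: a_minus_def free_algebra_simps)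
qed

text \<open>The values of \<open>h\<close> outside \<open>G\<close> may be junk (as for \<^const>\<open>psi_gen\<close>), hence the extension by zero.\<close>

lemma presented_algebra_hom:
  assumes R: "R \<subseteq> carrier (free_algebra G)" and A: "complex_algebra A"
    and h: "\<And>x. x \<in> G \<Longrightarrow> h x \<in> carrier A"
    and kill: "\<And>r. r \<in> R \<Longrightarrow> free_lift A (\<lambda>x. if x \<in> G then h x else \<zero>\<^bsub>A\<^esub>) r = \<zero>\<^bsub>A\<^esub>"
  shows "algebra_hom (presented_algebra G R) A (\<lambda>C. the_elem (free_lift A h ` C))"
    and "x \<in> G \<Longrightarrow> the_elem (free_lift A h ` presented_class G R (gen x)) = h x"
proof -
  interpret A: complex_algebra A by (rule A)
  interpret P: algebra_hom "free_algebra G" "presented_algebra G R" "presented_class G R"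
    by (rule presented_class_hom[OF R])
  let ?h = "\<lambda>x. if x \<in> G then h x else \<zero>\<^bsub>A\<^esub>"
  have range: "range ?h \<subseteq> carrier A" using h by auto
  interpret F: algebra_hom "free_algebra G" A "free_lift A ?h"
    by (rule A.free_lift_hom[OF range])
  interpret J: ideal "Idl\<^bsub>free_algebra G\<^esub> R" "free_algebra G" by (rule presented_ideal[OF R])
  have eval: "the_elem (free_lift A h ` presented_class G R f) = free_lift A ?h f"
    if f: "f \<in> carrier (free_algebra G)" for f
  proof -
    \<comment> \<open>The coset consists of expressions in letters from \<open>G\<close>, so junk
      values of \<open>h\<close> never enter.\<close>
    have "presented_class G R f \<subseteq> carrier (free_algebra G)"
      unfolding presented_class_def using f by (intro P.source.a_r_coset_subset_G J.a_subset)
    then have "free_lift A h ` presented_class G R f = free_lift A ?h ` presented_class G R f"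
      by (intro image_cong refl A.free_lift_cong[OF range, of _ G]) auto
    then show ?thesis using free_lift_presented_class[OF R A range kill f] by simp
  qed
  show "the_elem (free_lift A h ` presented_class G R (gen x)) = h x" if "x \<in> G"
    using that eval[OF free_algebra_gen_mem[OF that]] A.free_lift_gen[OF range] by simp
  let ?psi = "\<lambda>C. the_elem (free_lift A h ` C)"
  have car: "\<exists>f\<in>carrier (free_algebra G). C = presented_class G R f" if "C \<in> carrier (presented_algebra G R)" for C
    using that unfolding carrier_presented_algebra[OF R] by blast
  have "?psi \<in> Ring.ring_hom (presented_algebra G R) A"
  proof (rule ring_hom_memI)
    fix C D assume "C \<in> carrier (presented_algebra G R)" "D \<in> carrier (presented_algebra G R)"
    then obtain f g where f: "f \<in> carrier (free_algebra G)" "C = presented_class G R f"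
      and g: "g \<in> carrier (free_algebra G)" "D = presented_class G R g" using car by blast
    show "?psi C \<in> carrier A" unfolding f(2) eval[OF f(1)] by (rule F.hom_closed[OF f(1)])
    show "?psi (C \<otimes>\<^bsub>presented_algebra G R\<^esub> D) = ?psi C \<otimes>\<^bsub>A\<^esub> ?psi D"
      unfolding f(2) g(2) P.hom_mult[OF f(1) g(1), symmetric] eval[OF f(1)] eval[OF g(1)]
        eval[OF P.source.m_closed[OF f(1) g(1)]] F.hom_mult[OF f(1) g(1)] ..
    show "?psi (C \<oplus>\<^bsub>presented_algebra G R\<^esub> D) = ?psi C \<oplus>\<^bsub>A\<^esub> ?psi D"
      unfolding f(2) g(2) P.hom_add[OF f(1) g(1), symmetric] eval[OF f(1)] eval[OF g(1)]
        eval[OF P.source.a_closed[OF f(1) g(1)]] F.hom_add[OF f(1) g(1)] ..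
  next
    show "?psi \<one>\<^bsub>presented_algebra G R\<^esub> = \<one>\<^bsub>A\<^esub>"
      unfolding P.hom_one[symmetric] eval[OF P.source.one_closed] F.hom_one ..
  qed
  moreover have "?psi (c \<odot>\<^bsub>presented_algebra G R\<^esub> C) = c \<odot>\<^bsub>A\<^esub> ?psi C"
    if C: "C \<in> carrier (presented_algebra G R)" for c C
  proof -
    from car[OF C] obtain f where f: "f \<in> carrier (free_algebra G)" "C = presented_class G R f" by blast
    show ?thesis
      unfolding f(2) P.hom_smult[OF f(1), symmetric] eval[OF f(1)]
        eval[OF P.source.smult_closed[OF f(1)]] F.hom_smult[OF f(1)] ..
  qed
  ultimately show "algebra_hom (presented_algebra G R) A ?psi"
    by (intro algebra_hom.intro algebra_hom_axioms.intro A P.target.complex_algebra_axioms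
        ring_hom_ring.intro ring_hom_ring_axioms.intro P.target.ring_axioms A.ring_axioms)
qed

lemma presented_class_eqI:
  assumes R: "R \<subseteq> carrier (free_algebra G)" and "x - y \<in> R"
    and x: "x \<in> carrier (free_algebra G)" and y: "y \<in> carrier (free_algebra G)"
  shows "presented_class G R x = presented_class G R y"
proof -
  interpret P: algebra_hom "free_algebra G" "presented_algebra G R" "presented_class G R"
    by (rule presented_class_hom[OF R])
  have "presented_class G R x \<ominus>\<^bsub>presented_algebra G R\<^esub> presented_class G R y = \<zero>\<^bsub>presented_algebra G R\<^esub>"
    using presented_class_relator[OF R assms(2)] P.hom_minus[OF x y] by (simp add: free_algebra_minus[OF x y])
  then show ?thesis using x y by simp
qed

lemma Oq_hom:
  "algebra_hom (free_algebra (upper_indices \<theta>)) (Oq \<theta> q)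
    (presented_class (upper_indices \<theta>) (Oq_relators \<theta> q))"
  unfolding Oq_def by (rule presented_class_hom[OF Oq_relators_mem])

lemma Oq_quantum_borel:
  assumes "q \<noteq> 0"
  shows "quantum_borel (Oq \<theta> q) \<theta> q (zq \<theta> q)"
proof -
  let ?F = "free_algebra (upper_indices \<theta>)" and ?p = "presented_class (upper_indices \<theta>) (Oq_relators \<theta> q)"
  interpret P: algebra_hom ?F "Oq \<theta> q" ?p by (rule Oq_hom)
  note eqI = presented_class_eqI[OF Oq_relators_mem, of _ _ \<theta> q]
  note mem = free_algebra_mult_mem free_algebra_scal_mult_mem Z_mem free_algebra_add_mem free_algebra_minus_mem
  have mult: "?p (x * y) = ?p x \<otimes>\<^bsub>Oq \<theta> q\<^esub> ?p y" if "x \<in> carrier ?F" "y \<in> carrier ?F" for x y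
    using P.hom_mult[OF that] by (simp add: free_algebra_simps)
  have add: "?p (x + y) = ?p x \<oplus>\<^bsub>Oq \<theta> q\<^esub> ?p y" if "x \<in> carrier ?F" "y \<in> carrier ?F" for x y
    using P.hom_add[OF that] by (simp add: free_algebra_simps)
  have smult: "?p (scal c * x) = c \<odot>\<^bsub>Oq \<theta> q\<^esub> ?p x" if "x \<in> carrier ?F" for c x
    using P.hom_smult[OF that, of c] by (simp add: free_algebra_simps)
  note hom = mult add smult mult.assoc[of "scal _"]
  have zq: "zq \<theta> q i j = ?p (Z \<theta> i j)" for i j by (simp add: zq_def)
  show ?thesis
  proof (intro quantum_borel.intro quantum_borel_axioms.intro P.target.complex_algebra_axioms assms)
    show "zq \<theta> q i j \<in> carrier (Oq \<theta> q)" for i j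
      unfolding zq by (intro P.hom_closed Z_mem)
    show "zq \<theta> q i j = \<zero>\<^bsub>Oq \<theta> q\<^esub>" if "j < i" for i j
      using P.hom_zero that by (simp add: zq Z_def upper_indices_def free_algebra_simps)
  next
    fix i j s assume "{i, j, s} \<subseteq> {1..\<theta> + 1}" "i < j"
    then have "Z \<theta> i s * Z \<theta> j s - scal q * Z \<theta> j s * Z \<theta> i s \<in> Oq_relators \<theta> q"
      unfolding Oq_relators_def Let_def by blast
    from eqI[OF this] show "complex_algebra.qcomm (Oq \<theta> q) q (zq \<theta> q i s) (zq \<theta> q j s)"
      by (simp add: P.target.qcomm_def zq hom mem)
  next
    fix i j s assume "{i, j, s} \<subseteq> {1..\<theta> + 1}" "i < j"
    then have "Z \<theta> s i * Z \<theta> s j - scal q * Z \<theta> s j * Z \<theta> s i \<in> Oq_relators \<theta> q"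
      unfolding Oq_relators_def Let_def by blast
    from eqI[OF this] show "complex_algebra.qcomm (Oq \<theta> q) q (zq \<theta> q s i) (zq \<theta> q s j)"
      by (simp add: P.target.qcomm_def zq hom mem)
  next
    fix i j s t assume "{i, j, s, t} \<subseteq> {1..\<theta> + 1}" "i < j" "s < t"
    then have "Z \<theta> i t * Z \<theta> j s - Z \<theta> j s * Z \<theta> i t \<in> Oq_relators \<theta> q"
      unfolding Oq_relators_def Let_def by blast
    from eqI[OF this] show "complex_algebra.qcomm (Oq \<theta> q) 1 (zq \<theta> q i t) (zq \<theta> q j s)"
      by (simp add: P.target.qcomm_one_iff zq hom mem P.hom_closed)
  next
    fix i j s t assume "{i, j, s, t} \<subseteq> {1..\<theta> + 1}" "i < j" "s < t"
    then have "Z \<theta> i s * Z \<theta> j t - Z \<theta> j t * Z \<theta> i s - scal (q - inverse q) * Z \<theta> i t * Z \<theta> j s \<in> Oq_relators \<theta> q"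
      unfolding Oq_relators_def Let_def by blast
    \<comment> \<open>Regrouped as a difference of two expressions, the form required by
      \<open>presented_class_eqI\<close>.\<close>
    then have "Z \<theta> i s * Z \<theta> j t - (Z \<theta> j t * Z \<theta> i s + scal (q - inverse q) * (Z \<theta> i t * Z \<theta> j s)) \<in> Oq_relators \<theta> q"
      by (simp only: diff_diff_add mult.assoc)
    from eqI[OF this] show "zq \<theta> q i s \<otimes>\<^bsub>Oq \<theta> q\<^esub> zq \<theta> q j t = zq \<theta> q j t \<otimes>\<^bsub>Oq \<theta> q\<^esub> zq \<theta> q i s
        \<oplus>\<^bsub>Oq \<theta> q\<^esub> (q - inverse q) \<odot>\<^bsub>Oq \<theta> q\<^esub> (zq \<theta> q i t \<otimes>\<^bsub>Oq \<theta> q\<^esub> zq \<theta> q j s)"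
      by (simp add: zq hom mem)
  next
    \<comment> \<open>Membership is carried along in the induction because multiplicativity of the
      class map is available on the carrier only.\<close>
    have prod: "prod_list (map (\<lambda>i. Z \<theta> i i) xs) \<in> carrier ?F \<and>
        ?p (prod_list (map (\<lambda>i. Z \<theta> i i) xs)) = list_mult (Oq \<theta> q) (map (\<lambda>i. zq \<theta> q i i) xs)" for xs
      using P.source.one_closed P.hom_one by (induction xs) (auto simp: free_algebra_simps zq hom mem)
    have "prod_list (map (\<lambda>i. Z \<theta> i i) [1..<\<theta> + 2]) - 1 \<in> Oq_relators \<theta> q"
      unfolding Oq_relators_def Let_def by blast
    from eqI[OF this] prod show "list_mult (Oq \<theta> q) (map (\<lambda>i. zq \<theta> q i i) [1..<\<theta> + 2]) = \<one>\<^bsub>Oq \<theta> q\<^esub>"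
      using P.source.one_closed P.hom_one by (simp add: free_algebra_simps del: upt_Suc)
  qed
qed

section \<open>The lifting\<close>

lemma coord_fun_range: "range (coord_fun \<theta>) \<subseteq> carrier (fun_algebra (carrier (Borel \<theta>)))"
  by (auto simp: coord_fun_def fun_algebra_def split: prod.splits)

text \<open>The entries of \<open>P\<close> on and above the diagonal are placed in a triangular
  matrix. Vanishing on the Borel subgroup thus implies vanishing at all torus points.\<close>

lemma torus_point_matrix:
  assumes P: "P \<in> torus_points \<theta>"
  obtains M where "M \<in> carrier (Borel \<theta>)" "\<And>p. p \<in> upper_indices \<theta> \<Longrightarrow> coord_fun \<theta> p M = P p"
proof
  let ?M = "mat (\<theta> + 1) (\<theta> + 1) (\<lambda>(a, b). if a \<le> b then P (a + 1, b + 1) else 0)"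
  have ut: "upper_triangular ?M" by (auto simp: upper_triangular_def)
  have "det ?M = (\<Prod>k = 0..<\<theta> + 1. P (k + 1, k + 1))"
    using det_upper_triangular[OF ut, of "\<theta> + 1"] by (simp add: prod_list_diag_prod)
  also have "\<dots> = (\<Prod>i = 1..\<theta> + 1. P (i, i))"
    unfolding atLeast0LessThan using prod.atLeast1_atMost_eq[of "\<lambda>i. P (i, i)" "\<theta> + 1"]
    by (simp del: prod.cl_ivl_Suc prod.lessThan_Suc)
  finally show M: "?M \<in> carrier (Borel \<theta>)"
    using ut P by (simp add: Borel_def torus_points_def)
  show "coord_fun \<theta> p ?M = P p" if "p \<in> upper_indices \<theta>" for p
    using that M by (cases p) (auto simp: coord_fun_def upper_indices_def)
qed

text \<open>This is one entry of \<open>Q * M = D * Q\<close>; triangularity of \<open>Q\<close> and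
  \<open>M\<close> bounds the summation index from below and above.\<close>

lemma conjugate_entry:
  assumes Q: "Q \<in> carrier (Borel \<theta>)" and D: "D \<in> carrier (Borel \<theta>)" "diagonal_mat D"
    and M: "M = inv\<^bsub>Borel \<theta>\<^esub> Q * D * Q" and ab: "a < \<theta> + 1" "b < \<theta> + 1"
  shows "(\<Sum>c\<in>{a..b}. Q $$ (a, c) * M $$ (c, b)) = D $$ (a, a) * Q $$ (a, b)"
proof -
  interpret group "Borel \<theta>" by (rule group_Borel)
  have mult: "A * B = A \<otimes>\<^bsub>Borel \<theta>\<^esub> B" for A B by (simp add: Borel_def)
  have M': "M = inv\<^bsub>Borel \<theta>\<^esub> Q \<otimes>\<^bsub>Borel \<theta>\<^esub> D \<otimes>\<^bsub>Borel \<theta>\<^esub> Q" by (simp only: M mult)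
  then have car: "M \<in> carrier (Borel \<theta>)" using Q D(1) by simp
  have "Q \<otimes>\<^bsub>Borel \<theta>\<^esub> M = Q \<otimes>\<^bsub>Borel \<theta>\<^esub> inv\<^bsub>Borel \<theta>\<^esub> Q \<otimes>\<^bsub>Borel \<theta>\<^esub> (D \<otimes>\<^bsub>Borel \<theta>\<^esub> Q)"
    unfolding M' using Q D(1) by (simp only: m_assoc m_closed inv_closed)
  then have eq: "Q * M = D * Q" using Q D(1) by (simp add: mult)
  have dims: "Q \<in> carrier_mat (\<theta> + 1) (\<theta> + 1)" "D \<in> carrier_mat (\<theta> + 1) (\<theta> + 1)" "M \<in> carrier_mat (\<theta> + 1) (\<theta> + 1)"
    and ut: "upper_triangular Q" "upper_triangular M"
    using Q D car by (auto simp: Borel_def)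
  have "(Q * M) $$ (a, b) = (\<Sum>c = 0..<\<theta> + 1. Q $$ (a, c) * M $$ (c, b))"
    using ab dims by (auto simp: scalar_prod_def)
  also have "\<dots> = (\<Sum>c\<in>{a..b}. Q $$ (a, c) * M $$ (c, b))"
  proof (rule sum.mono_neutral_right)
    show "\<forall>c\<in>{0..<\<theta> + 1} - {a..b}. Q $$ (a, c) * M $$ (c, b) = 0"
    proof
      fix c assume c: "c \<in> {0..<\<theta> + 1} - {a..b}"
      show "Q $$ (a, c) * M $$ (c, b) = 0"
        using upper_triangularD[OF ut(1), of c a] upper_triangularD[OF ut(2), of b c] c ab dims
        by (cases "c < a") auto
    qed
  qed (use ab in auto)
  finally have l: "(Q * M) $$ (a, b) = (\<Sum>c\<in>{a..b}. Q $$ (a, c) * M $$ (c, b))" .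
  have "(D * Q) $$ (a, b) = (\<Sum>c = 0..<\<theta> + 1. D $$ (a, c) * Q $$ (c, b))"
    using ab dims by (auto simp: scalar_prod_def)
  also have "\<dots> = (\<Sum>c\<in>{a}. D $$ (a, c) * Q $$ (c, b))"
    using ab dims D(2) by (intro sum.mono_neutral_right) (auto simp: diagonal_mat_def)
  finally show ?thesis using l eq by simp
qed

text \<open>The condition \<open>q\<^sup>2 \<noteq> 1\<close> serves two purposes:
  \<open>q - inverse q\<close> is nonzero, and \<open>q\<^sup>2\<close> is a nontrivial
  \<open>N\<close>-th root of unity, as \<open>z_pow_commute\<close> requires.\<close>

locale type_A_lifting =
  fixes \<theta> N :: nat and q :: complex and n :: "nat \<Rightarrow> nat" and \<mu> :: "nat \<Rightarrow> nat \<Rightarrow> complex"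
  assumes odd_N: "odd N" and q_pow: "q ^ N = 1" and q_sq: "q\<^sup>2 \<noteq> 1"
    and n_gt_1: "i \<in> {1..\<theta>} \<Longrightarrow> 1 < n i"
begin

lemma q_ne_0: "q \<noteq> 0"
  using q_pow odd_N by (auto simp: power_0_left split: if_splits)

sublocale quantum_borel "Oq \<theta> q" \<theta> q "zq \<theta> q"
  by (rule Oq_quantum_borel[OF q_ne_0])

abbreviation "B \<equiv> Oq \<theta> q"
abbreviation "FB \<equiv> fun_algebra (carrier (Borel \<theta>))"
abbreviation "u \<equiv> lifting \<theta> q N n \<mu>"
abbreviation "p \<equiv> p_mu \<theta> q N n \<mu>"
abbreviation zN where "zN \<equiv> \<lambda>(i, j). zq \<theta> q i j [^]\<^bsub>B\<^esub> N"

definition r :: "nat \<Rightarrow> nat \<Rightarrow> complex"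
  where "r i j = (- 1) powi (int i - int j - 1) * (1 - q powi (- 2)) ^ N * \<mu> i j"

lemma zN_range: "range zN \<subseteq> carrier B"
  by auto

text \<open>Two expressions for the same function differ by one that vanishes on the Borel subgroup,
  hence at all torus points, and \<open>z_pow_relation\<close> kills it. The set in the definition
  of \<open>iota\<close> is therefore a singleton.\<close>

lemma iota_free_lift:
  assumes f: "f \<in> carrier (free_algebra (upper_indices \<theta>))"
  shows "iota \<theta> q N (free_lift FB (coord_fun \<theta>) f) = free_lift B zN f"
proof -
  interpret FB: complex_algebra FB by (rule fun_algebra_complex_algebra)
  let ?c = "free_lift FB (coord_fun \<theta>)"
  have "free_lift B zN w = free_lift B zN f"
    if w: "w \<in> carrier (free_algebra (upper_indices \<theta>))" "?c w = ?c f" for w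
  proof -
    have wf: "w - f \<in> carrier (free_algebra (upper_indices \<theta>))" using w f by (intro free_algebra_minus_mem)
    have "free_lift B zN (w - f) = \<zero>\<^bsub>B\<^esub>"
    proof (rule z_pow_relation[OF q_pow q_sq wf])
      fix P assume "P \<in> torus_points \<theta>"
      then obtain M where M: "M \<in> carrier (Borel \<theta>)" "\<And>p. p \<in> upper_indices \<theta> \<Longrightarrow> coord_fun \<theta> p M = P p"
        by (rule torus_point_matrix) blast
      have "?c (w - f) = \<zero>\<^bsub>FB\<^esub>"
        using FB.free_lift_closed[OF coord_fun_range] by (simp add: FB.free_lift_minus[OF coord_fun_range] w(2))
      then have "?c (w - f) M = 0" using M(1) by (simp add: fun_algebra_def)
      then have "(\<Sum>x\<in>Poly_Mapping.keys (w - f). Poly_Mapping.lookup (w - f) x *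
          prod_list (map (\<lambda>p. coord_fun \<theta> p M) (letters x))) = 0"
        by (simp add: free_lift_fun_algebra[OF coord_fun_range M(1)])
      moreover have "map (\<lambda>p. coord_fun \<theta> p M) (letters x) = map P (letters x)"
        if "x \<in> Poly_Mapping.keys (w - f)" for x
        using that wf M(2) by (auto simp: free_algebra_def)
      ultimately show "(\<Sum>x\<in>Poly_Mapping.keys (w - f). Poly_Mapping.lookup (w - f) x *
          prod_list (map P (letters x))) = 0"
        by (simp cong: sum.cong)
    qed
    then show ?thesis using free_lift_closed[OF zN_range] by (simp add: free_lift_minus[OF zN_range])
  qed
  then have "free_lift B zN ` {w \<in> carrier (free_algebra (upper_indices \<theta>)). ?c w = ?c f} = {free_lift B zN f}"
    using f by blast
  then show ?thesis by (simp add: iota_def)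
qed

abbreviation "restrict_kernel \<equiv>
  a_kernel (O_Borel \<theta>) (fun_algebra (carrier (char_group (T_group \<theta> N n))))
    (comorphism (carrier (char_group (T_group \<theta> N n))) (iota_mu \<theta> q N n \<mu>))"

lemma restrict_kernel_iff:
  "f \<in> restrict_kernel \<longleftrightarrow> f \<in> free_lift FB (coord_fun \<theta>) ` carrier (free_algebra (upper_indices \<theta>)) \<and>
    (\<forall>\<gamma>\<in>carrier (char_group (T_group \<theta> N n)). f (iota_mu \<theta> q N n \<mu> \<gamma>) = 0)"
proof -
  let ?T = "carrier (char_group (T_group \<theta> N n))"
  have "(\<lambda>s\<in>?T. g s) = (\<lambda>s\<in>?T. 0) \<longleftrightarrow> (\<forall>s\<in>?T. g s = 0)" for g :: "_ \<Rightarrow> complex"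
    by (auto simp: restrict_def fun_eq_iff)
  moreover have "\<zero>\<^bsub>fun_algebra ?T\<^esub> = (\<lambda>s\<in>?T. 0)" by (simp add: fun_algebra_def)
  moreover have "carrier (O_Borel \<theta>) = free_lift FB (coord_fun \<theta>) ` carrier (free_algebra (upper_indices \<theta>))"
    by (simp add: O_Borel_def)
  ultimately show ?thesis by (simp add: a_kernel_def' comorphism_def)
qed

lemma iota_kernel_mem: "iota \<theta> q N ` restrict_kernel \<subseteq> carrier B"
proof
  fix y assume "y \<in> iota \<theta> q N ` restrict_kernel"
  then obtain f where f: "f \<in> restrict_kernel" "y = iota \<theta> q N f" by blast
  from f(1) obtain w where "w \<in> carrier (free_algebra (upper_indices \<theta>))" "f = free_lift FB (coord_fun \<theta>) w"
    unfolding restrict_kernel_iff by blast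
  then show "y \<in> carrier B" using f(2) iota_free_lift free_lift_closed[OF zN_range] by simp
qed

lemma lifting_ideal_eq: "lifting_ideal \<theta> q N n \<mu> = Idl\<^bsub>B\<^esub> (iota \<theta> q N ` restrict_kernel)"
  by (simp add: lifting_ideal_def Let_def)

lemma ideal_lifting_ideal: "ideal (lifting_ideal \<theta> q N n \<mu>) B"
  unfolding lifting_ideal_eq by (rule genideal_ideal[OF iota_kernel_mem])

lemma p_hom: "algebra_hom B u p"
  using quot_algebra_hom[OF ideal_lifting_ideal]
  unfolding lifting_def p_mu_def[abs_def] .

text \<open>This converts polynomial equations that hold on the image of \<open>iota_mu\<close> into
  relations of the lifting.\<close>

lemma p_zero:
  assumes w: "w \<in> carrier (free_algebra (upper_indices \<theta>))"
    and zero: "\<And>\<gamma>. \<gamma> \<in> carrier (char_group (T_group \<theta> N n)) \<Longrightarrow>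
      free_lift FB (coord_fun \<theta>) w (iota_mu \<theta> q N n \<mu> \<gamma>) = 0"
  shows "p (free_lift B zN w) = \<zero>\<^bsub>u\<^esub>"
proof -
  have "free_lift FB (coord_fun \<theta>) w \<in> restrict_kernel"
    unfolding restrict_kernel_iff using w zero by blast
  then have "free_lift B zN w \<in> iota \<theta> q N ` restrict_kernel" using iota_free_lift[OF w] by force
  then have "free_lift B zN w \<in> lifting_ideal \<theta> q N n \<mu>"
    unfolding lifting_ideal_eq using genideal_self[OF iota_kernel_mem] by blast
  then show ?thesis
    unfolding p_mu_def lifting_def zero_quot_algebra by (rule ideal.coset_of_mem[OF ideal_lifting_ideal])
qed

lemma Q_mat_entry:
  assumes "a < \<theta> + 1" "b < \<theta> + 1"
  shows "Q_mat \<theta> q N \<mu> $$ (a, b) = (if a = b then 1 else if a < b then r (a + 1) (b + 1) else 0)"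
  using assms by (simp add: Q_mat_def r_def)

text \<open>The entry \<open>(i, j)\<close> of \<open>Q M = P Q\<close>, where \<open>P\<^sub>i\<^sub>i = M\<^sub>i\<^sub>i\<close>.\<close>

lemma iota_mu_relation:
  assumes \<gamma>: "\<gamma> \<in> carrier (char_group (T_group \<theta> N n))" and ij: "1 \<le> i" "i < j" "j \<le> \<theta> + 1"
  defines "M \<equiv> iota_mu \<theta> q N n \<mu> \<gamma>"
  shows "M $$ (i - 1, j - 1) + (\<Sum>k\<in>{i + 1..j - 1}. r i k * M $$ (k - 1, j - 1)) +
    r i j * (M $$ (j - 1, j - 1) - M $$ (i - 1, i - 1)) = 0"
proof -
  let ?D = "torus_mat \<theta> N n \<gamma>" and ?Q = "Q_mat \<theta> q N \<mu>"
  obtain a b where ab: "i = Suc a" "j = Suc b" using ij by (cases i; cases j) auto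
  have n1: "\<And>i. i \<in> {1..\<theta>} \<Longrightarrow> 1 < n i" by (rule n_gt_1)
  have entry: "(\<Sum>c\<in>{a..b}. ?Q $$ (a, c) * M $$ (c, b)) = ?D $$ (a, a) * ?Q $$ (a, b)"
    if "a < \<theta> + 1" "b < \<theta> + 1" for a b
  proof (rule conjugate_entry[OF _ _ _ _ that])
    show "?Q \<in> carrier (Borel \<theta>)" by (rule Q_mat_Borel[OF n1])
    show "?D \<in> carrier (Borel \<theta>)" "diagonal_mat ?D" using torus_mat_Borel(1,2)[OF n1 \<gamma>] by auto
    show "M = inv\<^bsub>Borel \<theta>\<^esub> ?Q * ?D * ?Q" by (simp add: M_def iota_mu_def)
  qed
  have lt: "a < b" "b < \<theta> + 1" using ij ab by auto
  \<comment> \<open>For equal indices the sum has a single term, which identifies the diagonal of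
    \<open>M\<close> with that of the torus matrix.\<close>
  have diag: "M $$ (a, a) = ?D $$ (a, a)" using entry[of a a] lt by (simp add: Q_mat_entry)
  \<comment> \<open>The two end terms have the coefficients 1 and \<open>r i j\<close>; the inner
    terms are then reindexed from 0-based to 1-based indices.\<close>
  have "{a..b} = insert a (insert b {a<..<b})" using lt by auto
  then have "(\<Sum>c\<in>{a..b}. ?Q $$ (a, c) * M $$ (c, b)) =
      M $$ (a, b) + (r i j * M $$ (b, b) + (\<Sum>c\<in>{a<..<b}. ?Q $$ (a, c) * M $$ (c, b)))"
    using lt by (simp add: Q_mat_entry ab)
  also have "(\<Sum>c\<in>{a<..<b}. ?Q $$ (a, c) * M $$ (c, b)) = (\<Sum>k\<in>{i + 1..j - 1}. r i k * M $$ (k - 1, b))"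
    using lt by (intro sum.reindex_bij_witness[of _ "\<lambda>k. k - 1" Suc]) (auto simp: Q_mat_entry ab)
  finally show ?thesis using entry[of a b] lt diag by (simp add: Q_mat_entry ab algebra_simps)
qed

end

section \<open>The homomorphism \<psi> and the images of the root vectors\<close>

lemma Uq_hom:
  "algebra_hom (free_algebra (uq_gens \<theta>)) (Uq \<theta> q) (presented_class (uq_gens \<theta>) (Uq_relators \<theta> q))"
  unfolding Uq_def by (rule presented_class_hom[OF Uq_relators_mem])

context type_A_lifting
begin

lemma psi_gen_eq:
  "psi_gen \<theta> q (Kgen m) = torus_elt m" "psi_gen \<theta> q (Egen j) = E j"
  by (simp_all add: torus_elt_def fund_def E_def e_def del: upt_Suc)

lemma psi_gen_closed:
  assumes "x \<in> uq_gens \<theta>"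
  shows "psi_gen \<theta> q x \<in> carrier B"
  using assms Units_closed[OF torus_elt_Units] E_closed
  by (auto simp: uq_gens_def psi_gen_eq simp del: psi_gen.simps)

lemma uq_gens_mem:
  "Kgen m \<in> uq_gens \<theta> \<longleftrightarrow> m \<in> weight_lattice \<theta>" "Egen j \<in> uq_gens \<theta> \<longleftrightarrow> j \<in> {1..\<theta>}"
  by (auto simp: uq_gens_def)

lemma weight_lattice_closed:
  "0 \<in> weight_lattice \<theta>"
  "m \<in> weight_lattice \<theta> \<Longrightarrow> m' \<in> weight_lattice \<theta> \<Longrightarrow> m + m' \<in> weight_lattice \<theta>"
  "m \<in> weight_lattice \<theta> \<Longrightarrow> - m \<in> weight_lattice \<theta>"
  "i \<in> {1..\<theta>} \<Longrightarrow> frag_of i \<in> weight_lattice \<theta>"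
  using Poly_Mapping.keys_add[of m m']
  by (auto simp: weight_lattice_def free_Abelian_group_def keys_frag_of)

lemma simple_root_weight: "simple_root \<theta> i \<in> weight_lattice \<theta>"
proof -
  have "frag_cmul c m \<in> weight_lattice \<theta>" if "m \<in> weight_lattice \<theta>" for c m
    using that keys_cmul[of c m] by (auto simp: weight_lattice_def free_Abelian_group_def)
  then have "(\<Sum>j\<in>K. frag_cmul (cartan j i) (frag_of j)) \<in> weight_lattice \<theta>" if "K \<subseteq> {1..\<theta>}" for K
    using that
  proof (induction K rule: infinite_finite_induct)
    case (insert k K)
    then show ?case by (simp add: weight_lattice_closed)
  qed (auto simp: weight_lattice_closed)
  then show ?thesis by (simp add: simple_root_def)
qed

text \<open>Needed for \<psi> to descend to the presented algebra. The five families of relators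
  correspond to the identities for \<open>torus_elt\<close> and \<open>E\<close> established
  before.\<close>

lemma psi_relators:
  assumes "\<rho> \<in> Uq_relators \<theta> q"
  shows "free_lift B (\<lambda>x. if x \<in> uq_gens \<theta> then psi_gen \<theta> q x else \<zero>\<^bsub>B\<^esub>) \<rho> = \<zero>\<^bsub>B\<^esub>"
proof -
  let ?h = "\<lambda>x. if x \<in> uq_gens \<theta> then psi_gen \<theta> q x else \<zero>\<^bsub>B\<^esub>"
  have range: "range ?h \<subseteq> carrier B" using psi_gen_closed by auto
  note [simp del] = psi_gen.simps
  note linear = free_lift_minus[OF range] free_lift_add[OF range] free_lift_scal_mult[OF range] mult.assoc[of "scal _"]
  note lift = free_lift_minus[OF range] free_lift_mult[OF range] free_lift_gen[OF range] free_lift_one[OF range]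
  have K: "torus_elt m \<in> carrier B" for m using torus_elt_Units by blast
  consider m m' where "m \<in> weight_lattice \<theta>" "m' \<in> weight_lattice \<theta>" "\<rho> = gen (Kgen m) * gen (Kgen m') - gen (Kgen (m + m'))"
    | "\<rho> = gen (Kgen 0) - 1"
    | i j where "i \<in> {1..\<theta>}" "j \<in> {1..\<theta>}" "\<rho> = gen (Kgen (frag_of i)) * gen (Egen j) * gen (Kgen (- frag_of i)) -
        scal (if i = j then q else 1) * gen (Egen j)"
    | i j where "i \<in> {1..\<theta>}" "j \<in> {1..\<theta>}" "cartan i j = 0" "\<rho> = gen (Egen i) * gen (Egen j) - gen (Egen j) * gen (Egen i)"
    | i j where "i \<in> {1..\<theta>}" "j \<in> {1..\<theta>}" "cartan i j = - 1"
        "\<rho> = gen (Egen i) * gen (Egen i) * gen (Egen j) - scal (q + inverse q) * gen (Egen i) * gen (Egen j) * gen (Egen i)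
          + gen (Egen j) * gen (Egen i) * gen (Egen i)"
    using assms unfolding Uq_relators_def Let_def by blast
  then show ?thesis
  proof cases
    case 1
    then show ?thesis using K by (simp add: lift uq_gens_mem weight_lattice_closed psi_gen_eq torus_elt_add)
  next
    case 2
    then show ?thesis by (simp add: lift uq_gens_mem weight_lattice_closed psi_gen_eq torus_elt_0)
  next
    case 3
    then show ?thesis using E_closed[of j]
      by (simp only: linear, simp only: lift uq_gens_mem weight_lattice_closed psi_gen_eq if_True torus_E_conj)
        (simp add: minus_eq r_neg)
  next
    case 4
    then show ?thesis using E_far_commute[of i j] E_closed
      by (simp only: lift uq_gens_mem psi_gen_eq if_True) (simp add: minus_eq r_neg)
  next
    case 5
    have c: "E i \<in> carrier B" "E j \<in> carrier B" using E_closed 5 by auto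
    show ?thesis using E_serre[OF 5(1-3)] 5(1,2) c
      by (simp only: 5(4) linear, simp only: lift uq_gens_mem psi_gen_eq if_True smult_mult_left m_closed)
  qed
qed

lemma psi_hom: "algebra_hom (Uq \<theta> q) B (psi \<theta> q)"
  using presented_algebra_hom(1)[OF Uq_relators_mem complex_algebra_axioms psi_gen_closed psi_relators]
  unfolding Uq_def psi_def[abs_def] .

lemma psi_Kq: "m \<in> weight_lattice \<theta> \<Longrightarrow> psi \<theta> q (Kq \<theta> q m) = torus_elt m"
  using presented_algebra_hom(2)[OF Uq_relators_mem complex_algebra_axioms psi_gen_closed psi_relators, where x = "Kgen m"]
  unfolding psi_def Kq_def psi_gen_eq by (simp add: uq_gens_mem)

lemma psi_Eq: "j \<in> {1..\<theta>} \<Longrightarrow> psi \<theta> q (Eq \<theta> q j) = E j"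
  using presented_algebra_hom(2)[OF Uq_relators_mem complex_algebra_axioms psi_gen_closed psi_relators, where x = "Egen j"]
  unfolding psi_def Eq_def psi_gen_eq by (simp add: uq_gens_mem)

lemma Eq_closed: "j \<in> {1..\<theta>} \<Longrightarrow> Eq \<theta> q j \<in> carrier (Uq \<theta> q)"
proof -
  interpret P: algebra_hom "free_algebra (uq_gens \<theta>)" "Uq \<theta> q" "presented_class (uq_gens \<theta>) (Uq_relators \<theta> q)"
    by (rule Uq_hom)
  show "j \<in> {1..\<theta>} \<Longrightarrow> Eq \<theta> q j \<in> carrier (Uq \<theta> q)"
    unfolding Eq_def by (intro P.hom_closed free_algebra_gen_mem) (simp add: uq_gens_mem)
qed

text \<open>Each step of the recursion for root vectors brackets with a further \<open>E j\<close>.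
  Its scalar cancels against the one in \<open>e_bracket\<close> up to the factor
  \<open>- inverse q\<close>.\<close>

definition root_coeff :: "nat \<Rightarrow> nat \<Rightarrow> complex"
  where "root_coeff i j = - inverse (q - inverse q) * (- inverse q) ^ (j - i - 1)"

lemma q_minus_inverse: "q - inverse q \<noteq> 0"
  using q_sq q_ne_0 by (auto simp: field_simps power2_eq_square)

lemma psi_root_vector:
  assumes "1 \<le> i"
  shows "i < j \<Longrightarrow> j \<le> \<theta> + 1 \<Longrightarrow> root_vector \<theta> q i j \<in> carrier (Uq \<theta> q) \<and>
    psi \<theta> q (root_vector \<theta> q i j) = root_coeff i j \<odot>\<^bsub>B\<^esub> e i j"
proof (induction j)
  case (Suc j)
  interpret psi: algebra_hom "Uq \<theta> q" B "psi \<theta> q" by (rule psi_hom)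
  have j: "j \<in> {1..\<theta>}" using Suc.prems assms by auto
  show ?case
  proof (cases "i < j")
    case False
    then have "i = j" using Suc.prems by simp
    then show ?thesis using Eq_closed[OF j] psi_Eq[OF j] by (simp add: E_def root_coeff_def)
  next
    case True
    let ?x = "root_vector \<theta> q i j" and ?c = "- inverse (q - inverse q)"
    have x: "?x \<in> carrier (Uq \<theta> q)" "psi \<theta> q ?x = root_coeff i j \<odot>\<^bsub>B\<^esub> e i j"
      using Suc.IH True Suc.prems by auto
    have car: "e i j \<in> carrier B" "e j (j + 1) \<in> carrier B" "e i (j + 1) \<in> carrier B"
      using j by (auto intro!: e_closed)
    note y = Eq_closed[OF j]
    have eq: "root_vector \<theta> q i (Suc j) = ?x \<otimes>\<^bsub>Uq \<theta> q\<^esub> Eq \<theta> q j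
         \<ominus>\<^bsub>Uq \<theta> q\<^esub> inverse q \<odot>\<^bsub>Uq \<theta> q\<^esub> (Eq \<theta> q j \<otimes>\<^bsub>Uq \<theta> q\<^esub> ?x)"
      using True by simp
    have "psi \<theta> q (root_vector \<theta> q i (Suc j)) =
        (root_coeff i j \<odot>\<^bsub>B\<^esub> e i j) \<otimes>\<^bsub>B\<^esub> (?c \<odot>\<^bsub>B\<^esub> e j (j + 1))
         \<ominus>\<^bsub>B\<^esub> inverse q \<odot>\<^bsub>B\<^esub> ((?c \<odot>\<^bsub>B\<^esub> e j (j + 1)) \<otimes>\<^bsub>B\<^esub> (root_coeff i j \<odot>\<^bsub>B\<^esub> e i j))"
      unfolding eq using x y psi_Eq[OF j] by (simp add: psi.hom_minus psi.hom_smult E_def del: root_vector.simps)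
    also have "\<dots> = (root_coeff i j * ?c) \<odot>\<^bsub>B\<^esub>
        (e i j \<otimes>\<^bsub>B\<^esub> e j (j + 1) \<ominus>\<^bsub>B\<^esub> inverse q \<odot>\<^bsub>B\<^esub> (e j (j + 1) \<otimes>\<^bsub>B\<^esub> e i j))"
      using car by (simp add: smult_mult_left smult_mult_right smult_smult smult_minus_right mult_ac)
    also have "\<dots> = (root_coeff i j * ?c * (inverse q * (q - inverse q))) \<odot>\<^bsub>B\<^esub> e i (j + 1)"
      using e_bracket[of i j "j + 1"] assms True j car by (simp add: smult_smult)
    also have "root_coeff i j * ?c * (inverse q * (q - inverse q)) = root_coeff i j * (- inverse q)"
    proof -
      have "- inverse d * (a * d) = - a" if "d \<noteq> 0" for a d :: complex using that by simp
      from this[OF q_minus_inverse] show ?thesis by (simp only: mult.assoc)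
    qed
    also have "\<dots> = root_coeff i (Suc j)"
    proof -
      have "Suc j - i - 1 = Suc (j - i - 1)" using True by simp
      then show ?thesis by (simp add: root_coeff_def)
    qed
    finally show ?thesis unfolding eq using x(1) y by (simp del: root_vector.simps)
  qed
qed simp

text \<open>\<open>q - inverse q\<close> is \<open>q\<close> times \<open>1 - q powi (- 2)\<close>,
  and \<open>q\<close> disappears in the \<open>N\<close>-th power. As \<open>N\<close> is odd, each
  of the \<open>j - i\<close> negative factors keeps its sign.\<close>

lemma root_coeff_pow:
  assumes "i < j"
  shows "root_coeff i j ^ N = (- 1) ^ (j - i) * inverse ((1 - q powi (- 2)) ^ N)"
proof -
  have l: "(q - inverse q) ^ N = (1 - q powi (- 2)) ^ N"
  proof -
    have "q - inverse q = q * (1 - q powi (- 2))"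
      using q_ne_0 by (simp add: power_int_minus field_simps power2_eq_square)
    then show ?thesis by (simp add: power_mult_distrib q_pow)
  qed
  have i: "(- inverse q) ^ N = - 1"
    using odd_N q_pow by (simp add: power_inverse)
  have "root_coeff i j ^ N = (- inverse (q - inverse q)) ^ N * ((- inverse q) ^ N) ^ (j - i - 1)"
    by (simp only: root_coeff_def power_mult_distrib mult.commute[of N] flip: power_mult)
  also have "(- inverse (q - inverse q)) ^ N = - inverse ((1 - q powi (- 2)) ^ N)"
    using odd_N l by (simp add: power_inverse)
  also have "\<dots> * ((- inverse q) ^ N) ^ (j - i - 1) = (- 1) ^ Suc (j - i - 1) * inverse ((1 - q powi (- 2)) ^ N)"
    by (simp add: i)
  also have "Suc (j - i - 1) = j - i" using assms by simp
  finally show ?thesis .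
qed

lemma x_root_pow:
  assumes "1 \<le> i" "i < j" "j \<le> \<theta> + 1"
  shows "x_root \<theta> q N n \<mu> i j [^]\<^bsub>u\<^esub> N =
    p ((- 1) ^ (j - i) * inverse ((1 - q powi (- 2)) ^ N) \<odot>\<^bsub>B\<^esub> e i j [^]\<^bsub>B\<^esub> N)"
proof -
  interpret p: algebra_hom B u p by (rule p_hom)
  have e: "e i j \<in> carrier B" using assms by (intro e_closed) auto
  show ?thesis
    using psi_root_vector[OF assms] e
    by (simp add: x_root_def smult_pow root_coeff_pow[OF assms(2)] flip: p.hom_nat_pow)
qed

lemma g_simple_eq: "i \<in> {1..\<theta>} \<Longrightarrow> g_simple \<theta> q N n \<mu> i =
    p (zq \<theta> q i i \<otimes>\<^bsub>B\<^esub> inv\<^bsub>B\<^esub> zq \<theta> q (i + 1) (i + 1))"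
  by (simp only: g_simple_def psi_Kq[OF simple_root_weight] torus_elt_simple_root)

text \<open>Each factor is the image of a diagonal generator times the inverse of the next one, so
  the product telescopes.\<close>

lemma g_root_eq:
  assumes "1 \<le> i" "i < j" "j \<le> \<theta> + 1"
  shows "g_root \<theta> q N n \<mu> i j = p (zq \<theta> q i i \<otimes>\<^bsub>B\<^esub> inv\<^bsub>B\<^esub> zq \<theta> q j j)"
proof -
  interpret p: algebra_hom B u p by (rule p_hom)
  let ?w = "\<lambda>k. zq \<theta> q k k \<otimes>\<^bsub>B\<^esub> inv\<^bsub>B\<^esub> zq \<theta> q (k + 1) (k + 1)"
  have U: "zq \<theta> q k k \<in> Units B" if "i \<le> k" "k \<le> j" for k using that assms by (intro z_diag_Units) auto
  have wc: "?w k \<in> carrier B" if "i \<le> k" "k < j" for k using U[of "k + 1"] that by auto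
  have "map (g_simple \<theta> q N n \<mu>) [i..<j] = map p (map ?w [i..<j])"
    unfolding map_map comp_def using assms by (intro map_cong refl g_simple_eq) auto
  then have "g_root \<theta> q N n \<mu> i j = list_mult u (map p (map ?w [i..<j]))"
    by (simp only: g_root_def)
  also have "\<dots> = p (list_mult B (map ?w [i..<j]))"
    using wc by (intro p.hom_list_mult[symmetric]) auto
  also have "list_mult B (map ?w [i..<j]) = zq \<theta> q i i \<otimes>\<^bsub>B\<^esub> inv\<^bsub>B\<^esub> zq \<theta> q j j"
    using assms(2) U wc
  proof (induction j)
    case (Suc j)
    show ?case
    proof (cases "i = j")
      case True
      then show ?thesis using Suc.prems(3)[of j] by simp
    next
      case False
      then have ij: "i < j" using Suc.prems by simp
      have Uj: "zq \<theta> q i i \<in> Units B" "zq \<theta> q j j \<in> Units B" "zq \<theta> q (Suc j) (Suc j) \<in> Units B"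
        using Suc.prems(2) ij by auto
      have "list_mult B (map ?w [i..<Suc j]) = list_mult B (map ?w [i..<j] @ [?w j])" using ij by simp
      also have "\<dots> = list_mult B (map ?w [i..<j]) \<otimes>\<^bsub>B\<^esub> list_mult B [?w j]"
        using Suc.prems(3) ij by (intro list_mult_append) auto
      also have "list_mult B (map ?w [i..<j]) = zq \<theta> q i i \<otimes>\<^bsub>B\<^esub> inv\<^bsub>B\<^esub> zq \<theta> q j j"
        using Suc.IH ij Suc.prems by simp
      also have "list_mult B [?w j] = ?w j" using Suc.prems(3)[of j] ij by simp
      also have "zq \<theta> q i i \<otimes>\<^bsub>B\<^esub> inv\<^bsub>B\<^esub> zq \<theta> q j j \<otimes>\<^bsub>B\<^esub> ?w j =
          zq \<theta> q i i \<otimes>\<^bsub>B\<^esub> (inv\<^bsub>B\<^esub> zq \<theta> q j j \<otimes>\<^bsub>B\<^esub> zq \<theta> q j j) \<otimes>\<^bsub>B\<^esub> inv\<^bsub>B\<^esub> zq \<theta> q (j + 1) (j + 1)"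
        using Uj by (simp add: m_assoc Units_closed del: Units_l_inv)
      finally show ?thesis using Uj by (simp add: Units_closed)
    qed
  qed simp
  finally show ?thesis .
qed

lemma diag_quotient_pow:
  assumes "i \<in> {1..\<theta> + 1}" "j \<in> {1..\<theta> + 1}"
  shows "(zq \<theta> q i i \<otimes>\<^bsub>B\<^esub> inv\<^bsub>B\<^esub> zq \<theta> q j j) [^]\<^bsub>B\<^esub> N =
    zq \<theta> q i i [^]\<^bsub>B\<^esub> N \<otimes>\<^bsub>B\<^esub> inv\<^bsub>B\<^esub> (zq \<theta> q j j [^]\<^bsub>B\<^esub> N)"
proof -
  have U: "zq \<theta> q j j \<in> Units B" using assms by (intro z_diag_Units) auto
  have "qcomm (inverse 1) (inv\<^bsub>B\<^esub> zq \<theta> q j j) (zq \<theta> q i i)"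
    using assms U by (intro qcomm_inv_left z_diag_diag) auto
  then have "(zq \<theta> q i i \<otimes>\<^bsub>B\<^esub> inv\<^bsub>B\<^esub> zq \<theta> q j j) [^]\<^bsub>B\<^esub> N =
      1 ^ (N choose 2) \<odot>\<^bsub>B\<^esub> (zq \<theta> q i i [^]\<^bsub>B\<^esub> N \<otimes>\<^bsub>B\<^esub> inv\<^bsub>B\<^esub> zq \<theta> q j j [^]\<^bsub>B\<^esub> N)"
    using U by (intro qcomm_mult_pow) auto
  then show ?thesis using U inv_pow_Units[OF U, of N] by (simp add: smult_one Units_pow_closed)
qed

lemma power_relation:
  assumes ij: "1 \<le> i" "i < j" "j \<le> \<theta> + 1"
  shows "p (e i j [^]\<^bsub>B\<^esub> N \<oplus>\<^bsub>B\<^esub> (\<Oplus>\<^bsub>B\<^esub>k\<in>{i + 1..j - 1}. r i k \<odot>\<^bsub>B\<^esub> e k j [^]\<^bsub>B\<^esub> N) \<oplus>\<^bsub>B\<^esub>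
    r i j \<odot>\<^bsub>B\<^esub> (\<one>\<^bsub>B\<^esub> \<ominus>\<^bsub>B\<^esub> (zq \<theta> q i i \<otimes>\<^bsub>B\<^esub> inv\<^bsub>B\<^esub> zq \<theta> q j j) [^]\<^bsub>B\<^esub> N)) = \<zero>\<^bsub>u\<^esub>"
proof -
  interpret p: algebra_hom B u p by (rule p_hom)
  interpret FB: complex_algebra FB by (rule fun_algebra_complex_algebra)
  let ?K = "{i + 1..j - 1}"
  \<comment> \<open>A polynomial expression whose value at a point of the image of
    \<open>iota_mu\<close> is the left side of \<open>iota_mu_relation\<close>.\<close>
  define w where "w = Z \<theta> i j + (\<Sum>k\<in>?K. scal (r i k) * Z \<theta> k j) + scal (r i j) * (Z \<theta> j j - Z \<theta> i i)"
  have w: "w \<in> carrier (free_algebra (upper_indices \<theta>))"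
    unfolding w_def
    by (intro free_algebra_add_mem free_algebra_sum_mem free_algebra_scal_mult_mem free_algebra_minus_mem Z_mem)
  have up: "(k, j) \<in> upper_indices \<theta>" if "k \<in> {i..j}" for k
    using that ij by (auto simp: upper_indices_def)
  have up_i: "(i, i) \<in> upper_indices \<theta>" using ij by (auto simp: upper_indices_def)
  have n1: "\<And>i. i \<in> {1..\<theta>} \<Longrightarrow> 1 < n i" by (rule n_gt_1)
  have zero: "p (free_lift B zN w) = \<zero>\<^bsub>u\<^esub>"
  proof (rule p_zero[OF w])
    fix \<gamma> assume \<gamma>: "\<gamma> \<in> carrier (char_group (T_group \<theta> N n))"
    let ?M = "iota_mu \<theta> q N n \<mu> \<gamma>"
    have M: "?M \<in> carrier (Borel \<theta>)"
      using iota_mu_mon[OF n1] \<gamma> by (auto simp: mon_def hom_def Pi_def)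
    have gen: "free_lift FB (coord_fun \<theta>) (Z \<theta> k l) ?M = ?M $$ (k - 1, l - 1)" if "(k, l) \<in> upper_indices \<theta>" for k l
    proof -
      have "free_lift FB (coord_fun \<theta>) (Z \<theta> k l) = coord_fun \<theta> (k, l)"
        using that by (simp add: Z_def FB.free_lift_gen[OF coord_fun_range])
      then show ?thesis using M by (simp add: coord_fun_def)
    qed
    have ops: "(f \<oplus>\<^bsub>FB\<^esub> g) ?M = f ?M + g ?M" "(c \<odot>\<^bsub>FB\<^esub> f) ?M = c * f ?M" for f g c
      using M by (simp_all add: fun_algebra_def)
    have diff: "free_lift FB (coord_fun \<theta>) (a - b) ?M =
        free_lift FB (coord_fun \<theta>) a ?M - free_lift FB (coord_fun \<theta>) b ?M" for a b
      using ops(1) FB.free_lift_add[OF coord_fun_range, of "a - b" b] by simp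
    have "free_lift FB (coord_fun \<theta>) w ?M = ?M $$ (i - 1, j - 1) +
        (\<Sum>k\<in>?K. r i k * ?M $$ (k - 1, j - 1)) + r i j * (?M $$ (j - 1, j - 1) - ?M $$ (i - 1, i - 1))"
    proof -
      have "(\<Oplus>\<^bsub>FB\<^esub>k\<in>?K. free_lift FB (coord_fun \<theta>) (scal (r i k) * Z \<theta> k j)) ?M =
          (\<Sum>k\<in>?K. free_lift FB (coord_fun \<theta>) (scal (r i k) * Z \<theta> k j) ?M)"
        using M by (intro finsum_fun_algebra FB.free_lift_closed[OF coord_fun_range]) auto
      also have "\<dots> = (\<Sum>k\<in>?K. r i k * ?M $$ (k - 1, j - 1))"
        using ij by (intro sum.cong refl) (auto simp: FB.free_lift_scal_mult[OF coord_fun_range] ops gen up)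
      finally show ?thesis
        using ij unfolding w_def
        by (simp add: FB.free_lift_add[OF coord_fun_range] FB.free_lift_sum[OF coord_fun_range] ops diff
            FB.free_lift_scal_mult[OF coord_fun_range] gen up up_i)
    qed
    then show "free_lift FB (coord_fun \<theta>) w ?M = 0" using iota_mu_relation[OF \<gamma> ij] by simp
  qed
  let ?z = "\<lambda>k l. zq \<theta> q k l [^]\<^bsub>B\<^esub> N" and ?v = "inv\<^bsub>B\<^esub> (zq \<theta> q j j [^]\<^bsub>B\<^esub> N)"
  have U: "zq \<theta> q j j [^]\<^bsub>B\<^esub> N \<in> Units B" using ij by (intro Units_pow_closed z_diag_Units) auto
  then have v: "?v \<in> carrier B" by blast
  have gen: "free_lift B zN (Z \<theta> k l) = ?z k l" if "(k, l) \<in> upper_indices \<theta>" for k l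
    using that by (simp add: Z_def free_lift_gen[OF zN_range])
  have "free_lift B zN w = ?z i j \<oplus>\<^bsub>B\<^esub> (\<Oplus>\<^bsub>B\<^esub>k\<in>?K. free_lift B zN (scal (r i k) * Z \<theta> k j)) \<oplus>\<^bsub>B\<^esub>
      r i j \<odot>\<^bsub>B\<^esub> (?z j j \<ominus>\<^bsub>B\<^esub> ?z i i)"
    using ij unfolding w_def
    by (simp add: free_lift_add[OF zN_range] free_lift_sum[OF zN_range] free_lift_minus[OF zN_range]
        free_lift_scal_mult[OF zN_range] gen up up_i)
  also have "(\<Oplus>\<^bsub>B\<^esub>k\<in>?K. free_lift B zN (scal (r i k) * Z \<theta> k j)) = (\<Oplus>\<^bsub>B\<^esub>k\<in>?K. r i k \<odot>\<^bsub>B\<^esub> ?z k j)"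
    using ij by (intro finsum_cong') (auto simp: free_lift_scal_mult[OF zN_range] gen up)
  finally have lift: "free_lift B zN w = ?z i j \<oplus>\<^bsub>B\<^esub> (\<Oplus>\<^bsub>B\<^esub>k\<in>?K. r i k \<odot>\<^bsub>B\<^esub> ?z k j) \<oplus>\<^bsub>B\<^esub>
      r i j \<odot>\<^bsub>B\<^esub> (?z j j \<ominus>\<^bsub>B\<^esub> ?z i i)" .
  \<comment> \<open>All terms lie in column \<open>j\<close> and share the denominator
    \<open>zq \<theta> q j j\<close>, so a single factor \<open>?v\<close> turns each of them into a
    power of some \<open>e k j\<close>.\<close>
  have sum_v: "(\<Oplus>\<^bsub>B\<^esub>k\<in>?K. r i k \<odot>\<^bsub>B\<^esub> ?z k j) \<otimes>\<^bsub>B\<^esub> ?v = (\<Oplus>\<^bsub>B\<^esub>k\<in>?K. r i k \<odot>\<^bsub>B\<^esub> e k j [^]\<^bsub>B\<^esub> N)"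
  proof -
    have "(\<Oplus>\<^bsub>B\<^esub>k\<in>?K. r i k \<odot>\<^bsub>B\<^esub> ?z k j) \<otimes>\<^bsub>B\<^esub> ?v = (\<Oplus>\<^bsub>B\<^esub>k\<in>?K. (r i k \<odot>\<^bsub>B\<^esub> ?z k j) \<otimes>\<^bsub>B\<^esub> ?v)"
      using v by (intro finsum_ldistr) auto
    also have "\<dots> = (\<Oplus>\<^bsub>B\<^esub>k\<in>?K. r i k \<odot>\<^bsub>B\<^esub> e k j [^]\<^bsub>B\<^esub> N)"
    proof (rule finsum_cong'[OF refl])
      show "(\<lambda>k. r i k \<odot>\<^bsub>B\<^esub> e k j [^]\<^bsub>B\<^esub> N) \<in> ?K \<rightarrow> carrier B"
        using ij by (auto intro!: smult_closed nat_pow_closed e_closed)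
      show "(r i k \<odot>\<^bsub>B\<^esub> ?z k j) \<otimes>\<^bsub>B\<^esub> ?v = r i k \<odot>\<^bsub>B\<^esub> e k j [^]\<^bsub>B\<^esub> N" if "k \<in> ?K" for k
      proof -
        have "e k j [^]\<^bsub>B\<^esub> N = ?z k j \<otimes>\<^bsub>B\<^esub> ?v" using that ij by (intro e_pow odd_N q_pow) auto
        then show ?thesis using v by (simp add: smult_mult_left)
      qed
    qed
    finally show ?thesis .
  qed
  have sum_car: "(\<Oplus>\<^bsub>B\<^esub>k\<in>?K. r i k \<odot>\<^bsub>B\<^esub> ?z k j) \<in> carrier B" by (intro finsum_closed) auto
  \<comment> \<open>In the last term \<open>?z j j\<close> cancels against \<open>?v\<close>, while
    \<open>?z i i \<otimes> ?v\<close> is the \<open>N\<close>-th power of the quotient of diagonal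
    generators.\<close>
  have "free_lift B zN w \<otimes>\<^bsub>B\<^esub> ?v = e i j [^]\<^bsub>B\<^esub> N \<oplus>\<^bsub>B\<^esub> (\<Oplus>\<^bsub>B\<^esub>k\<in>?K. r i k \<odot>\<^bsub>B\<^esub> e k j [^]\<^bsub>B\<^esub> N) \<oplus>\<^bsub>B\<^esub>
      r i j \<odot>\<^bsub>B\<^esub> (\<one>\<^bsub>B\<^esub> \<ominus>\<^bsub>B\<^esub> ?z i i \<otimes>\<^bsub>B\<^esub> ?v)"
    unfolding lift sum_v[symmetric] e_pow[OF odd_N q_pow ij]
    using v U sum_car by (simp add: l_distr smult_mult_left minus_eq l_minus)
  moreover have "p (free_lift B zN w \<otimes>\<^bsub>B\<^esub> ?v) = \<zero>\<^bsub>u\<^esub>"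
    using zero v free_lift_closed[OF zN_range] by simp
  ultimately show ?thesis using ij diag_quotient_pow[of i j] by simp
qed

end

section \<open>Rescaling to the power root vector relation\<close>

context type_A_lifting
begin

lemma one_minus_q_nonzero: "(1 - q powi (- 2)) ^ N \<noteq> 0"
  using q_sq q_ne_0 by (auto simp: power_int_minus power2_eq_square field_simps)

text \<open>The exponent is the negative of \<open>k - i + 1\<close>, and a sign is its own
  inverse.\<close>

lemma neg_one_powi: "i < k \<Longrightarrow> (- 1 :: complex) powi (int i - int k - 1) = - ((- 1) ^ (k - i))"
proof -
  assume "i < k"
  then have "int i - int k - 1 = - int (Suc (k - i))" by simp
  then have "(- 1 :: complex) powi (int i - int k - 1) = inverse ((- 1) ^ Suc (k - i))"
    by (simp only: power_int_minus power_int_of_nat)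
  then show ?thesis by (simp add: power_inverse[symmetric])
qed

theorem x_root_power_relation:
  assumes ij: "1 \<le> i" "i < j" "j \<le> \<theta> + 1"
  shows "x_root \<theta> q N n \<mu> i j [^]\<^bsub>u\<^esub> N =
    (\<mu> i j \<odot>\<^bsub>u\<^esub> (\<one>\<^bsub>u\<^esub> \<ominus>\<^bsub>u\<^esub> g_root \<theta> q N n \<mu> i j [^]\<^bsub>u\<^esub> N)) \<oplus>\<^bsub>u\<^esub>
    (\<Oplus>\<^bsub>u\<^esub>k\<in>{i + 1..j - 1}. ((1 - q powi (- 2)) ^ N * \<mu> i k) \<odot>\<^bsub>u\<^esub> x_root \<theta> q N n \<mu> k j [^]\<^bsub>u\<^esub> N)"
proof -
  interpret p: algebra_hom B u p by (rule p_hom)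
  let ?K = "{i + 1..j - 1}" and ?l = "(1 - q powi (- 2)) ^ N"
  let ?x = "\<lambda>k. x_root \<theta> q N n \<mu> k j [^]\<^bsub>u\<^esub> N" and ?g = "zq \<theta> q i i \<otimes>\<^bsub>B\<^esub> inv\<^bsub>B\<^esub> zq \<theta> q j j"
  \<comment> \<open>By \<open>x_root_pow\<close> this scalar turns the \<open>N\<close>-th power of
    \<open>e i j\<close> into that of the root vector.\<close>
  define s where "s = (- 1) ^ (j - i) * inverse ?l"
  have car: "e k j \<in> carrier B" "?g \<in> carrier B" for k
    using ij z_diag_Units[of j] by (auto intro!: e_closed)
  have x: "?x k = ((- 1) ^ (j - k) * inverse ?l) \<odot>\<^bsub>u\<^esub> p (e k j [^]\<^bsub>B\<^esub> N)" if "i \<le> k" "k < j" for k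
    using that ij car by (simp add: x_root_pow p.hom_smult)
  have pe: "p (e k j [^]\<^bsub>B\<^esub> N) \<in> carrier u" for k using car by (intro p.hom_closed nat_pow_closed)
  have xc: "?x k \<in> carrier u" if "i \<le> k" "k < j" for k using x that pe by simp
  have l: "?l \<noteq> 0" by (rule one_minus_q_nonzero)
  \<comment> \<open>The factor \<open>?l\<close> of \<open>r i k\<close> cancels against its inverse
    in \<open>s\<close>; only signs are left.\<close>
  have coeff: "s * r i k = - \<mu> i k * (- 1) ^ (j - i) * (- 1) ^ (k - i)" if "i < k" for k
    using l neg_one_powi[OF that] by (simp add: s_def r_def)
  define T where "T = \<one>\<^bsub>u\<^esub> \<ominus>\<^bsub>u\<^esub> g_root \<theta> q N n \<mu> i j [^]\<^bsub>u\<^esub> N"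
  have T: "T = p (\<one>\<^bsub>B\<^esub> \<ominus>\<^bsub>B\<^esub> ?g [^]\<^bsub>B\<^esub> N)"
    using car by (simp add: T_def g_root_eq[OF ij] p.hom_minus p.hom_nat_pow)
  have Tc: "T \<in> carrier u" unfolding T using car by (intro p.hom_closed) simp
  define S where "S = (\<Oplus>\<^bsub>u\<^esub>k\<in>?K. (?l * \<mu> i k) \<odot>\<^bsub>u\<^esub> ?x k)"
  have Sc: "S \<in> carrier u" unfolding S_def using xc by (intro p.target.finsum_closed) auto
  have rc: "(\<lambda>k. r i k \<odot>\<^bsub>B\<^esub> e k j [^]\<^bsub>B\<^esub> N) \<in> ?K \<rightarrow> carrier B" using car by auto
  have sumc: "(\<Oplus>\<^bsub>B\<^esub>k\<in>?K. r i k \<odot>\<^bsub>B\<^esub> e k j [^]\<^bsub>B\<^esub> N) \<in> carrier B" by (rule finsum_closed[OF rc])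
  have "s \<odot>\<^bsub>u\<^esub> p (e i j [^]\<^bsub>B\<^esub> N \<oplus>\<^bsub>B\<^esub> (\<Oplus>\<^bsub>B\<^esub>k\<in>?K. r i k \<odot>\<^bsub>B\<^esub> e k j [^]\<^bsub>B\<^esub> N) \<oplus>\<^bsub>B\<^esub>
      r i j \<odot>\<^bsub>B\<^esub> (\<one>\<^bsub>B\<^esub> \<ominus>\<^bsub>B\<^esub> ?g [^]\<^bsub>B\<^esub> N)) = \<zero>\<^bsub>u\<^esub>"
    by (simp only: power_relation[OF ij] p.target.smult_zero_right)
  also have "p (e i j [^]\<^bsub>B\<^esub> N \<oplus>\<^bsub>B\<^esub> (\<Oplus>\<^bsub>B\<^esub>k\<in>?K. r i k \<odot>\<^bsub>B\<^esub> e k j [^]\<^bsub>B\<^esub> N) \<oplus>\<^bsub>B\<^esub>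
      r i j \<odot>\<^bsub>B\<^esub> (\<one>\<^bsub>B\<^esub> \<ominus>\<^bsub>B\<^esub> ?g [^]\<^bsub>B\<^esub> N)) =
      p (e i j [^]\<^bsub>B\<^esub> N) \<oplus>\<^bsub>u\<^esub> p (\<Oplus>\<^bsub>B\<^esub>k\<in>?K. r i k \<odot>\<^bsub>B\<^esub> e k j [^]\<^bsub>B\<^esub> N) \<oplus>\<^bsub>u\<^esub> r i j \<odot>\<^bsub>u\<^esub> T"
    using car sumc by (simp only: p.hom_add p.hom_smult T m_closed a_closed smult_closed nat_pow_closed
        minus_closed one_closed)
  also have "p (\<Oplus>\<^bsub>B\<^esub>k\<in>?K. r i k \<odot>\<^bsub>B\<^esub> e k j [^]\<^bsub>B\<^esub> N) =
      (\<Oplus>\<^bsub>u\<^esub>k\<in>?K. r i k \<odot>\<^bsub>u\<^esub> p (e k j [^]\<^bsub>B\<^esub> N))"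
    using car by (simp add: p.hom_finsum[OF rc] comp_def p.hom_smult)
  also have "s \<odot>\<^bsub>u\<^esub> (p (e i j [^]\<^bsub>B\<^esub> N) \<oplus>\<^bsub>u\<^esub> (\<Oplus>\<^bsub>u\<^esub>k\<in>?K. r i k \<odot>\<^bsub>u\<^esub> p (e k j [^]\<^bsub>B\<^esub> N)) \<oplus>\<^bsub>u\<^esub> r i j \<odot>\<^bsub>u\<^esub> T) =
      s \<odot>\<^bsub>u\<^esub> p (e i j [^]\<^bsub>B\<^esub> N) \<oplus>\<^bsub>u\<^esub> (\<Oplus>\<^bsub>u\<^esub>k\<in>?K. s \<odot>\<^bsub>u\<^esub> (r i k \<odot>\<^bsub>u\<^esub> p (e k j [^]\<^bsub>B\<^esub> N))) \<oplus>\<^bsub>u\<^esub> (s * r i j) \<odot>\<^bsub>u\<^esub> T"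
  proof -
    have "(\<lambda>k. r i k \<odot>\<^bsub>u\<^esub> p (e k j [^]\<^bsub>B\<^esub> N)) \<in> ?K \<rightarrow> carrier u" using pe by auto
    then show ?thesis using pe Tc p.target.finsum_closed
      by (simp add: p.target.smult_add_right p.target.smult_smult p.target.smult_finsum)
  qed
  also have "s \<odot>\<^bsub>u\<^esub> p (e i j [^]\<^bsub>B\<^esub> N) = ?x i" using x[of i] ij by (simp add: s_def)
  also have "(\<Oplus>\<^bsub>u\<^esub>k\<in>?K. s \<odot>\<^bsub>u\<^esub> (r i k \<odot>\<^bsub>u\<^esub> p (e k j [^]\<^bsub>B\<^esub> N))) =
      (\<Oplus>\<^bsub>u\<^esub>k\<in>?K. (- 1) \<odot>\<^bsub>u\<^esub> ((?l * \<mu> i k) \<odot>\<^bsub>u\<^esub> ?x k))"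
  proof (rule p.target.finsum_cong'[OF refl])
    fix k assume k: "k \<in> ?K"
    \<comment> \<open>The exponent \<open>j - i\<close> is the sum of \<open>j - k\<close> and
      \<open>k - i\<close>, so the sign of \<open>k - i\<close> occurs twice.\<close>
    have sgn: "(- 1 :: complex) ^ (j - i) * (- 1) ^ (k - i) = (- 1) ^ (j - k)"
    proof -
      have "j - i = (j - k) + (k - i)" using k by auto
      then show ?thesis by (simp add: power_add mult.assoc flip: power_mult_distrib)
    qed
    \<comment> \<open>A factor \<open>?l\<close> and its inverse are inserted, the latter being part
      of the scalar that relates \<open>?x k\<close> to \<open>e k j\<close>.\<close>
    have "s * r i k = - 1 * (?l * \<mu> i k) * ((- 1) ^ (j - k) * inverse ?l)"
      using k l coeff[of k] sgn by (simp add: mult.assoc)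
    then show "s \<odot>\<^bsub>u\<^esub> (r i k \<odot>\<^bsub>u\<^esub> p (e k j [^]\<^bsub>B\<^esub> N)) = (- 1) \<odot>\<^bsub>u\<^esub> ((?l * \<mu> i k) \<odot>\<^bsub>u\<^esub> ?x k)"
    proof -
      have xk: "?x k = ((- 1) ^ (j - k) * inverse ?l) \<odot>\<^bsub>u\<^esub> p (e k j [^]\<^bsub>B\<^esub> N)"
        by (rule x) (use k in auto)
      show ?thesis unfolding xk
        by (simp only: p.target.smult_smult pe p.target.smult_closed \<open>s * r i k = _\<close> mult.assoc)
    qed
  qed (use xc in auto)
  also have "\<dots> = (- 1) \<odot>\<^bsub>u\<^esub> S"
    unfolding S_def using xc by (intro p.target.smult_finsum[symmetric]) auto
  \<comment> \<open>The case \<open>k = j\<close> of \<open>coeff\<close>, where the two signs are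
    equal and cancel.\<close>
  also have "s * r i j = - \<mu> i j"
    using coeff[OF ij(2)] by (simp add: mult.assoc flip: power_mult_distrib)
  finally have "?x i \<oplus>\<^bsub>u\<^esub> \<ominus>\<^bsub>u\<^esub> S \<oplus>\<^bsub>u\<^esub> \<ominus>\<^bsub>u\<^esub> (\<mu> i j \<odot>\<^bsub>u\<^esub> T) = \<zero>\<^bsub>u\<^esub>"
    using Sc Tc by (simp add: p.target.smult_neg p.target.smult_one)
  then have "?x i \<ominus>\<^bsub>u\<^esub> (\<mu> i j \<odot>\<^bsub>u\<^esub> T \<oplus>\<^bsub>u\<^esub> S) = \<zero>\<^bsub>u\<^esub>"
    using xc[of i] Sc Tc ij
    by (simp add: p.target.minus_eq p.target.minus_add p.target.a_assoc p.target.a_comm[of "\<ominus>\<^bsub>u\<^esub> S"])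
  then have "?x i = \<mu> i j \<odot>\<^bsub>u\<^esub> T \<oplus>\<^bsub>u\<^esub> S"
    using xc[of i] Sc Tc ij by simp
  then show ?thesis by (simp only: T_def S_def)
qed

end

theorem theorem4p2:
  fixes \<theta> N :: nat and q :: complex and n :: "nat \<Rightarrow> nat" and \<mu> :: "nat \<Rightarrow> nat \<Rightarrow> complex"
  assumes "\<theta> \<ge> 1"
    and "odd N" and "N > 7" and "gcd 3 N = 1"
    and "q ^ N = 1" and "\<forall>k. 0 < k \<and> k < N \<longrightarrow> q ^ k \<noteq> 1"
    and "\<forall>i\<in>{1..\<theta>}. 0 < n i \<and> N dvd n i"
    and "root_vector_parameters \<theta> N n \<mu>"
  defines "u \<equiv> lifting \<theta> q N n \<mu>"
    and "x \<equiv> x_root \<theta> q N n \<mu>"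
    and "g \<equiv> g_root \<theta> q N n \<mu>"
  shows "\<forall>i j. 1 \<le> i \<and> i < j \<and> j \<le> \<theta> + 1 \<longrightarrow>
    x i j [^]\<^bsub>u\<^esub> N =
      (\<mu> i j \<odot>\<^bsub>u\<^esub> (\<one>\<^bsub>u\<^esub> \<ominus>\<^bsub>u\<^esub> g i j [^]\<^bsub>u\<^esub> N))
      \<oplus>\<^bsub>u\<^esub> (\<Oplus>\<^bsub>u\<^esub>k\<in>{i + 1..j - 1}. ((1 - q powi (- 2)) ^ N * \<mu> i k) \<odot>\<^bsub>u\<^esub> x k j [^]\<^bsub>u\<^esub> N)"
proof -
  have "type_A_lifting \<theta> N q n"
  proof
    \<comment> \<open>The exponent 2 is positive and smaller than the order
      \<open>N\<close>.\<close>
    show "q\<^sup>2 \<noteq> 1" using assms(3,6) by simp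
    \<comment> \<open>A positive multiple of \<open>N\<close> is at least \<open>N\<close>.\<close>
    show "1 < n i" if "i \<in> {1..\<theta>}" for i
      using assms(3,7) that dvd_imp_le[of N "n i"] by fastforce
  qed (use assms in auto)
  then show ?thesis unfolding u_def x_def g_def
    using type_A_lifting.x_root_power_relation by blast
qed

end
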